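(* Assume that the Maxwell problem is well posed on $D$, that it is uniformly well posed on the family $\mathfrak D=\{\widetilde D_i\}_{i\in\mathbb N}$, and that $\mathfrak D$ is an admissible approximation of $D$ with transformations $\{\mathbf T_i\}_{i\in\mathbb N}$ (all notions as defined in the context). Let $\mathbf E\in\mathbf H_0(\mathbf{curl};D)$ be the unique solution of the Maxwell problem on $D$ and, for each $i\in\mathbb N$, let $\widetilde{\mathbf E}_i\in\mathbf H_0(\mathbf{curl};\widetilde D_i)$ be the unique solution of the Maxwell problem on $\widetilde D_i$. Assume moreover that $\mu^{-1}$, $\epsilon$ and $\mathbf J$ have coefficients in $W^{1,\infty}(D_H)$. Then, for all $i\in\mathbb N$, $$\|\Psi_i\mathbf E-\widetilde{\mathbf E}_i\|_{\mathbf H(\mathbf{curl};\widetilde D_i)}\le C\,d_1(D_H,\mathbf T_i)\left(\|\mathbf E\|_{\mathbf H(\mathbf{curl};D)}+\|\mathbf J\|_{\mathbf W^{1,\infty}(D_H)}\right),$$ where $C>0$ depends on $\omega$, $\mu$, $\epsilon$ and $\mathbf J$ but is independent of $i\in\mathbb N$.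
   Context: Function spaces. For an open bounded Lipschitz domain $\Omega\subset\mathbb R^3$, $\mathbf H(\mathbf{curl};\Omega)=\{\mathbf U\in L^2(\Omega)^3:\mathbf{curl}\,\mathbf U\in L^2(\Omega)^3\}$ (complex-valued fields), with $\|\mathbf U\|^2_{\mathbf H(\mathbf{curl};\Omega)}=\|\mathbf U\|^2_{0,\Omega}+\|\mathbf{curl}\,\mathbf U\|^2_{0,\Omega}$, where $\|\cdot\|_{0,\Omega}$ is the $L^2$-norm; $\mathbf H_0(\mathbf{curl};\Omega)$ is the closed subspace of fields with zero tangential trace $\mathbf n\times\mathbf U=\mathbf 0$ on $\partial\Omega$. Maxwell setting. $D\subset\mathbb R^3$ is a bounded domain with boundary of class $\mathcal C^{\mathfrak M}$, $\mathfrak M\in\mathbb N$; $\omega>0$. $\mathfrak D=\{\widetilde D_i\}_{i\in\mathbb N}$ is a countable family of bounded Lipschitz domains. $D_H$ (the hold-all domain) is an open bounded Lipschitz domain with $\overline D\subset D_H$ and $\overline{\widetilde D_i}\subset D_H$ for all $i$. $\mu,\epsilon$ are complex symmetric $3\times3$ matrix-valued functions with coefficients in $L^\infty(D_H)$, $\mu$ has a pointwise inverse $\mu^{-1}$ a.e. on $D_H$ with coefficients in $L^\infty(D_H)$, and the current $\mathbf J$ is defined on $D_H$ so that $\mathbf F$ below is a bounded antilinear functional on $\mathbf H_0(\mathbf{curl};D_H)$. Elements of $\mathbf H_0(\mathbf{curl};D)$ and $\mathbf H_0(\mathbf{curl};\widetilde D_i)$ are identified with their extensions by zero to $D_H$.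 Set $$\Phi(\mathbf U,\mathbf V)=\int_{D_H}\mu^{-1}\mathbf{curl}\,\mathbf U\cdot\mathbf{curl}\,\overline{\mathbf V}-\omega^2\epsilon\,\mathbf U\cdot\overline{\mathbf V}\,d\mathbf x,\qquad \mathbf F(\mathbf V)=-\imath\omega\int_{D_H}\mathbf J\cdot\overline{\mathbf V}\,d\mathbf x .$$ For $\Omega\in\{D\}\cup\mathfrak D$, the Maxwell problem on $\Omega$ is: find $\mathbf U\in\mathbf H_0(\mathbf{curl};\Omega)$ with $\Phi(\mathbf U,\mathbf V)=\mathbf F(\mathbf V)$ for all $\mathbf V\in\mathbf H_0(\mathbf{curl};\Omega)$. It is called well posed on $\Omega$, with constants $C_1,C_2>0$, if, with $X=\mathbf H_0(\mathbf{curl};\Omega)$ and $\|\cdot\|=\|\cdot\|_{\mathbf H(\mathbf{curl};\Omega)}$: $|\Phi(\mathbf U,\mathbf V)|\le C_1\|\mathbf U\|\|\mathbf V\|$ on $X\times X$; $\sup_{\mathbf U\in X\setminus\{0\}}|\Phi(\mathbf U,\mathbf V)|>0$ for all $\mathbf V\in X\setminus\{0\}$; and $\inf_{\mathbf U\in X\setminus\{0\}}\sup_{\mathbf V\in X\setminus\{0\}}\frac{|\Phi(\mathbf U,\mathbf V)|}{\|\mathbf U\|\|\mathbf V\|}\ge C_2$. It is uniformly well posed on $\mathfrak D$ if it is well posed on every $\widetilde D_i$ with constants independent of $i$. Admissible approximation. $\mathfrak D$ is an admissible approximation of $D$ if there are bijections $\mathbf T_i:D_H\to D_H$ with $\mathbf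 T_i|_{\widetilde D_i}:\widetilde D_i\to D$ (bijectively), $\mathbf T_i,\mathbf T_i^{-1}\in\mathbf W^{1,\infty}(D_H)$, such that, with $d_{n}(D_H,\mathbf T):=\|\mathbf T-\mathsf I\|_{\mathbf W^{n,\infty}(D_H)}+\|\mathbf T^{-1}-\mathsf I\|_{\mathbf W^{n,\infty}(D_H)}$ ($\mathsf I$ the identity map), one has $\lim_{i\to\infty}d_1(D_H,\mathbf T_i)=0$, $d_1(D_H,\mathbf T_i)<1$, $d_1(D_H,\mathbf T_{i+1})<d_1(D_H,\mathbf T_i)$; there is $\vartheta>1$ such that for all $i$ the $L^\infty(D_H)$-norms of $\det(d\mathbf T_i)$, $d\mathbf T_i$, $d\mathbf T_i^{\mathsf{co}}$, $\det(d(\mathbf T_i^{-1}))$, $d(\mathbf T_i^{-1})$, $d(\mathbf T_i^{-1})^{\mathsf{co}}$ all lie in $[\vartheta^{-1},\vartheta]$; and $\det(d\mathbf T_i)>0$ a.e. on $D_H$. Here $d\mathbf T$ is the Jacobian matrix and $\mathbf A^{\mathsf{co}}$ the cofactor matrix, normalized so that $\mathbf A^{-1}=\det(\mathbf A)^{-1}\mathbf A^{\mathsf{co}}$ as in the paper. Pull-back. $\Psi_i:\mathbf H_0(\mathbf{curl};D)\to\mathbf H_0(\mathbf{curl};\widetilde D_i)$, $\Psi_i\mathbf U:=d\mathbf T_i^\top(\mathbf U\circ\mathbf T_i)$, which is an isomorphism. *)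

theory Defs
  imports "HOL-Analysis.Analysis" "HOL-Probability.Essential_Supremum"
begin

text \<open>The dot of the integrands is bilinear; conjugation is always written explicitly.\<close>

definition bdot :: "complex^3 \<Rightarrow> complex^3 \<Rightarrow> complex" (infixl "\<odot>" 70) where
  "u \<odot> v = (\<Sum>k\<in>UNIV. u $ k * v $ k)"

definition conj_vec :: "complex^3 \<Rightarrow> complex^3" where
  "conj_vec v = (\<chi> k. cnj (v $ k))"

definition complex_mat :: "real^3^3 \<Rightarrow> complex^3^3" where
  "complex_mat A = (\<chi> k l. complex_of_real (A $ k $ l))"

text \<open>
  The cofactor matrix in the normalization \<open>A\<^sup>-\<^sup>1 = (det A)\<^sup>-\<^sup>1 A\<^sup>c\<^sup>o\<close>: the entry \<open>(k, l)\<close> is the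
  determinant of \<open>A\<close> with row \<open>l\<close> replaced by the \<open>k\<close>-th unit vector.
\<close>

definition cofactor_matrix :: "real^3^3 \<Rightarrow> real^3^3" where
  "cofactor_matrix A = (\<chi> k l. det (\<chi> m. if m = l then axis k 1 else A $ m))"

lemma matrix_mul_cofactor_matrix: "A ** cofactor_matrix A = mat (det A)"
  by (simp add: vec_eq_iff forall_3 matrix_matrix_mult_def sum_3 cofactor_matrix_def det_3
      axis_def mat_def algebra_simps)

lemma matrix_inv_cofactor_matrix:
  assumes "invertible A"
  shows "matrix_inv A = inverse (det A) *\<^sub>R cofactor_matrix A"
proof -
  have "det A \<noteq> 0"
    using assms by (simp add: invertible_det_nz)
  have "A ** (inverse (det A) *\<^sub>R cofactor_matrix A)
      = inverse (det A) *\<^sub>R (A ** cofactor_matrix A)"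
    by (simp add: vec_eq_iff matrix_matrix_mult_def sum_distrib_left mult_ac)
  also have "\<dots> = mat 1"
    using \<open>det A \<noteq> 0\<close> by (simp add: matrix_mul_cofactor_matrix vec_eq_iff mat_def)
  finally have "A ** (inverse (det A) *\<^sub>R cofactor_matrix A) = mat 1" .
  then have "matrix_inv A ** (A ** (inverse (det A) *\<^sub>R cofactor_matrix A)) = matrix_inv A"
    by simp
  moreover have "matrix_inv A ** A = mat 1"
    using assms unfolding invertible_def matrix_inv_def by (metis (mono_tags, lifting) someI_ex)
  ultimately show ?thesis
    by (simp add: matrix_mul_assoc)
qed

definition partial :: "'n::finite \<Rightarrow> (real^'n \<Rightarrow> 'a::real_normed_vector) \<Rightarrow> real^'n \<Rightarrow> 'a" where
  "partial j f x = frechet_derivative f (at x) (axis j 1)"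

primrec Ck :: "nat \<Rightarrow> (real^'n::finite \<Rightarrow> 'a::real_normed_vector) \<Rightarrow> bool" where
  "Ck 0 f \<longleftrightarrow> continuous_on UNIV f"
| "Ck (Suc k) f \<longleftrightarrow> (\<forall>x. f differentiable (at x)) \<and> (\<forall>j. Ck k (partial j f))"

definition smooth :: "(real^3 \<Rightarrow> 'a::real_normed_vector) \<Rightarrow> bool" where
  "smooth f \<longleftrightarrow> (\<forall>k. Ck k f)"

text \<open>Elements of \<open>C\<^sub>c\<^sup>\<infinity>(\<Omega>)\<close>, extended by zero to the whole space.\<close>

definition test_function :: "(real^3) set \<Rightarrow> (real^3 \<Rightarrow> 'a::real_normed_vector) \<Rightarrow> bool" where
  "test_function \<Omega> \<phi> \<longleftrightarrow> smooth \<phi> \<and> (\<exists>K. compact K \<and> K \<subseteq> \<Omega> \<and> (\<forall>x. x \<notin> K \<longrightarrow> \<phi> x = 0))"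

definition curl :: "(real^3 \<Rightarrow> complex^3) \<Rightarrow> real^3 \<Rightarrow> complex^3" where
  "curl \<phi> x = vector [partial 2 \<phi> x $ 3 - partial 3 \<phi> x $ 2,
                      partial 3 \<phi> x $ 1 - partial 1 \<phi> x $ 3,
                      partial 1 \<phi> x $ 2 - partial 2 \<phi> x $ 1]"

text \<open>
  Near every boundary point and up to an orthogonal change of coordinates, \<open>\<Omega>\<close> is the set of points
  strictly below the graph of a function \<open>g\<close> of class \<open>P\<close>.
\<close>

definition boundary_of_class :: "((real^2 \<Rightarrow> real) \<Rightarrow> bool) \<Rightarrow> (real^3) set \<Rightarrow> bool" where
  "boundary_of_class P \<Omega> \<longleftrightarrow>
     (\<forall>p\<in>frontier \<Omega>. \<exists>r>0. \<exists>(Q :: real^3 \<Rightarrow> real^3) g. orthogonal_transformation Q \<and> P g \<and>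
        (\<forall>x\<in>ball p r. x \<in> \<Omega> \<longleftrightarrow> Q x $ 3 < g (vector [Q x $ 1, Q x $ 2])))"

definition bounded_domain :: "(real^3) set \<Rightarrow> bool" where
  "bounded_domain \<Omega> \<longleftrightarrow> \<Omega> \<noteq> {} \<and> open \<Omega> \<and> connected \<Omega> \<and> bounded \<Omega>"

definition bounded_Lipschitz_domain :: "(real^3) set \<Rightarrow> bool" where
  "bounded_Lipschitz_domain \<Omega> \<longleftrightarrow>
     bounded_domain \<Omega> \<and> boundary_of_class (\<lambda>g. \<exists>L::real. L-lipschitz_on UNIV g) \<Omega>"

definition bounded_Ck_domain :: "nat \<Rightarrow> (real^3) set \<Rightarrow> bool" where
  "bounded_Ck_domain k \<Omega> \<longleftrightarrow> bounded_domain \<Omega> \<and> boundary_of_class (Ck k) \<Omega>"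

definition locally_integrable ::
  "(real^3) set \<Rightarrow> (real^3 \<Rightarrow> 'a::{banach, second_countable_topology}) \<Rightarrow> bool" where
  "locally_integrable \<Omega> f \<longleftrightarrow> (\<forall>K. compact K \<and> K \<subseteq> \<Omega> \<longrightarrow> set_integrable lebesgue K f)"

definition Linf :: "(real^3) set \<Rightarrow> (real^3 \<Rightarrow> 'a::euclidean_space) \<Rightarrow> bool" where
  "Linf \<Omega> f \<longleftrightarrow> f \<in> borel_measurable (lebesgue_on \<Omega>) \<and>
                (\<exists>c. AE x in lebesgue_on \<Omega>. norm (f x) \<le> c)"

text \<open>The pointwise norm of vectors (matrices) is the Euclidean (Frobenius) norm.\<close>

definition Linf_norm :: "(real^3) set \<Rightarrow> (real^3 \<Rightarrow> 'a::euclidean_space) \<Rightarrow> real" where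
  "Linf_norm \<Omega> f = real_of_ereal (esssup (lebesgue_on \<Omega>) (\<lambda>x. ereal (norm (f x))))"

definition has_weak_partial ::
  "(real^3) set \<Rightarrow> 3 \<Rightarrow> (real^3 \<Rightarrow> 'a::euclidean_space) \<Rightarrow> (real^3 \<Rightarrow> 'a) \<Rightarrow> bool" where
  "has_weak_partial \<Omega> j f g \<longleftrightarrow> locally_integrable \<Omega> f \<and> locally_integrable \<Omega> g \<and>
     (\<forall>\<phi>::real^3 \<Rightarrow> real. test_function \<Omega> \<phi> \<longrightarrow>
        (LINT x|lebesgue_on \<Omega>. partial j \<phi> x *\<^sub>R f x) = - (LINT x|lebesgue_on \<Omega>. \<phi> x *\<^sub>R g x))"

text \<open>Weak derivatives are determined up to null sets only; one representative is selected.\<close>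

definition weak_partial ::
  "(real^3) set \<Rightarrow> 3 \<Rightarrow> (real^3 \<Rightarrow> 'a::euclidean_space) \<Rightarrow> real^3 \<Rightarrow> 'a" where
  "weak_partial \<Omega> j f = (SOME g. has_weak_partial \<Omega> j f g)"

definition W1inf :: "(real^3) set \<Rightarrow> (real^3 \<Rightarrow> 'a::euclidean_space) \<Rightarrow> bool" where
  "W1inf \<Omega> f \<longleftrightarrow> Linf \<Omega> f \<and> (\<forall>j. \<exists>g. has_weak_partial \<Omega> j f g \<and> Linf \<Omega> g)"

definition W1inf_norm :: "(real^3) set \<Rightarrow> (real^3 \<Rightarrow> 'a::euclidean_space) \<Rightarrow> real" where
  "W1inf_norm \<Omega> f = max (Linf_norm \<Omega> f) (MAX j\<in>UNIV. Linf_norm \<Omega> (weak_partial \<Omega> j f))"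

definition weak_jacobian :: "(real^3) set \<Rightarrow> (real^3 \<Rightarrow> real^3) \<Rightarrow> real^3 \<Rightarrow> real^3^3" where
  "weak_jacobian \<Omega> T x = (\<chi> k j. weak_partial \<Omega> j T x $ k)"

definition L2 :: "(real^3) set \<Rightarrow> (real^3 \<Rightarrow> complex^3) \<Rightarrow> bool" where
  "L2 \<Omega> U \<longleftrightarrow> U \<in> borel_measurable (lebesgue_on \<Omega>) \<and>
              integrable (lebesgue_on \<Omega>) (\<lambda>x. (norm (U x))\<^sup>2)"

definition L2_norm :: "(real^3) set \<Rightarrow> (real^3 \<Rightarrow> complex^3) \<Rightarrow> real" where
  "L2_norm \<Omega> U = sqrt (LINT x|lebesgue_on \<Omega>. (norm (U x))\<^sup>2)"

definition has_weak_curl ::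
  "(real^3) set \<Rightarrow> (real^3 \<Rightarrow> complex^3) \<Rightarrow> (real^3 \<Rightarrow> complex^3) \<Rightarrow> bool" where
  "has_weak_curl \<Omega> U W \<longleftrightarrow> locally_integrable \<Omega> U \<and> locally_integrable \<Omega> W \<and>
     (\<forall>\<phi>. test_function \<Omega> \<phi> \<longrightarrow>
        (LINT x|lebesgue_on \<Omega>. U x \<odot> curl \<phi> x) = (LINT x|lebesgue_on \<Omega>. W x \<odot> \<phi> x))"

definition weak_curl :: "(real^3) set \<Rightarrow> (real^3 \<Rightarrow> complex^3) \<Rightarrow> real^3 \<Rightarrow> complex^3" where
  "weak_curl \<Omega> U = (SOME W. has_weak_curl \<Omega> U W)"

definition Hcurl :: "(real^3) set \<Rightarrow> (real^3 \<Rightarrow> complex^3) set" where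
  "Hcurl \<Omega> = {U. L2 \<Omega> U \<and> (\<exists>W. has_weak_curl \<Omega> U W \<and> L2 \<Omega> W)}"

definition Hcurl_norm :: "(real^3) set \<Rightarrow> (real^3 \<Rightarrow> complex^3) \<Rightarrow> real" where
  "Hcurl_norm \<Omega> U = sqrt ((L2_norm \<Omega> U)\<^sup>2 + (L2_norm \<Omega> (weak_curl \<Omega> U))\<^sup>2)"

text \<open>
  For \<open>U \<in> H(curl; \<Omega>)\<close> the tangential trace \<open>n \<times> U\<close> is the functional on boundary values of fields
  \<open>\<phi>\<close> that Green's formula
  \<open>\<integral>\<^sub>\<Omega> curl U \<cdot> \<phi> - U \<cdot> curl \<phi> dx = \<integral>\<^sub>\<partial>\<^sub>\<Omega> (n \<times> U) \<cdot> \<phi> dS\<close>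
  defines; it suffices to test with restrictions of smooth fields, which are dense in \<open>H\<^sup>1(\<Omega>)\<close>.
\<close>

definition tangential_trace ::
  "(real^3) set \<Rightarrow> (real^3 \<Rightarrow> complex^3) \<Rightarrow> (real^3 \<Rightarrow> complex^3) \<Rightarrow> complex" where
  "tangential_trace \<Omega> U \<phi> =
     (LINT x|lebesgue_on \<Omega>. weak_curl \<Omega> U x \<odot> \<phi> x - U x \<odot> curl \<phi> x)"

text \<open>Elements are identified with their extensions by zero, hence they vanish outside \<open>\<Omega>\<close>.\<close>

definition H0curl :: "(real^3) set \<Rightarrow> (real^3 \<Rightarrow> complex^3) set" where
  "H0curl \<Omega> = {U \<in> Hcurl \<Omega>. (\<forall>\<phi>. smooth \<phi> \<longrightarrow> tangential_trace \<Omega> U \<phi> = 0) \<and>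
                            (\<forall>x. x \<notin> \<Omega> \<longrightarrow> U x = 0)}"

text \<open>The nonzero elements; zero is meant in the almost everywhere sense.\<close>

definition H0curl_nz :: "(real^3) set \<Rightarrow> (real^3 \<Rightarrow> complex^3) set" where
  "H0curl_nz \<Omega> = {U \<in> H0curl \<Omega>. \<not> (AE x in lebesgue_on \<Omega>. U x = 0)}"

definition Phi :: "(real^3) set \<Rightarrow> real \<Rightarrow> (real^3 \<Rightarrow> complex^3^3) \<Rightarrow> (real^3 \<Rightarrow> complex^3^3) \<Rightarrow>
    (real^3 \<Rightarrow> complex^3) \<Rightarrow> (real^3 \<Rightarrow> complex^3) \<Rightarrow> complex" where
  "Phi DH \<omega> \<mu> \<epsilon> U V = (LINT x|lebesgue_on DH.
     (matrix_inv (\<mu> x) *v weak_curl DH U x) \<odot> weak_curl DH (\<lambda>y. conj_vec (V y)) x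
       - complex_of_real (\<omega>\<^sup>2) * ((\<epsilon> x *v U x) \<odot> conj_vec (V x)))"

definition Frhs :: "(real^3) set \<Rightarrow> real \<Rightarrow> (real^3 \<Rightarrow> complex^3) \<Rightarrow> (real^3 \<Rightarrow> complex^3) \<Rightarrow> complex"
  where
  "Frhs DH \<omega> J V = - \<i> * complex_of_real \<omega> * (LINT x|lebesgue_on DH. J x \<odot> conj_vec (V x))"

text \<open>
  Antilinearity of \<open>Frhs DH \<omega> J\<close> is automatic once the integrals exist, so only existence of the
  integrals and boundedness are required.
\<close>

definition maxwell_data :: "(real^3) set \<Rightarrow> real \<Rightarrow> (real^3 \<Rightarrow> complex^3^3) \<Rightarrow>
    (real^3 \<Rightarrow> complex^3^3) \<Rightarrow> (real^3 \<Rightarrow> complex^3) \<Rightarrow> bool" where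
  "maxwell_data DH \<omega> \<mu> \<epsilon> J \<longleftrightarrow> \<omega> > 0 \<and>
     (\<forall>k l. Linf DH (\<lambda>x. \<mu> x $ k $ l)) \<and> (\<forall>k l. Linf DH (\<lambda>x. \<epsilon> x $ k $ l)) \<and>
     (AE x in lebesgue_on DH. transpose (\<mu> x) = \<mu> x \<and> transpose (\<epsilon> x) = \<epsilon> x) \<and>
     (AE x in lebesgue_on DH. invertible (\<mu> x)) \<and>
     (\<forall>k l. Linf DH (\<lambda>x. matrix_inv (\<mu> x) $ k $ l)) \<and>
     (\<exists>K. \<forall>V\<in>H0curl DH. integrable (lebesgue_on DH) (\<lambda>x. J x \<odot> conj_vec (V x)) \<and>
                         cmod (Frhs DH \<omega> J V) \<le> K * Hcurl_norm DH V)"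

definition maxwell_solution :: "(real^3) set \<Rightarrow> real \<Rightarrow> (real^3 \<Rightarrow> complex^3^3) \<Rightarrow>
    (real^3 \<Rightarrow> complex^3^3) \<Rightarrow> (real^3 \<Rightarrow> complex^3) \<Rightarrow> (real^3) set \<Rightarrow> (real^3 \<Rightarrow> complex^3) \<Rightarrow> bool"
  where
  "maxwell_solution DH \<omega> \<mu> \<epsilon> J \<Omega> U \<longleftrightarrow>
     U \<in> H0curl \<Omega> \<and> (\<forall>V\<in>H0curl \<Omega>. Phi DH \<omega> \<mu> \<epsilon> U V = Frhs DH \<omega> J V)"

definition well_posed :: "(real^3) set \<Rightarrow> real \<Rightarrow> (real^3 \<Rightarrow> complex^3^3) \<Rightarrow>
    (real^3 \<Rightarrow> complex^3^3) \<Rightarrow> (real^3) set \<Rightarrow> real \<Rightarrow> real \<Rightarrow> bool" where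
  "well_posed DH \<omega> \<mu> \<epsilon> \<Omega> C1 C2 \<longleftrightarrow>
     (\<forall>U\<in>H0curl \<Omega>. \<forall>V\<in>H0curl \<Omega>.
        cmod (Phi DH \<omega> \<mu> \<epsilon> U V) \<le> C1 * Hcurl_norm \<Omega> U * Hcurl_norm \<Omega> V) \<and>
     (\<forall>V\<in>H0curl_nz \<Omega>. (SUP U\<in>H0curl_nz \<Omega>. ereal (cmod (Phi DH \<omega> \<mu> \<epsilon> U V))) > 0) \<and>
     (INF U\<in>H0curl_nz \<Omega>. SUP V\<in>H0curl_nz \<Omega>.
        ereal (cmod (Phi DH \<omega> \<mu> \<epsilon> U V) / (Hcurl_norm \<Omega> U * Hcurl_norm \<Omega> V))) \<ge> ereal C2"

definition uniformly_well_posed :: "(real^3) set \<Rightarrow> real \<Rightarrow> (real^3 \<Rightarrow> complex^3^3) \<Rightarrow>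
    (real^3 \<Rightarrow> complex^3^3) \<Rightarrow> (nat \<Rightarrow> (real^3) set) \<Rightarrow> bool" where
  "uniformly_well_posed DH \<omega> \<mu> \<epsilon> Dt \<longleftrightarrow>
     (\<exists>C1>0. \<exists>C2>0. \<forall>i. well_posed DH \<omega> \<mu> \<epsilon> (Dt i) C1 C2)"

definition d1 :: "(real^3) set \<Rightarrow> (real^3 \<Rightarrow> real^3) \<Rightarrow> real" where
  "d1 DH T = W1inf_norm DH (\<lambda>x. T x - x) + W1inf_norm DH (\<lambda>x. inv_into DH T x - x)"

text \<open>
  A transformation in \<open>W\<^sup>1\<^sup>,\<^sup>\<infinity>\<close> that is used pointwise (as a bijection, and in compositions) is its
  continuous representative; hence the two continuity requirements.
\<close>

definition admissible_approximation :: "(real^3) set \<Rightarrow> (real^3) set \<Rightarrow> (nat \<Rightarrow> (real^3) set) \<Rightarrow>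
    (nat \<Rightarrow> real^3 \<Rightarrow> real^3) \<Rightarrow> bool" where
  "admissible_approximation DH D Dt T \<longleftrightarrow>
     (\<forall>i. bij_betw (T i) DH DH \<and> bij_betw (T i) (Dt i) D \<and>
          continuous_on DH (T i) \<and> continuous_on DH (inv_into DH (T i)) \<and>
          W1inf DH (T i) \<and> W1inf DH (inv_into DH (T i))) \<and>
     (\<lambda>i. d1 DH (T i)) \<longlonglongrightarrow> 0 \<and>
     (\<forall>i. d1 DH (T i) < 1) \<and>
     (\<forall>i. d1 DH (T (Suc i)) < d1 DH (T i)) \<and>
     (\<exists>\<theta>>1. \<forall>i. \<forall>S\<in>{T i, inv_into DH (T i)}.
        Linf_norm DH (\<lambda>x. det (weak_jacobian DH S x)) \<in> {inverse \<theta>..\<theta>} \<and>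
        Linf_norm DH (weak_jacobian DH S) \<in> {inverse \<theta>..\<theta>} \<and>
        Linf_norm DH (\<lambda>x. cofactor_matrix (weak_jacobian DH S x)) \<in> {inverse \<theta>..\<theta>}) \<and>
     (\<forall>i. AE x in lebesgue_on DH. det (weak_jacobian DH (T i) x) > 0)"

definition pull_back :: "(real^3) set \<Rightarrow> (real^3) set \<Rightarrow> (real^3 \<Rightarrow> real^3) \<Rightarrow>
    (real^3 \<Rightarrow> complex^3) \<Rightarrow> real^3 \<Rightarrow> complex^3" where
  "pull_back DH \<Omega> T U x =
     (if x \<in> \<Omega> then complex_mat (transpose (weak_jacobian DH T x)) *v U (T x) else 0)"

end

(*
  Let d = d_1(D_H, T_i), A = dT_i, and let e be the pull-back of E minus the solution on the
  approximate domain. Testing the problem on D with the pull-back under the inverse of T_i of a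
  field V, and changing variables, writes Phi(e, V) as a difference of two forms on the approximate
  domain. Since cof A = det A A^-1, their coefficients differ only through cof A - I, A^T - I and
  mu^-1 o T_i - mu^-1, eps o T_i - eps, J o T_i - J, all of size O(d). The uniform inf-sup
  condition then bounds e. This argument needs d to be small, so that segments from x to T_i x stay
  in D_H; the finitely many remaining indices are absorbed into the constant because d > 0, unless E
  and J vanish, in which case e = 0.

  That the pull-back maps H_0(curl; D) to H_0(curl) of the approximate domain is shown by duality:
  the zero tangential trace of U is tested with pull-backs of smooth fields under mollifications of
  the inverse transformation, for which the transformation rule of the curl is classical, and the
  mollification parameter tends to zero. The change of variables rests on Rademacher's theorem,
  obtained at the Lebesgue points of the weak gradient.
*)

theory Submission
  imports Defs
begin

section \<open>Functions of class Ck\<close>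

text \<open>Two obstacles shape the development. First, \<open>weak_partial\<close> and
  \<open>weak_curl\<close> pick some representative, so identities for differences, conjugates,
  extensions and compositions hold for the picked functions only almost everywhere. Arguments
  therefore carry an explicit witness, as in \<open>zero_trace_curl \<Omega> U W\<close>, and return
  to the picked representative by uniqueness, which rests on \<open>fundamental_lemma\<close>.
  Second, coefficients, Jacobians and fields are known only up to null sets, but are composed with a
  transformation. Both the transformation and its inverse must then preserve null sets, which is why
  \<open>W1inf_homeo\<close> treats them symmetrically. It also yields the lower bound on the
  Jacobian determinant: the determinants of the two Jacobians multiply to 1, and each is bounded
  above. Estimates are made on matrix entries, not operator norms; the factors 3 and 9 in the
  constants count coordinates and entries. Since \<open>D_H\<close> need not be convex, Lipschitz
  bounds are available only on balls inside it, always with the factor 3 from summing three partial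
  derivatives.\<close>

lemma vec_as_sum_axis: "(h::real^'n::finite) = (\<Sum>j\<in>UNIV. h$j *\<^sub>R axis j 1)"
  by (simp add: vec_eq_iff axis_def if_distrib cong: if_cong)

lemma partial_eqI: "(f has_derivative f') (at x) \<Longrightarrow> partial j f x = f' (axis j 1)"
  using frechet_derivative_at[of f f' x] by (simp add: partial_def)

lemma sum_axis_scaleR: "(\<Sum>l\<in>UNIV. (axis j 1 :: real^'n::finite) $ l *\<^sub>R c l) = (c j :: 'a::real_normed_vector)"
proof -
  have "(axis j 1 :: real^'n) $ l *\<^sub>R c l = (if l = j then c l else 0)" for l
    by (simp add: axis_def)
  then show ?thesis by simp
qed

text \<open>The normal form for derivatives: each rule for \<open>partial\<close> below starts from
  it, applies a \<open>has_derivative\<close> rule, evaluates at a coordinate vector by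
  \<open>partial_eqI\<close>, and collapses the sum by \<open>sum_axis_scaleR\<close>.\<close>

lemma has_derivative_partial:
  fixes f :: "real^'n::finite \<Rightarrow> 'a::real_normed_vector"
  assumes "f differentiable (at x)"
  shows "(f has_derivative (\<lambda>h. \<Sum>j\<in>UNIV. h$j *\<^sub>R partial j f x)) (at x)"
proof -
  have d: "(f has_derivative frechet_derivative f (at x)) (at x)"
    using assms frechet_derivative_works by blast
  interpret linear "frechet_derivative f (at x)"
    using d has_derivative_linear by blast
  have "frechet_derivative f (at x) h = (\<Sum>j\<in>UNIV. h$j *\<^sub>R partial j f x)" for h
  proof -
    have "frechet_derivative f (at x) h
        = frechet_derivative f (at x) (\<Sum>j\<in>UNIV. h$j *\<^sub>R axis j 1)"
      using vec_as_sum_axis[of h] by simp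
    also have "\<dots> = (\<Sum>j\<in>UNIV. h$j *\<^sub>R partial j f x)"
      by (simp add: sum scaleR partial_def)
    finally show ?thesis .
  qed
  then have "frechet_derivative f (at x) = (\<lambda>h. \<Sum>j\<in>UNIV. h$j *\<^sub>R partial j f x)"
    by (rule ext)
  then show ?thesis
    using d by simp
qed

lemma Ck_imp_continuous: "Ck k f \<Longrightarrow> continuous_on UNIV f"
  by (cases k) (auto intro!: continuous_at_imp_continuous_on differentiable_imp_continuous_within)

lemma Ck_Suc_imp: "Ck (Suc k) f \<Longrightarrow> Ck k f"
proof (induction k arbitrary: f)
  case 0
  then show ?case using Ck_imp_continuous[of "Suc 0" f] by simp
next
  case (Suc k)
  then show ?case by (metis Ck.simps(2))
qed

lemma Ck_const: "Ck k (\<lambda>x::real^'n::finite. c)"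
proof (induction k arbitrary: c)
  case (Suc k)
  have "partial j (\<lambda>x. c) = (\<lambda>x. 0)" for j :: 'n
    by (rule ext, subst partial_eqI[of "\<lambda>x. c" "\<lambda>x. 0"]) auto
  then show ?case using Suc by simp
qed simp

lemma Ck_add: "Ck k f \<Longrightarrow> Ck k g \<Longrightarrow> Ck k (\<lambda>x. f x + g x)"
proof (induction k arbitrary: f g)
  case 0
  then show ?case by (auto intro!: continuous_intros)
next
  case (Suc k)
  have "partial j (\<lambda>x. f x + g x) = (\<lambda>x. partial j f x + partial j g x)" for j
  proof
    fix x
    have "(f has_derivative (\<lambda>h. \<Sum>j\<in>UNIV. h$j *\<^sub>R partial j f x)) (at x)"
      "(g has_derivative (\<lambda>h. \<Sum>j\<in>UNIV. h$j *\<^sub>R partial j g x)) (at x)"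
      using Suc.prems by (auto intro: has_derivative_partial)
    from partial_eqI[OF has_derivative_add[OF this]]
    show "partial j (\<lambda>x. f x + g x) x = partial j f x + partial j g x" by (simp add: sum_axis_scaleR)
  qed
  then show ?case using Suc by simp
qed

lemma (in bounded_linear) Ck_comp: "Ck k g \<Longrightarrow> Ck k (\<lambda>x. f (g x))"
proof (induction k arbitrary: g)
  case 0
  then show ?case by (auto intro!: continuous_on continuous_intros)
next
  case (Suc k)
  have "partial j (\<lambda>x. f (g x)) = (\<lambda>x. f (partial j g x))" for j
  proof
    fix x
    have "(g has_derivative (\<lambda>h. \<Sum>j\<in>UNIV. h$j *\<^sub>R partial j g x)) (at x)"
      using Suc.prems by (auto intro: has_derivative_partial)
    from partial_eqI[OF has_derivative[OF this]]
    show "partial j (\<lambda>x. f (g x)) x = f (partial j g x)" by (simp add: sum_axis_scaleR)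
  qed
  moreover have "(\<lambda>x. f (g x)) differentiable at x" for x
  proof -
    obtain g' where "(g has_derivative g') (at x)"
      using Suc.prems by (auto simp: differentiable_def)
    from has_derivative[OF this] show ?thesis
      unfolding differentiable_def by blast
  qed
  ultimately show ?case using Suc by simp
qed

lemma (in bounded_bilinear) partial_prod:
  assumes "f differentiable (at x)" "g differentiable (at x)"
  shows "partial j (\<lambda>x. prod (f x) (g x)) x = prod (f x) (partial j g x) + prod (partial j f x) (g x)"
proof -
  have d: "(f has_derivative (\<lambda>h. \<Sum>j\<in>UNIV. h$j *\<^sub>R partial j f x)) (at x)"
      "(g has_derivative (\<lambda>h. \<Sum>j\<in>UNIV. h$j *\<^sub>R partial j g x)) (at x)"
    using assms by (auto intro: has_derivative_partial)
  from partial_eqI[OF FDERIV[OF this]]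
  show ?thesis by (simp add: sum_axis_scaleR)
qed

lemma (in bounded_bilinear) Ck_prod:
  "Ck k f \<Longrightarrow> Ck k g \<Longrightarrow> Ck k (\<lambda>x. prod (f x) (g x))"
proof (induction k arbitrary: f g)
  case 0
  then show ?case by (auto intro!: continuous_on)
next
  case (Suc k)
  have "partial j (\<lambda>x. prod (f x) (g x))
      = (\<lambda>x. prod (f x) (partial j g x) + prod (partial j f x) (g x))" for j
  proof
    fix x
    have "f differentiable at x" "g differentiable at x" using Suc.prems by auto
    then show "partial j (\<lambda>x. prod (f x) (g x)) x
        = prod (f x) (partial j g x) + prod (partial j f x) (g x)"
      by (rule partial_prod)
  qed
  moreover have "(\<lambda>x. prod (f x) (g x)) differentiable at x" for x
  proof -
    have "f differentiable at x" "g differentiable at x" using Suc.prems by auto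
    then show ?thesis
      using FDERIV[of f _ x UNIV g] unfolding differentiable_def by blast
  qed
  moreover have "Ck k (\<lambda>x. prod (f x) (partial j g x) + prod (partial j f x) (g x))" for j
  proof -
    \<comment> \<open>The Leibniz rule pairs each derivative, of order \<open>k\<close> only, with
      an undifferentiated factor, which is lowered to the same order.\<close>
    have "Ck k f" "Ck k g" "Ck k (partial j f)" "Ck k (partial j g)"
      using Suc.prems Ck_Suc_imp[of k f] Ck_Suc_imp[of k g] by auto
    then show ?thesis
      by (intro Ck_add Suc.IH)
  qed
  ultimately show ?case by simp
qed

lemmas Ck_scaleR = bounded_bilinear.Ck_prod[OF bounded_bilinear_scaleR]
lemmas Ck_mult = bounded_bilinear.Ck_prod[OF bounded_bilinear_mult]
lemmas Ck_cmult = bounded_linear.Ck_comp[OF bounded_linear_mult_right]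
lemmas Ck_cscaleR = bounded_linear.Ck_comp[OF bounded_linear_scaleR_right]
lemmas Ck_nth = bounded_linear.Ck_comp[OF bounded_linear_vec_nth]

lemma Ck_sum: "(\<And>i. i \<in> I \<Longrightarrow> Ck k (f i)) \<Longrightarrow> Ck k (\<lambda>x. \<Sum>i\<in>I. f i x)"
proof (induction I rule: infinite_finite_induct)
  case (insert i I)
  then show ?case by (simp add: Ck_add)
qed (simp_all add: Ck_const)

lemma Ck_prod: "(\<And>i. i \<in> I \<Longrightarrow> Ck k (f i)) \<Longrightarrow> Ck k (\<lambda>x. \<Prod>i\<in>I. f i x :: real)"
proof (induction I rule: infinite_finite_induct)
  case (insert i I)
  then show ?case by (simp add: Ck_mult)
qed (simp_all add: Ck_const)

lemma Ck_linear: "bounded_linear f \<Longrightarrow> Ck k f"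
proof (cases k)
  case 0
  assume "bounded_linear f"
  then show ?thesis using 0 by (simp add: linear_continuous_on)
next
  case (Suc n)
  assume f: "bounded_linear f"
  then have d: "(f has_derivative f) (at x)" for x
    by (rule bounded_linear_imp_has_derivative)
  have "partial j f = (\<lambda>x. f (axis j 1))" for j
    using partial_eqI[OF d] by blast
  then show ?thesis using Suc d Ck_const by (auto simp: differentiable_def)
qed

lemma partial_compose:
  fixes f :: "real^'m::finite \<Rightarrow> 'a::real_normed_vector" and g :: "real^'n::finite \<Rightarrow> real^'m"
  assumes "f differentiable (at (g x))" "g differentiable (at x)"
  shows "partial j (\<lambda>x. f (g x)) x = (\<Sum>l\<in>UNIV. (partial j g x $ l) *\<^sub>R partial l f (g x))"
proof -
  have d: "(f has_derivative (\<lambda>h. \<Sum>j\<in>UNIV. h$j *\<^sub>R partial j f (g x))) (at (g x))"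
      "(g has_derivative (\<lambda>h. \<Sum>j\<in>UNIV. h$j *\<^sub>R partial j g x)) (at x)"
    using assms by (auto intro: has_derivative_partial)
  from partial_eqI[OF diff_chain_at[OF d(2,1), unfolded o_def]]
  show ?thesis by (simp add: o_def sum_axis_scaleR)
qed

text \<open>The induction generalises over \<open>f\<close> alone: the chain rule composes the
  partials of \<open>f\<close> with the same \<open>g\<close>, and the partials of \<open>g\<close>
  occur only as factors.\<close>

lemma Ck_compose:
  fixes f :: "real^'m::finite \<Rightarrow> 'a::real_normed_vector" and g :: "real^'n::finite \<Rightarrow> real^'m"
  shows "Ck k f \<Longrightarrow> Ck k g \<Longrightarrow> Ck k (\<lambda>x. f (g x))"
proof (induction k arbitrary: f)
  case 0
  then show ?case by (auto intro: continuous_on_compose2)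
next
  case (Suc k)
  have "partial j (\<lambda>x. f (g x)) = (\<lambda>x. \<Sum>l\<in>UNIV. (partial j g x $ l) *\<^sub>R partial l f (g x))" for j
    using Suc.prems by (auto intro!: partial_compose)
  moreover have "(\<lambda>x. f (g x)) differentiable at x" for x
    using Suc.prems differentiable_chain_at[of g x f] by (auto simp: o_def)
  moreover have "Ck k (\<lambda>x. \<Sum>l\<in>UNIV. (partial j g x $ l) *\<^sub>R partial l f (g x))" for j
    using Suc Ck_Suc_imp[OF Suc.prems(2)] by (intro Ck_sum Ck_scaleR Ck_nth Suc.IH) auto
  ultimately show ?case by simp
qed

lemma partial_nth: "f differentiable (at x) \<Longrightarrow> partial j (\<lambda>x. f x $ k) x = partial j f x $ k"
proof -
  assume "f differentiable (at x)"
  then have d: "(f has_derivative (\<lambda>h. \<Sum>j\<in>UNIV. h$j *\<^sub>R partial j f x)) (at x)"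
    by (rule has_derivative_partial)
  from partial_eqI[OF bounded_linear.has_derivative[OF bounded_linear_vec_nth d]]
  show ?thesis by (simp add: sum_axis_scaleR)
qed

lemma Ck_vec:
  fixes f :: "real^'n::finite \<Rightarrow> ('a::real_normed_vector)^'m::finite"
  assumes "\<And>i. Ck k (\<lambda>x. f x $ i)"
  shows "Ck k f"
  using assms
proof (induction k arbitrary: f)
  case 0
  then show ?case by (auto simp: continuous_on_def intro!: vec_tendstoI)
next
  case (Suc k)
  have "(f has_derivative (\<lambda>h. \<chi> i. frechet_derivative (\<lambda>x. f x $ i) (at x) h)) (at x)" for x
  proof -
    have d: "((\<lambda>x. f x $ i) has_derivative frechet_derivative (\<lambda>x. f x $ i) (at x)) (at x)" for i
      using Suc.prems frechet_derivative_works by force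
    show ?thesis
      unfolding has_derivative_within
    proof (rule conjI)
      have "linear (\<lambda>h. \<chi> i. frechet_derivative (\<lambda>x. f x $ i) (at x) h)"
        by (rule linearI)
           (auto simp: vec_eq_iff linear_add[OF has_derivative_linear[OF d]] linear_cmul[OF has_derivative_linear[OF d]])
      then show "bounded_linear (\<lambda>h. \<chi> i. frechet_derivative (\<lambda>x. f x $ i) (at x) h)"
        by (rule linear_conv_bounded_linear[THEN iffD1])
      show "((\<lambda>y. (1 / norm (y - x)) *\<^sub>R (f y - (f x +
           (\<chi> i. frechet_derivative (\<lambda>x. f x $ i) (at x) (y - x))))) \<longlongrightarrow> 0) (at x)"
        using d[unfolded has_derivative_within] by (intro vec_tendstoI) simp
    qed
  qed
  then have df: "f differentiable at x" for x
    by (auto simp: differentiable_def)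
  have "Ck k (partial j f)" for j
  proof (rule Suc.IH)
    fix i
    have "(\<lambda>x. partial j f x $ i) = partial j (\<lambda>x. f x $ i)"
      using partial_nth[OF df] by fastforce
    then show "Ck k (\<lambda>x. partial j f x $ i)"
      using Suc.prems by simp
  qed
  with df show ?case by simp
qed

lemma smoothD: "smooth f \<Longrightarrow> Ck k f"
  by (simp add: smooth_def)

lemma smooth_differentiable: "smooth f \<Longrightarrow> f differentiable (at x)"
  using smoothD[of f "Suc 0"] by simp

lemma smooth_partial: "smooth f \<Longrightarrow> smooth (partial j f)"
  unfolding smooth_def by (metis Ck.simps(2))

lemma smooth_continuous: "smooth f \<Longrightarrow> continuous_on S f"
  using smoothD[of f 0] continuous_on_subset by auto

text \<open>The classical \<open>exp (-1/t)\<close>, with a power of \<open>t\<close> in the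
  denominator so that the family is closed under differentiation: the derivative of order
  \<open>k\<close> combines the orders \<open>k + 1\<close> and \<open>k + 2\<close>. Smoothness at
  the origin then needs a single limit.\<close>

definition flat_exp :: "nat \<Rightarrow> real \<Rightarrow> real" where
  "flat_exp k t = (if t > 0 then exp (- 1 / t) / t ^ k else 0)"

text \<open>With s = 1/t the right-hand limit is the decay of s^k / exp s at infinity; to the left
  of 0 the function vanishes.\<close>

lemma flat_exp_tendsto_0: "(flat_exp k \<longlongrightarrow> 0) (at 0)"
proof -
  have "((\<lambda>t::real. (1/t) ^ k / exp (1/t)) \<longlongrightarrow> 0) (at_right 0)"
    using filterlim_compose[OF tendsto_power_div_exp_0[of k] filterlim_inverse_at_top_right]
    by (simp add: inverse_eq_divide)
  then have "(flat_exp k \<longlongrightarrow> 0) (at_right 0)"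
    by (rule Lim_transform_eventually)
       (auto simp: eventually_at_filter flat_exp_def exp_minus field_simps)
  moreover have "(flat_exp k \<longlongrightarrow> 0) (at_left 0)"
    by (rule tendsto_eventually) (auto simp: eventually_at_filter flat_exp_def)
  ultimately show ?thesis
    using filterlim_split_at by blast
qed

lemma flat_exp_has_derivative:
  "(flat_exp k has_field_derivative (flat_exp (k + 2) t - k * flat_exp (k + 1) t)) (at t)"
proof -
  consider "t > 0" | "t < 0" | "t = 0" by linarith
  then show ?thesis
  proof cases
    case 1
    have "((\<lambda>t. exp (- 1 / t) / t ^ k) has_field_derivative
        (flat_exp (k + 2) t - k * flat_exp (k + 1) t)) (at t)"
      using 1 by (auto intro!: derivative_eq_intros simp: flat_exp_def field_simps power2_eq_square)
        (cases k; simp add: field_simps)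
    then show ?thesis
      by (rule DERIV_cong_ev[THEN iffD1, rotated 3])
         (use 1 eventually_nhds_in_open[of "{0<..}" t] in \<open>auto simp: flat_exp_def elim: eventually_mono\<close>)
  next
    case 2
    have "((\<lambda>t. 0) has_field_derivative 0) (at t)" by simp
    then show ?thesis
      by (rule DERIV_cong_ev[THEN iffD1, rotated 3])
         (use 2 eventually_nhds_in_open[of "{..<0}" t] in \<open>auto simp: flat_exp_def elim: eventually_mono\<close>)
  next
    case 3
    \<comment> \<open>At 0 the difference quotient is itself a member of the family, of order
      \<open>k + 1\<close>, so its limit is already known.\<close>
    have "((\<lambda>h. flat_exp k h / h) \<longlongrightarrow> 0) (at 0)"
      by (rule Lim_transform_eventually[OF flat_exp_tendsto_0[of "Suc k"]])
         (auto simp: eventually_at_filter flat_exp_def)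
    then show ?thesis
      using 3 by (auto simp: DERIV_def flat_exp_def)
  qed
qed

lemma Ck_flat_exp:
  fixes q :: "real^'n::finite \<Rightarrow> real"
  shows "Ck n q \<Longrightarrow> Ck n (\<lambda>x. flat_exp k (q x))"
proof (induction n arbitrary: k)
  case 0
  have "continuous_on UNIV (flat_exp k)"
    using flat_exp_has_derivative by (intro DERIV_continuous_on) (auto intro: DERIV_subset)
  then show ?case using 0 by (auto intro: continuous_on_compose2)
next
  case (Suc n)
  have d: "((\<lambda>x. flat_exp k (q x)) has_derivative
     (\<lambda>h. (\<Sum>j\<in>UNIV. h$j *\<^sub>R partial j q x) * (flat_exp (k + 2) (q x) - k * flat_exp (k + 1) (q x)))) (at x)" for x
  proof -
    have "q differentiable at x" using Suc.prems by simp
    from DERIV_compose_FDERIV[OF flat_exp_has_derivative has_derivative_partial[OF this]]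
    show ?thesis .
  qed
  have "partial j (\<lambda>x. flat_exp k (q x))
      = (\<lambda>x. partial j q x * (flat_exp (k + 2) (q x) - k * flat_exp (k + 1) (q x)))" for j
  proof
    fix x
    have "(q has_derivative (\<lambda>h. \<Sum>j\<in>UNIV. h$j *\<^sub>R partial j q x)) (at x)"
      using Suc.prems by (intro has_derivative_partial) simp
    from partial_eqI[OF d] sum_axis_scaleR[of j "\<lambda>l. partial l q x"]
    show "partial j (\<lambda>x. flat_exp k (q x)) x
      = partial j q x * (flat_exp (k + 2) (q x) - k * flat_exp (k + 1) (q x))" by simp
  qed
  moreover have "Ck n (\<lambda>x. partial j q x * (flat_exp (k + 2) (q x) + (- real k) * flat_exp (k + 1) (q x)))" for j
    using Suc Ck_Suc_imp[OF Suc.prems] by (intro Ck_mult Ck_add Ck_cmult) auto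
  ultimately show ?case using d by (auto simp: differentiable_def)
qed

section \<open>Lebesgue points\<close>

text \<open>The closed ball of the maximum norm. It is a \<open>cbox\<close>, so its measure is
  explicit, and it contains the support of the product kernel \<open>mollifier\<close>.\<close>

definition cube :: "real^3 \<Rightarrow> real \<Rightarrow> (real^3) set" where
  "cube x r = {y. \<forall>i. \<bar>y $ i - x $ i\<bar> \<le> r}"

lemma cube_eq_cbox: "cube x r = cbox (x - vec r) (x + vec r)"
  by (auto simp: cube_def mem_box_cart abs_le_iff algebra_simps)

lemma compact_cube: "compact (cube x r)"
  by (simp add: cube_eq_cbox)

lemma cube_lmeasurable [simp]: "cube x r \<in> lmeasurable"
  by (simp add: cube_eq_cbox)

lemma cube_sets_lebesgue [simp]: "cube x r \<in> sets lebesgue"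
  by (simp add: cube_eq_cbox)

lemma measure_cube: "0 \<le> r \<Longrightarrow> measure lebesgue (cube x r) = (2 * r) ^ 3"
proof -
  assume "0 \<le> r"
  then have "x \<in> cbox (x - vec r) (x + vec r)"
    by (simp add: mem_box_cart)
  then have "cbox (x - vec r) (x + vec r) \<noteq> {}"
    by blast
  then have "measure lborel (cbox (x - vec r) (x + vec r)) = (2 * r) ^ 3"
    by (subst content_cbox_cart) (auto simp: prod_constant)
  then show ?thesis by (simp add: cube_eq_cbox)
qed

lemma cube_mono: "r \<le> s \<Longrightarrow> cube x r \<subseteq> cube x s"
  by (auto simp: cube_def intro: order_trans)

text \<open>The sharp factor would be the square root of 3; 2 is a convenient upper bound.\<close>

lemma cube_subset_cball: "0 \<le> r \<Longrightarrow> cube x r \<subseteq> cball x (2 * r)"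
proof
  fix y assume r: "0 \<le> r" and "y \<in> cube x r"
  then have *: "(y $ i - x $ i)\<^sup>2 \<le> r\<^sup>2" for i
    by (auto simp: cube_def intro!: abs_le_square_iff[THEN iffD1])
  have "(norm (y - x))\<^sup>2 = (\<Sum>i\<in>UNIV. (y $ i - x $ i)\<^sup>2)"
    by (simp add: norm_vec_def L2_set_def sum_nonneg)
  also have "\<dots> \<le> 3 * r\<^sup>2"
    using *[of 1] *[of 2] *[of 3] by (simp only: sum_3)
  also have "\<dots> \<le> (2 * r)\<^sup>2"
    by (simp add: power_mult_distrib)
  finally have "norm (y - x) \<le> 2 * r"
    by (rule power2_le_imp_le) (use r in simp)
  then show "y \<in> cball x (2 * r)" by (simp add: dist_norm norm_minus_commute)
qed

lemma cball_subset_cube: "cball x r \<subseteq> cube x r"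
proof
  fix y assume "y \<in> cball x r"
  then have "norm (y - x) \<le> r" by (simp add: dist_norm norm_minus_commute)
  then show "y \<in> cube x r"
    using component_le_norm_cart[of "y - x"] by (auto simp: cube_def intro: order_trans)
qed

text \<open>The strong form, with the norm inside the integral, because convergence of
  mollifications needs it. Division by \<open>r ^ 3\<close> instead of the volume
  \<open>8 * r ^ 3\<close> changes only a constant.\<close>

definition lebesgue_point :: "(real^3 \<Rightarrow> 'a::euclidean_space) \<Rightarrow> real^3 \<Rightarrow> bool" where
  "lebesgue_point f x \<longleftrightarrow>
     ((\<lambda>r. (LINT y|lebesgue_on (cube x r). norm (f y - f x)) / r ^ 3) \<longlongrightarrow> 0) (at_right 0)"

definition sgn_flip :: "(3 \<Rightarrow> bool) \<Rightarrow> real^3 \<Rightarrow> real^3" where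
  "sgn_flip \<sigma> x = (\<chi> i. (if \<sigma> i then 1 else - 1) * x $ i)"

lemma linear_sgn_flip: "linear (sgn_flip \<sigma>)"
  by (rule linearI) (auto simp: sgn_flip_def vec_eq_iff algebra_simps)

lemma sgn_flip_flip [simp]: "sgn_flip \<sigma> (sgn_flip \<sigma> x) = x"
  by (simp add: sgn_flip_def vec_eq_iff)

lemma in_sgn_flip_image: "y \<in> sgn_flip \<sigma> ` A \<longleftrightarrow> sgn_flip \<sigma> y \<in> A"
proof
  assume "sgn_flip \<sigma> y \<in> A"
  then have "sgn_flip \<sigma> (sgn_flip \<sigma> y) \<in> sgn_flip \<sigma> ` A"
    by (rule imageI)
  then show "y \<in> sgn_flip \<sigma> ` A" by simp
qed auto

definition octant :: "(3 \<Rightarrow> bool) \<Rightarrow> real^3 \<Rightarrow> real \<Rightarrow> (real^3) set" where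
  "octant \<sigma> x h = sgn_flip \<sigma> ` cbox (sgn_flip \<sigma> x) (sgn_flip \<sigma> x + h *\<^sub>R One)"

text \<open>
  The library averages over cubes with a corner at \<open>x\<close>; reflecting the coordinates gives all eight
  octants, hence centred cubes.
\<close>

lemma octant_averages:
  fixes g :: "real^3 \<Rightarrow> real"
  assumes g: "\<And>a b. g integrable_on cbox a b"
  obtains N where "negligible N"
    "\<And>x. x \<notin> N \<Longrightarrow> ((\<lambda>h. integral (octant \<sigma> x h) g / h ^ 3) \<longlongrightarrow> g x) (at_right 0)"
proof -
  let ?R = "sgn_flip \<sigma>"
  let ?s = "\<lambda>i. if \<sigma> i then 1 else - 1 :: real"
  \<comment> \<open>Stretching by factors 1 and -1: the map is its own inverse and the product of
    the factors has modulus 1, so integrals are unchanged.\<close>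
  have stretch: "((\<lambda>y. f (?R y)) has_integral i) (?R ` cbox a b)"
    if "(f has_integral i) (cbox a b)" for f :: "real^3 \<Rightarrow> real" and i a b
  proof -
    have st: "((\<lambda>x. f (?R x)) has_integral (i /\<^sub>R \<bar>prod ?s UNIV\<bar>))
        ((\<lambda>x. \<chi> k. x $ k / ?s k) ` cbox a b)"
      unfolding sgn_flip_def by (rule has_integral_stretch_cart[OF that]) auto
    have pr: "\<bar>prod ?s UNIV\<bar> = 1"
      unfolding abs_prod by (intro prod.neutral) auto
    have im: "(\<lambda>x. \<chi> k. x $ k / ?s k) = ?R"
      by (auto simp: sgn_flip_def fun_eq_iff vec_eq_iff)
    from st show ?thesis unfolding pr im by simp
  qed
  have img: "?R ` cbox a b = cbox (\<chi> i. if \<sigma> i then a $ i else - b $ i) (\<chi> i. if \<sigma> i then b $ i else - a $ i)" for a b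
  proof -
    have "?R y \<in> cbox a b \<longleftrightarrow>
      y \<in> cbox (\<chi> i. if \<sigma> i then a $ i else - b $ i) (\<chi> i. if \<sigma> i then b $ i else - a $ i)" for y
      unfolding mem_box_cart by (rule all_cong1) (auto simp: sgn_flip_def)
    then show ?thesis
      using in_sgn_flip_image by blast
  qed
  have "(\<lambda>y. g (?R y)) integrable_on cbox a b" for a b
  proof -
    let ?a' = "\<chi> i. if \<sigma> i then a $ i else - b $ i" and ?b' = "\<chi> i. if \<sigma> i then b $ i else - a $ i"
    have "((\<lambda>y. g (?R y)) has_integral integral (cbox ?a' ?b') g) (?R ` cbox ?a' ?b')"
      using g by (intro stretch integrable_integral)
    moreover have "?R ` cbox ?a' ?b' = cbox a b"
      unfolding img by (rule arg_cong2[of _ _ _ _ cbox]) (auto simp: vec_eq_iff)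
    ultimately show ?thesis by auto
  qed
  then obtain N where N: "negligible N" and lim: "\<And>x e. \<lbrakk>x \<notin> N; 0 < e\<rbrakk> \<Longrightarrow>
     \<exists>d>0. \<forall>h. 0 < h \<and> h < d \<longrightarrow>
        norm(integral (cbox x (x + h *\<^sub>R One)) (\<lambda>y. g (?R y)) /\<^sub>R h ^ DIM(real^3) - g (?R x)) < e"
    using integrable_ccontinuous_explicit[of "\<lambda>y. g (?R y)"] by metis
  have int_eq: "integral (octant \<sigma> x h) g = integral (cbox (?R x) (?R x + h *\<^sub>R One)) (\<lambda>y. g (?R y))" for x h
  proof -
    have "((\<lambda>y. g (?R y)) has_integral integral (cbox (?R x) (?R x + h *\<^sub>R One)) (\<lambda>y. g (?R y)))
        (cbox (?R x) (?R x + h *\<^sub>R One))"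
      by (rule integrable_integral) fact
    from stretch[OF this] have "(g has_integral integral (cbox (?R x) (?R x + h *\<^sub>R One)) (\<lambda>y. g (?R y)))
        (octant \<sigma> x h)"
      by (simp add: octant_def)
    then show ?thesis by (rule integral_unique)
  qed
  show thesis
  proof
    show "negligible (?R ` N)"
      using linear_sgn_flip N
      by (intro negligible_differentiable_image_negligible)
        (auto intro!: linear_imp_differentiable_on simp: linear_conv_bounded_linear)
    fix x assume "x \<notin> ?R ` N"
    then have "?R x \<notin> N" by (simp add: in_sgn_flip_image)
    show "((\<lambda>h. integral (octant \<sigma> x h) g / h ^ 3) \<longlongrightarrow> g x) (at_right 0)"
    proof (rule tendstoI)
      fix e :: real assume "e > 0"
      then obtain d where "d > 0" and d: "\<forall>h. 0 < h \<and> h < d \<longrightarrow>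
        norm(integral (cbox (?R x) (?R x + h *\<^sub>R One)) (\<lambda>y. g (?R y)) /\<^sub>R h ^ DIM(real^3) - g (?R (?R x))) < e"
        using lim[OF \<open>?R x \<notin> N\<close>] by blast
      show "\<forall>\<^sub>F h in at_right 0. dist (integral (octant \<sigma> x h) g / h ^ 3) (g x) < e"
        unfolding eventually_at_right_field
        using d \<open>d > 0\<close> by (intro exI[of _ d]) (auto simp: int_eq dist_norm divide_inverse mult.commute)
    qed
  qed
qed

lemma One_nth: "(One :: real^'n::finite) $ i = 1"
  by (simp add: cart_eq_inner_axis inner_sum_left_Basis axis_in_Basis_iff)

lemma mem_octant: "y \<in> octant \<sigma> x h \<longleftrightarrow> (\<forall>i. 0 \<le> (if \<sigma> i then 1 else -1) * (y $ i - x $ i)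
    \<and> (if \<sigma> i then 1 else -1) * (y $ i - x $ i) \<le> h)"
proof -
  have "y \<in> octant \<sigma> x h \<longleftrightarrow> sgn_flip \<sigma> y \<in> cbox (sgn_flip \<sigma> x) (sgn_flip \<sigma> x + h *\<^sub>R One)"
    unfolding octant_def by (rule in_sgn_flip_image)
  also have "\<dots> \<longleftrightarrow> (\<forall>i. 0 \<le> (if \<sigma> i then 1 else -1) * (y $ i - x $ i)
    \<and> (if \<sigma> i then 1 else -1) * (y $ i - x $ i) \<le> h)"
    unfolding mem_box_cart by (rule all_cong1) (auto simp: sgn_flip_def algebra_simps One_nth simp del: sum_component)
  finally show ?thesis .
qed

lemma cube_subset_octants: "cube x h \<subseteq> (\<Union>\<sigma>. octant \<sigma> x h)"
proof
  fix y assume "y \<in> cube x h"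
  then have *: "\<bar>y $ i - x $ i\<bar> \<le> h" for i
    by (simp add: cube_def)
  have "0 \<le> (if x $ i \<le> y $ i then 1 else -1) * (y $ i - x $ i)
    \<and> (if x $ i \<le> y $ i then 1 else -1) * (y $ i - x $ i) \<le> h" for i
    using *[of i] by (cases "x $ i \<le> y $ i") auto
  then have "y \<in> octant (\<lambda>i. x $ i \<le> y $ i) x h"
    unfolding mem_octant by blast
  then show "y \<in> (\<Union>\<sigma>. octant \<sigma> x h)" by blast
qed

lemma octant_subset_cube: "octant \<sigma> x h \<subseteq> cube x h"
proof
  fix y assume y: "y \<in> octant \<sigma> x h"
  have "\<bar>y $ i - x $ i\<bar> \<le> h" for i
    using y[unfolded mem_octant, rule_format, of i] by (auto split: if_splits)
  then show "y \<in> cube x h" by (simp add: cube_def)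
qed

lemma octant_sets [simp]: "octant \<sigma> x h \<in> sets lebesgue"
proof -
  have "compact (octant \<sigma> x h)"
    unfolding octant_def
    by (intro compact_continuous_image linear_continuous_on linear_conv_bounded_linear[THEN iffD1] linear_sgn_flip) auto
  then show ?thesis
    by (simp add: lmeasurable_compact fmeasurableD)
qed

text \<open>Averages converge almost everywhere for each real function |f - q|. Doing this for all
  \<open>q\<close> in a countable dense set and all octants costs one null set. Off it,
  \<open>f x\<close> is approximated by some \<open>q\<close>, and |f - f x| is compared with |f -
  q|.\<close>

lemma ae_lebesgue_point:
  fixes f :: "real^3 \<Rightarrow> 'a::euclidean_space"
  assumes f: "integrable lebesgue f"
  shows "AE x in lebesgue. lebesgue_point f x"
proof -
  obtain Q :: "'a set" where Q: "countable Q" "\<And>X. open X \<Longrightarrow> X \<noteq> {} \<Longrightarrow> \<exists>d\<in>Q. d \<in> X"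
    using countable_dense_exists[where 'a='a] by metis
  have int: "integrable (lebesgue_on S) (\<lambda>y. norm (f y - q))" if "S \<in> lmeasurable" for q S
  proof -
    have "integrable (lebesgue_on S) f"
      using f that by (simp add: integrable_restrict_space fmeasurableD integrable_mult_indicator)
    moreover have "integrable (lebesgue_on S) (\<lambda>y. q)"
      using that by (simp add: finite_measure.integrable_const finite_measure_lebesgue_on)
    ultimately show ?thesis by auto
  qed
  define P where "P \<sigma> q N \<longleftrightarrow> negligible N \<and> (\<forall>x. x \<notin> N \<longrightarrow>
      ((\<lambda>h. integral (octant \<sigma> x h) (\<lambda>y. norm (f y - q)) / h ^ 3) \<longlongrightarrow> norm (f x - q)) (at_right 0))"
    for \<sigma> q N
  have P: "\<exists>N. P \<sigma> q N" for \<sigma> q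
  proof -
    have "(\<lambda>y. norm (f y - q)) integrable_on cbox a b" for a b
      by (intro integrable_on_lebesgue_on int) auto
    then show ?thesis
      unfolding P_def using octant_averages[of "\<lambda>y. norm (f y - q)" \<sigma>] by blast
  qed
  define N where "N \<sigma> q = (SOME N. P \<sigma> q N)" for \<sigma> q
  have "P \<sigma> q (N \<sigma> q)" for \<sigma> q
    unfolding N_def using P by (rule someI_ex)
  then have N: "\<And>\<sigma> q. negligible (N \<sigma> q)" "\<And>\<sigma> q x. x \<notin> N \<sigma> q \<Longrightarrow>
      ((\<lambda>h. integral (octant \<sigma> x h) (\<lambda>y. norm (f y - q)) / h ^ 3) \<longlongrightarrow> norm (f x - q)) (at_right 0)"
    by (auto simp: P_def)
  have "negligible (\<Union>q\<in>Q. \<Union>\<sigma>. N \<sigma> q)"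
    using N(1) Q(1) by (intro negligible_countable_Union) (auto intro!: negligible_Union)
  moreover have "lebesgue_point f x" if x: "x \<notin> (\<Union>q\<in>Q. \<Union>\<sigma>. N \<sigma> q)" for x
    unfolding lebesgue_point_def
  proof (rule tendstoI)
    fix e :: real assume "e > 0"
    let ?c = "real (card (UNIV :: (3 \<Rightarrow> bool) set))"
    \<comment> \<open>With \<open>?c\<close> octants, the averages of |f - q| contribute less than
      \<open>?c * \<delta> + \<delta>\<close>, and replacing \<open>q\<close> by \<open>f x\<close>
      on a cube of volume \<open>8 * h ^ 3\<close> adds \<open>8 * \<delta>\<close>. The total
      \<open>(?c + 9) * \<delta>\<close> is below
      \<open>e = (2 * ?c + 9) * \<delta>\<close>.\<close>
    define \<delta> where "\<delta> = e / (2 * ?c + 9)"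
    have "\<delta> > 0" using \<open>e > 0\<close> by (simp add: \<delta>_def add_nonneg_pos)
    then obtain q where "q \<in> Q" and q: "dist (f x) q < \<delta>"
      using Q(2)[of "ball (f x) \<delta>"] by force
    have "((\<lambda>h. \<Sum>\<sigma>\<in>UNIV. integral (octant \<sigma> x h) (\<lambda>y. norm (f y - q)) / h ^ 3)
        \<longlongrightarrow> (\<Sum>\<sigma>\<in>(UNIV :: (3 \<Rightarrow> bool) set). norm (f x - q))) (at_right 0)"
      using x \<open>q \<in> Q\<close> by (intro tendsto_sum N(2)) auto
    moreover have "(\<Sum>\<sigma>\<in>(UNIV :: (3 \<Rightarrow> bool) set). norm (f x - q)) < ?c * \<delta> + \<delta>"
    proof -
      have "?c * norm (f x - q) \<le> ?c * \<delta>"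
        using q by (intro mult_left_mono) (auto simp: dist_norm)
      moreover have "(\<Sum>\<sigma>\<in>(UNIV :: (3 \<Rightarrow> bool) set). norm (f x - q)) = ?c * norm (f x - q)"
        by (rule sum_constant)
      ultimately show ?thesis using \<open>\<delta> > 0\<close> by linarith
    qed
    ultimately have ev: "\<forall>\<^sub>F h in at_right 0.
        (\<Sum>\<sigma>\<in>UNIV. integral (octant \<sigma> x h) (\<lambda>y. norm (f y - q)) / h ^ 3) < ?c * \<delta> + \<delta>"
      by (rule order_tendstoD)
    have "\<forall>\<^sub>F h in at_right 0. h > (0::real)"
      by (simp add: eventually_at_right_less)
    with ev show "\<forall>\<^sub>F h in at_right 0. dist ((LINT y|lebesgue_on (cube x h). norm (f y - f x)) / h ^ 3) 0 < e"
    proof eventually_elim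
      case (elim h)
      have "(LINT y|lebesgue_on (cube x h). norm (f y - f x))
          \<le> (LINT y|lebesgue_on (cube x h). norm (f y - q) + \<delta>)"
      proof (rule integral_mono)
        show "norm (f y - f x) \<le> norm (f y - q) + \<delta>" for y
          using q norm_triangle_ineq4[of "f y - q" "f x - q"] by (simp add: dist_norm)
        show "integrable (lebesgue_on (cube x h)) (\<lambda>y. norm (f y - q) + \<delta>)"
          by (intro Bochner_Integration.integrable_add int)
             (auto simp: finite_measure.integrable_const finite_measure_lebesgue_on)
      qed (auto intro: int)
      also have "\<dots> = (LINT y|lebesgue_on (cube x h). norm (f y - q)) + 8 * h ^ 3 * \<delta>"
        using elim by (subst Bochner_Integration.integral_add)
          (auto simp: int finite_measure.integrable_const finite_measure_lebesgue_on
            measure_restrict_space measure_cube power_mult_distrib)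
      also have "(LINT y|lebesgue_on (cube x h). norm (f y - q))
        \<le> (\<Sum>\<sigma>\<in>UNIV. (LINT y|lebesgue_on (octant \<sigma> x h). norm (f y - q)))"
      proof -
        have oct: "octant \<sigma> x h \<in> lmeasurable" for \<sigma>
          by (rule fmeasurableI2[OF cube_lmeasurable octant_subset_cube]) simp
        have I: "integrable lebesgue (\<lambda>y. indicator (octant \<sigma> x h) y *\<^sub>R norm (f y - q))" for \<sigma>
          using int[OF oct] by (simp add: integrable_restrict_space)
        have "(LINT y|lebesgue. indicator (cube x h) y *\<^sub>R norm (f y - q))
          \<le> (LINT y|lebesgue. (\<Sum>\<sigma>\<in>UNIV. indicator (octant \<sigma> x h) y *\<^sub>R norm (f y - q)))"
        proof (rule integral_mono)
          show "integrable lebesgue (\<lambda>y. indicator (cube x h) y *\<^sub>R norm (f y - q))"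
            using int[OF cube_lmeasurable] by (simp add: integrable_restrict_space)
          show "integrable lebesgue (\<lambda>y. \<Sum>\<sigma>\<in>UNIV. indicator (octant \<sigma> x h) y *\<^sub>R norm (f y - q))"
            using I by (rule Bochner_Integration.integrable_sum)
          fix y
          show "indicator (cube x h) y *\<^sub>R norm (f y - q)
            \<le> (\<Sum>\<sigma>\<in>UNIV. indicator (octant \<sigma> x h) y *\<^sub>R norm (f y - q))"
          proof (cases "y \<in> cube x h")
            case True
            then obtain \<sigma> where "y \<in> octant \<sigma> x h" using cube_subset_octants by blast
            then show ?thesis
              using True member_le_sum[of \<sigma> UNIV "\<lambda>\<sigma>. indicator (octant \<sigma> x h) y *\<^sub>R norm (f y - q)"] by simp
          qed (simp add: sum_nonneg)
        qed
        also have "\<dots> = (\<Sum>\<sigma>\<in>UNIV. (LINT y|lebesgue. indicator (octant \<sigma> x h) y *\<^sub>R norm (f y - q)))"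
          using I by (rule Bochner_Integration.integral_sum)
        finally show ?thesis by (simp add: integral_restrict_space)
      qed
      also have "(\<Sum>\<sigma>\<in>UNIV. (LINT y|lebesgue_on (octant \<sigma> x h). norm (f y - q)))
          = (\<Sum>\<sigma>\<in>UNIV. integral (octant \<sigma> x h) (\<lambda>y. norm (f y - q)))"
      proof (rule sum.cong)
        fix \<sigma> :: "3 \<Rightarrow> bool"
        have "octant \<sigma> x h \<in> lmeasurable"
          by (rule fmeasurableI2[OF cube_lmeasurable octant_subset_cube]) simp
        then show "(LINT y|lebesgue_on (octant \<sigma> x h). norm (f y - q))
          = integral (octant \<sigma> x h) (\<lambda>y. norm (f y - q))"
          by (intro lebesgue_integral_eq_integral int) auto
      qed simp
      also have "\<dots> \<le> (?c * \<delta> + \<delta>) * h ^ 3"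
        using elim by (simp add: sum_divide_distrib[symmetric] pos_divide_less_eq less_imp_le)
      finally have "(LINT y|lebesgue_on (cube x h). norm (f y - f x)) \<le> (?c * \<delta> + 9 * \<delta>) * h ^ 3"
        by (simp add: algebra_simps)
      then have "(LINT y|lebesgue_on (cube x h). norm (f y - f x)) / h ^ 3 \<le> ?c * \<delta> + 9 * \<delta>"
        using elim by (simp add: pos_divide_le_eq)
      also have "\<dots> < e"
      proof -
        have "e = (2 * ?c + 9) * \<delta>"
          by (simp add: \<delta>_def add_nonneg_eq_0_iff)
        moreover have "?c > 0" by (simp add: card_gt_0_iff)
        ultimately show ?thesis using \<open>\<delta> > 0\<close> by (simp add: algebra_simps)
      qed
      finally show ?case
        using elim by (simp add: dist_norm abs_of_nonneg)
    qed
  qed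
  ultimately show ?thesis
    by (intro AE_I'[of "\<Union>q\<in>Q. \<Union>\<sigma>. N \<sigma> q"]) (auto simp only: negligible_iff_null_sets space_completion)
qed

section \<open>Convolution with smooth kernels\<close>

text \<open>A product over the coordinates rather than a radial function, so that the support lies
  in a cube. It is even, hence reflected kernels need no new estimate.\<close>

definition bump :: "real^3 \<Rightarrow> real" where
  "bump x = (\<Prod>i\<in>UNIV. flat_exp 0 (1 + x $ i) * flat_exp 0 (1 - x $ i))"

lemma Ck_nth_coord: "Ck k (\<lambda>x::real^'n::finite. x $ i)"
  by (rule Ck_linear[OF bounded_linear_vec_nth])

lemma smooth_bump: "smooth bump"
  unfolding smooth_def bump_def[abs_def]
proof
  fix k
  have "Ck k (\<lambda>x::real^3. \<Prod>i\<in>UNIV. flat_exp 0 (1 + x $ i) * flat_exp 0 (1 + (-1) * x $ i))"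
    by (intro Ck_prod Ck_mult Ck_flat_exp Ck_add Ck_const Ck_nth_coord)
  then show "Ck k (\<lambda>x::real^3. \<Prod>i\<in>UNIV. flat_exp 0 (1 + x $ i) * flat_exp 0 (1 - x $ i))"
    by simp
qed

lemma flat_exp_bounds: "0 \<le> flat_exp 0 t" "flat_exp 0 t \<le> 1"
  by (auto simp: flat_exp_def)

lemma bump_nonneg: "0 \<le> bump x"
  unfolding bump_def by (intro prod_nonneg ballI mult_nonneg_nonneg flat_exp_bounds)

lemma bump_le_1: "bump x \<le> 1"
  unfolding bump_def
  by (intro prod_le_1 conjI mult_nonneg_nonneg mult_le_one flat_exp_bounds)

lemma bump_eq_0: "x \<notin> cube 0 1 \<Longrightarrow> bump x = 0"
proof -
  assume "x \<notin> cube 0 1"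
  then obtain i where "\<bar>x $ i\<bar> > 1" by (auto simp: cube_def not_le)
  then have "flat_exp 0 (1 + x $ i) * flat_exp 0 (1 - x $ i) = 0"
    by (auto simp: flat_exp_def)
  then show ?thesis unfolding bump_def by (intro prod_zero) auto
qed

lemma bump_minus [simp]: "bump (- x) = bump x"
  by (simp add: bump_def mult.commute)

lemma continuous_imp_borel_lebesgue:
  "continuous_on UNIV f \<Longrightarrow> f \<in> borel_measurable lebesgue"
  by (rule measurable_completion) (simp add: borel_measurable_continuous_onI)

lemma integrable_compact_support:
  fixes K :: "real^3 \<Rightarrow> 'a::euclidean_space"
  assumes "continuous_on UNIV K" "compact C" "\<And>x. x \<notin> C \<Longrightarrow> K x = 0"
  shows "integrable lebesgue K"
proof -
  have "integrable lborel (\<lambda>x. indicator C x *\<^sub>R K x)"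
    using assms(2) continuous_on_subset[OF assms(1) subset_UNIV] by (intro borel_integrable_compact)
  moreover have "(\<lambda>x. indicator C x *\<^sub>R K x) = K"
    using assms(3) by (auto simp: fun_eq_iff indicator_def)
  ultimately show ?thesis
    by (simp add: integrable_completion)
qed

text \<open>Completeness of Lebesgue measure makes the exceptional set itself null, not merely
  contained in a null set.\<close>

lemma AE_lebesgue_iff_negligible: "(AE x in lebesgue. P x) \<longleftrightarrow> negligible {x. \<not> P x}"
  unfolding eventually_ae_filter negligible_iff_null_sets
  using negligible_subset by (auto simp: negligible_iff_null_sets[symmetric])

definition bump_mass :: real where "bump_mass = (LINT x|lebesgue. bump x)"

lemma integrable_bump: "integrable lebesgue bump"
  by (rule integrable_compact_support[OF smooth_continuous[OF smooth_bump] compact_cube bump_eq_0])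

text \<open>If the mass were 0, the set where the bump is nonzero would be null; but it is open and
  contains the origin.\<close>

lemma bump_mass_pos: "bump_mass > 0"
proof -
  have "bump_mass \<ge> 0" unfolding bump_mass_def by (simp add: bump_nonneg)
  moreover have "bump_mass \<noteq> 0"
  proof
    assume "bump_mass = 0"
    then have "AE x in lebesgue. bump x = 0"
      unfolding bump_mass_def
      by (subst (asm) integral_nonneg_eq_0_iff_AE) (auto simp: integrable_bump bump_nonneg)
    then have "negligible {x. bump x \<noteq> 0}"
      by (simp add: AE_lebesgue_iff_negligible)
    moreover have "open {x. bump x \<noteq> 0}"
      using smooth_continuous[OF smooth_bump]
      by (intro open_Collect_neq continuous_intros)
    moreover have "0 \<in> {x. bump x \<noteq> 0}"
      by (simp add: bump_def flat_exp_def)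
    ultimately show False
      using open_not_negligible by blast
  qed
  ultimately show ?thesis by simp
qed

definition mollifier :: "real \<Rightarrow> real^3 \<Rightarrow> real" where
  "mollifier r x = bump (x /\<^sub>R r) / (r ^ 3 * bump_mass)"

lemma smooth_mollifier: "smooth (mollifier r)"
  unfolding smooth_def mollifier_def[abs_def]
proof
  fix k
  have "Ck k (\<lambda>x. inverse (r ^ 3 * bump_mass) * bump (x /\<^sub>R r))"
    by (rule Ck_cmult[OF Ck_compose[OF smoothD[OF smooth_bump] Ck_linear[OF bounded_linear_scaleR_right]]])
  then show "Ck k (\<lambda>x. bump (x /\<^sub>R r) / (r ^ 3 * bump_mass))"
    by (simp add: divide_inverse mult.commute)
qed

lemma mollifier_nonneg: "0 \<le> r \<Longrightarrow> 0 \<le> mollifier r x"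
  using bump_mass_pos by (simp add: mollifier_def bump_nonneg)

lemma mollifier_le: "0 < r \<Longrightarrow> mollifier r x \<le> 1 / (r ^ 3 * bump_mass)"
  unfolding mollifier_def using bump_mass_pos bump_le_1 by (intro divide_right_mono) auto

lemma mollifier_eq_0: "0 < r \<Longrightarrow> x \<notin> cube 0 r \<Longrightarrow> mollifier r x = 0"
  by (auto simp: mollifier_def cube_def abs_mult field_simps intro!: bump_eq_0)

lemma integrable_mollifier: "0 < r \<Longrightarrow> integrable lebesgue (\<lambda>y. mollifier r (x - y))"
proof (rule integrable_compact_support[where C="cube x r"])
  assume r: "0 < r"
  show "continuous_on UNIV (\<lambda>y. mollifier r (x - y))"
    using smooth_continuous[OF smooth_mollifier, of UNIV]
    by (rule continuous_on_compose2) (auto intro!: continuous_intros)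
  show "mollifier r (x - y) = 0" if "y \<notin> cube x r" for y
    using that r by (intro mollifier_eq_0) (auto simp: cube_def abs_minus_commute)
qed (rule compact_cube)

lemma lborel_integral_affine:
  fixes f :: "real^3 \<Rightarrow> 'a::{banach, second_countable_topology}"
  assumes c: "c \<noteq> 0" and f: "f \<in> borel_measurable borel"
  shows "(LINT x|lborel. f x) = \<bar>c\<bar> ^ 3 *\<^sub>R (LINT x|lborel. f (t + c *\<^sub>R x))"
proof -
  have "(LINT x|lborel. f x)
      = (LINT x|density (distr lborel borel (\<lambda>x. t + c *\<^sub>R x)) (\<lambda>_. ennreal (\<bar>c\<bar> ^ 3)). f x)"
    using lborel_affine[OF c, of t] by simp
  also have "\<dots> = \<bar>c\<bar> ^ 3 *\<^sub>R (LINT x|lborel. f (t + c *\<^sub>R x))"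
    using f by (simp add: integral_density integral_distr)
  finally show ?thesis .
qed

lemma integral_mollifier: 
  assumes "0 < r" shows "(LINT y|lebesgue. mollifier r (x - y)) = 1"
proof -
  have "continuous_on UNIV (\<lambda>y. x - y)" by (intro continuous_intros)
  then have b: "bump \<in> borel_measurable borel" "(\<lambda>y. mollifier r (x - y)) \<in> borel_measurable borel"
    using smooth_continuous[OF smooth_bump, of UNIV] continuous_on_compose2[OF smooth_continuous[OF smooth_mollifier[of r], of UNIV], of UNIV "\<lambda>y. x - y"]
    by (auto intro!: borel_measurable_continuous_onI continuous_intros)
  have "(LINT y|lborel. mollifier r (x - y)) = r ^ 3 * (LINT z|lborel. mollifier r (x - (x + r *\<^sub>R z)))"
    using lborel_integral_affine[of r, OF _ b(2), of x] assms by simp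
  also have "\<dots> = (LINT z|lborel. bump z) / bump_mass"
    using assms by (simp add: mollifier_def)
  also have "\<dots> = 1"
    using bump_mass_pos b by (simp add: bump_mass_def integral_completion)
  finally show ?thesis using b by (simp add: integral_completion)
qed

text \<open>No integrability of \<open>f\<close> has to be checked when this is applied: the
  integral of a non-integrable function is 0 by convention, and \<open>g\<close> is almost
  everywhere nonnegative.\<close>

lemma norm_integral_le:
  fixes f :: "'b \<Rightarrow> 'a::{banach, second_countable_topology}"
  assumes g: "integrable M g" and le: "AE x in M. norm (f x) \<le> g x"
  shows "norm (LINT x|M. f x) \<le> (LINT x|M. g x)"
proof (cases "integrable M f")
  case True
  have "norm (LINT x|M. f x) \<le> (LINT x|M. norm (f x))"
    by (rule integral_norm_bound)
  also have "\<dots> \<le> (LINT x|M. g x)"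
    using True g le by (intro integral_mono_AE) auto
  finally show ?thesis .
next
  case False
  have "AE x in M. 0 \<le> g x"
    using le by (auto elim!: eventually_mono intro: order_trans[OF norm_ge_zero])
  then show ?thesis
    using False by (simp add: not_integrable_integral_eq integral_nonneg_AE)
qed

definition conv :: "(real^3 \<Rightarrow> real) \<Rightarrow> (real^3 \<Rightarrow> 'a::euclidean_space) \<Rightarrow> real^3 \<Rightarrow> 'a" where
  "conv K f x = (LINT y|lebesgue. K (x - y) *\<^sub>R f y)"

lemma bounded_compact_support:
  fixes K :: "real^3 \<Rightarrow> 'a::real_normed_vector"
  assumes "continuous_on UNIV K" "compact C" "\<And>x. x \<notin> C \<Longrightarrow> K x = 0"
  obtains B where "B > 0" "\<And>x. norm (K x) \<le> B"
proof -
  have "compact (K ` C)"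
    using assms(2) continuous_on_subset[OF assms(1) subset_UNIV] by (intro compact_continuous_image)
  then obtain B where "B > 0" "\<And>x. x \<in> C \<Longrightarrow> norm (K x) \<le> B"
    using compact_imp_bounded bounded_pos by (metis imageI)
  then have "norm (K x) \<le> B" for x
    using assms(3)[of x] by (cases "x \<in> C") auto
  then show thesis using \<open>B > 0\<close> that by blast
qed

lemma integrable_conv:
  fixes f :: "real^3 \<Rightarrow> 'a::euclidean_space"
  assumes K: "continuous_on UNIV K" "compact C" "\<And>x. x \<notin> C \<Longrightarrow> K x = 0"
    and f: "integrable lebesgue f"
  shows "integrable lebesgue (\<lambda>y. K (x - y) *\<^sub>R f y)"
proof -
  obtain B where "B > 0" and B: "\<And>x. norm (K x) \<le> B"
    using bounded_compact_support[OF K] by blast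
  have "continuous_on UNIV (\<lambda>y. K (x - y))"
    by (rule continuous_on_compose2[OF K(1)]) (auto intro!: continuous_intros)
  then have [measurable]: "(\<lambda>y. K (x - y)) \<in> borel_measurable lebesgue"
    by (rule continuous_imp_borel_lebesgue)
  have [measurable]: "f \<in> borel_measurable lebesgue" using f by auto
  show ?thesis
  proof (rule Bochner_Integration.integrable_bound)
    show "integrable lebesgue (\<lambda>y. B * norm (f y))" using f by auto
    show "AE y in lebesgue. norm (K (x - y) *\<^sub>R f y) \<le> norm (B * norm (f y))"
      using B by (auto intro!: AE_I2 mult_right_mono simp: abs_mult intro: order_trans[OF _ abs_ge_self])
  qed measurable
qed

lemma partial_zero_off_compact:
  fixes K :: "real^3 \<Rightarrow> 'a::real_normed_vector"
  assumes "compact C" "\<And>x. x \<notin> C \<Longrightarrow> K x = 0" "x \<notin> C"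
  shows "partial j K x = 0"
proof -
  have "open (- C)" using assms(1) compact_imp_closed by blast
  then have "(K has_derivative (\<lambda>h. 0)) (at x)"
    using has_derivative_transform_within_open[OF has_derivative_const[of 0 "at x"], of "- C" K] assms
    by auto
  then show ?thesis by (simp add: partial_eqI)
qed

lemma uniformly_continuous_compact_support:
  fixes K :: "real^3 \<Rightarrow> 'a::real_normed_vector"
  assumes K: "continuous_on UNIV K" and C: "compact C" "\<And>x. x \<notin> C \<Longrightarrow> K x = 0"
    and e: "e > 0"
  obtains d where "d > 0" "\<And>x y. dist x y < d \<Longrightarrow> norm (K x - K y) < e"
proof -
  \<comment> \<open>The closed 1-neighbourhood of the support is compact. Two points closer than 1
    either both lie in it or both avoid \<open>C\<close>, where \<open>K\<close> vanishes.\<close>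
  define C' where "C' = {x + y | x y. x \<in> C \<and> y \<in> cball 0 (1::real)}"
  have "compact C'" unfolding C'_def by (intro compact_sums C compact_cball)
  then have "uniformly_continuous_on C' K"
    using K continuous_on_subset by (intro compact_uniformly_continuous) auto
  then obtain d where d: "d > 0" "\<And>x y. x \<in> C' \<Longrightarrow> y \<in> C' \<Longrightarrow> dist y x < d \<Longrightarrow> dist (K y) (K x) < e"
    using e unfolding uniformly_continuous_on_def by meson
  have near: "y \<in> C'" if "x \<in> C" "dist x y < 1" for x y
  proof -
    have "y = x + (y - x)" "y - x \<in> cball 0 1"
      using that by (auto simp: dist_norm norm_minus_commute)
    then show ?thesis unfolding C'_def using that(1) by blast
  qed
  show thesis
  proof
    show "min d 1 > 0" using d by simp
    fix x y :: "real^3" assume xy: "dist x y < min d 1"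
    show "norm (K x - K y) < e"
    proof (cases "x \<in> C \<or> y \<in> C")
      case True
      then have "x \<in> C'" "y \<in> C'"
        using xy near[of x y] near[of y x] near[of x x] near[of y y] by (auto simp: dist_commute)
      then show ?thesis using d(2)[of y x] xy by (simp add: dist_norm)
    next
      case False
      then show ?thesis using C(2) e by simp
    qed
  qed
qed

text \<open>The mean value inequality for \<open>K\<close> minus its linear part at
  \<open>z\<close>; uniform continuity of the partials makes \<open>d\<close> independent of
  \<open>z\<close>. This uniformity allows differentiation under the convolution integral: the error
  is at most \<open>e * norm h\<close> times the integral of the norm of \<open>f\<close>.\<close>

lemma uniform_linearization:
  fixes K :: "real^3 \<Rightarrow> real"
  assumes K: "smooth K" and C: "compact C" "\<And>x. x \<notin> C \<Longrightarrow> K x = 0" and e: "e > 0"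
  obtains d where "d > 0"
    "\<And>z h. norm h < d \<Longrightarrow> \<bar>K (z + h) - K z - (\<Sum>j\<in>UNIV. h $ j * partial j K z)\<bar> \<le> e * norm h"
proof -
  have "\<exists>d>0. \<forall>x y. dist x y < d \<longrightarrow> norm (partial j K x - partial j K y) < e / 3" for j
    using uniformly_continuous_compact_support[OF smooth_continuous[OF smooth_partial[OF K]] C(1)
        partial_zero_off_compact[OF C], of "e/3"] e
    by (metis divide_pos_pos zero_less_numeral)
  then obtain D where D: "\<And>j. D j > 0" "\<And>j x y. dist x y < D j \<Longrightarrow> norm (partial j K x - partial j K y) < e / 3"
    by metis
  define d where "d = Min (range D)"
  have d: "d > 0" "\<And>j. d \<le> D j" using D by (auto simp: d_def)
  show thesis
  proof
    show "d > 0" by fact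
    fix z h :: "real^3" assume h: "norm h < d"
    let ?g = "\<lambda>w. K w - (\<Sum>j\<in>UNIV. w $ j * partial j K z)"
    have "norm (?g (z + h) - ?g z) \<le> e * norm (z + h - z)"
    proof (rule differentiable_bound[of "ball z d"])
      fix w assume w: "w \<in> ball z d"
      have "(K has_derivative (\<lambda>h. \<Sum>j\<in>UNIV. h $ j *\<^sub>R partial j K w)) (at w within ball z d)"
        by (rule has_derivative_at_withinI[OF has_derivative_partial[OF smooth_differentiable[OF K]]])
      moreover have "((\<lambda>w. \<Sum>j\<in>UNIV. w $ j * partial j K z) has_derivative
          (\<lambda>w. \<Sum>j\<in>UNIV. w $ j * partial j K z)) (at w within ball z d)"
        by (intro bounded_linear_imp_has_derivative bounded_linear_sum bounded_linear_mult_const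
            bounded_linear_vec_nth)
      ultimately show "(?g has_derivative (\<lambda>h. (\<Sum>j\<in>UNIV. h $ j *\<^sub>R partial j K w)
          - (\<Sum>j\<in>UNIV. h $ j * partial j K z))) (at w within ball z d)"
        by (rule has_derivative_diff)
      show "onorm (\<lambda>h. (\<Sum>j\<in>UNIV. h $ j *\<^sub>R partial j K w) - (\<Sum>j\<in>UNIV. h $ j * partial j K z)) \<le> e"
      proof (rule onorm_bound)
        fix k :: "real^3"
        have "norm ((\<Sum>j\<in>UNIV. k $ j *\<^sub>R partial j K w) - (\<Sum>j\<in>UNIV. k $ j * partial j K z))
          = norm (\<Sum>j\<in>UNIV. k $ j * (partial j K w - partial j K z))"
          by (simp add: sum_subtractf algebra_simps)
        also have "\<dots> \<le> (\<Sum>j\<in>(UNIV :: 3 set). norm k * (e / 3))"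
        proof (rule sum_norm_le)
          fix j :: 3
          have "dist w z < D j" using w d(2)[of j] by (auto simp: dist_commute)
          then show "norm (k $ j * (partial j K w - partial j K z)) \<le> norm k * (e / 3)"
            unfolding norm_mult using D(2)[of w z j] component_le_norm_cart[of k j] less_imp_le
            by (intro mult_mono) auto
        qed
        also have "\<dots> = e * norm k" by simp
        finally show "norm ((\<Sum>j\<in>UNIV. k $ j *\<^sub>R partial j K w) - (\<Sum>j\<in>UNIV. k $ j * partial j K z)) \<le> e * norm k" .
      qed (use e in simp)
    qed (use h d in \<open>auto simp: dist_norm\<close>)
    moreover have "?g (z + h) - ?g z = K (z + h) - K z - (\<Sum>j\<in>UNIV. h $ j * partial j K z)"
      by (simp add: sum.distrib distrib_right)
    ultimately show "\<bar>K (z + h) - K z - (\<Sum>j\<in>UNIV. h $ j * partial j K z)\<bar> \<le> e * norm h"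
      by simp
  qed
qed

lemma conv_has_derivative:
  fixes f :: "real^3 \<Rightarrow> 'a::euclidean_space"
  assumes K: "smooth K" and C: "compact C" "\<And>x. x \<notin> C \<Longrightarrow> K x = 0"
    and f: "integrable lebesgue f"
  shows "(conv K f has_derivative (\<lambda>h. \<Sum>j\<in>UNIV. h $ j *\<^sub>R conv (partial j K) f x)) (at x)"
  unfolding has_derivative_at_alt
proof (intro conjI allI impI)
  show "bounded_linear (\<lambda>h. \<Sum>j\<in>UNIV. h $ j *\<^sub>R conv (partial j K) f x)"
    by (intro bounded_linear_sum bounded_linear_scaleR_const bounded_linear_vec_nth)
  fix e :: real assume e: "e > 0"
  define I where "I = (LINT y|lebesgue. norm (f y))"
  have "I \<ge> 0" by (simp add: I_def)
  \<comment> \<open>The 1 guards against \<open>I = 0\<close>.\<close>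
  then have "e / (I + 1) > 0" using e by simp
  then obtain d where d: "d > 0" "\<And>z h. norm h < d \<Longrightarrow>
      \<bar>K (z + h) - K z - (\<Sum>j\<in>UNIV. h $ j * partial j K z)\<bar> \<le> e / (I + 1) * norm h"
    using uniform_linearization[OF K C, where e="e / (I + 1)"] by blast
  show "\<exists>d>0. \<forall>y. norm (y - x) < d \<longrightarrow>
      norm (conv K f y - conv K f x - (\<Sum>j\<in>UNIV. (y - x) $ j *\<^sub>R conv (partial j K) f x)) \<le> e * norm (y - x)"
  proof (intro exI conjI allI impI)
    fix y assume "norm (y - x) < d"
    define h where "h = y - x"
    have h: "norm h < d" "y = x + h" using \<open>norm (y - x) < d\<close> by (auto simp: h_def)
    have i: "integrable lebesgue (\<lambda>u. K (z - u) *\<^sub>R f u)"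
      "integrable lebesgue (\<lambda>u. partial j K (z - u) *\<^sub>R f u)" for z j
      using integrable_conv[OF smooth_continuous[OF K] C f]
        integrable_conv[OF smooth_continuous[OF smooth_partial[OF K]] C(1) partial_zero_off_compact[OF C] f]
      by auto
    have "conv K f y - conv K f x - (\<Sum>j\<in>UNIV. h $ j *\<^sub>R conv (partial j K) f x)
      = (LINT u|lebesgue. K (x + h - u) *\<^sub>R f u - K (x - u) *\<^sub>R f u
           - (\<Sum>j\<in>UNIV. h $ j *\<^sub>R (partial j K (x - u) *\<^sub>R f u)))"
    proof -
      have i3: "integrable lebesgue (\<lambda>u. \<Sum>j\<in>UNIV. h $ j *\<^sub>R (partial j K (x - u) *\<^sub>R f u))"
        by (intro Bochner_Integration.integrable_sum integrable_scaleR_right i)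
      have "(LINT u|lebesgue. K (x + h - u) *\<^sub>R f u - K (x - u) *\<^sub>R f u
           - (\<Sum>j\<in>UNIV. h $ j *\<^sub>R (partial j K (x - u) *\<^sub>R f u)))
        = (LINT u|lebesgue. K (x + h - u) *\<^sub>R f u - K (x - u) *\<^sub>R f u)
           - (LINT u|lebesgue. (\<Sum>j\<in>UNIV. h $ j *\<^sub>R (partial j K (x - u) *\<^sub>R f u)))"
        by (rule Bochner_Integration.integral_diff) (intro Bochner_Integration.integrable_diff i i3)+
      also have "(LINT u|lebesgue. K (x + h - u) *\<^sub>R f u - K (x - u) *\<^sub>R f u)
        = conv K f y - conv K f x"
        unfolding conv_def h(2) by (rule Bochner_Integration.integral_diff) (rule i)+
      also have "(LINT u|lebesgue. (\<Sum>j\<in>UNIV. h $ j *\<^sub>R (partial j K (x - u) *\<^sub>R f u)))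
        = (\<Sum>j\<in>UNIV. (LINT u|lebesgue. h $ j *\<^sub>R (partial j K (x - u) *\<^sub>R f u)))"
        by (rule Bochner_Integration.integral_sum) (intro integrable_scaleR_right i)
      finally show ?thesis by (simp add: conv_def del: scaleR_scaleR)
    qed
    also have "\<dots> = (LINT u|lebesgue. (K ((x - u) + h) - K (x - u) - (\<Sum>j\<in>UNIV. h $ j * partial j K (x - u))) *\<^sub>R f u)"
      by (rule Bochner_Integration.integral_cong)
        (simp_all add: scaleR_diff_left scaleR_sum_left algebra_simps)
    also have "norm \<dots> \<le> (LINT u|lebesgue. e / (I + 1) * norm h * norm (f u))"
    proof (rule norm_integral_le)
      show "integrable lebesgue (\<lambda>u. e / (I + 1) * norm h * norm (f u))" using f by auto
      have "norm ((K ((x - u) + h) - K (x - u) - (\<Sum>j\<in>UNIV. h $ j * partial j K (x - u))) *\<^sub>R f u)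
          \<le> e / (I + 1) * norm h * norm (f u)" for u
        unfolding norm_scaleR using d(2)[OF h(1), of "x - u"] by (intro mult_right_mono) auto
      then show "AE u in lebesgue. norm ((K ((x - u) + h) - K (x - u) - (\<Sum>j\<in>UNIV. h $ j * partial j K (x - u))) *\<^sub>R f u)
          \<le> e / (I + 1) * norm h * norm (f u)" by (rule AE_I2)
    qed
    also have "\<dots> = e / (I + 1) * norm h * I" by (simp add: I_def)
    also have "\<dots> \<le> e * norm h"
    proof -
      have "e * I / (I + 1) \<le> e"
        using \<open>I \<ge> 0\<close> e by (simp add: pos_divide_le_eq algebra_simps)
      then have "e * I / (I + 1) * norm h \<le> e * norm h" by (rule mult_right_mono) simp
      then show ?thesis by (simp add: mult.commute mult.left_commute)
    qed
    finally show "norm (conv K f y - conv K f x - (\<Sum>j\<in>UNIV. (y - x) $ j *\<^sub>R conv (partial j K) f x)) \<le> e * norm (y - x)"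
      by (simp add: h_def)
  qed (rule d)
qed

lemma partial_conv:
  fixes f :: "real^3 \<Rightarrow> 'a::euclidean_space"
  assumes K: "smooth K" and C: "compact C" "\<And>x. x \<notin> C \<Longrightarrow> K x = 0"
    and f: "integrable lebesgue f"
  shows "partial j (conv K f) = conv (partial j K) f"
proof
  fix x
  show "partial j (conv K f) x = conv (partial j K) f x"
    using partial_eqI[OF conv_has_derivative[OF assms]] sum_axis_scaleR[of j "\<lambda>l. conv (partial l K) f x"]
    by simp
qed

text \<open>Every derivative falls on the kernel, and a partial derivative of an admissible kernel
  is again one with the same compact set; hence the induction over all kernels.\<close>

lemma smooth_conv:
  fixes f :: "real^3 \<Rightarrow> 'a::euclidean_space"
  assumes "smooth K" "compact C" "\<And>x. x \<notin> C \<Longrightarrow> K x = 0" and f: "integrable lebesgue f"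
  shows "smooth (conv K f)"
  unfolding smooth_def
proof
  fix k
  show "Ck k (conv K f)"
    using assms(1-3)
  proof (induction k arbitrary: K)
    case 0
    have "continuous (at x) (conv K f)" for x
      using conv_has_derivative[OF 0 f] has_derivative_continuous by blast
    then show ?case by (simp add: continuous_at_imp_continuous_on)
  next
    case (Suc k)
    have "Ck k (conv (partial j K) f)" for j
      by (rule Suc.IH[OF smooth_partial[OF Suc.prems(1)] Suc.prems(2) partial_zero_off_compact[OF Suc.prems(2,3)]])
    moreover have "conv K f differentiable at x" for x
      using conv_has_derivative[OF Suc.prems f] by (auto simp: differentiable_def)
    ultimately show ?case
      by (simp add: partial_conv[OF Suc.prems f])
  qed
qed

section \<open>Mollification and weak derivatives\<close>

definition moll :: "real \<Rightarrow> (real^3 \<Rightarrow> 'a::euclidean_space) \<Rightarrow> real^3 \<Rightarrow> 'a" where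
  "moll r = conv (mollifier r)"

lemma smooth_moll: "0 < r \<Longrightarrow> integrable lebesgue f \<Longrightarrow> smooth (moll r f)"
  unfolding moll_def using smooth_conv[OF smooth_mollifier compact_cube mollifier_eq_0] by blast

lemma integrable_moll_kernel:
  fixes f :: "real^3 \<Rightarrow> 'a::euclidean_space"
  shows "0 < r \<Longrightarrow> integrable lebesgue f \<Longrightarrow> integrable lebesgue (\<lambda>y. mollifier r (x - y) *\<^sub>R f y)"
  using integrable_conv[OF smooth_continuous[OF smooth_mollifier] compact_cube mollifier_eq_0] by blast

lemma moll_minus_const:
  fixes f :: "real^3 \<Rightarrow> 'a::euclidean_space"
  assumes r: "0 < r" and f: "integrable lebesgue f"
  shows "integrable lebesgue (\<lambda>y. mollifier r (x - y) *\<^sub>R (f y - a))"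
    and "moll r f x - a = (LINT y|lebesgue. mollifier r (x - y) *\<^sub>R (f y - a))"
proof -
  have 1: "integrable lebesgue (\<lambda>y. mollifier r (x - y) *\<^sub>R a)"
    using integrable_mollifier[OF r] by (rule integrable_scaleR_left)
  show "integrable lebesgue (\<lambda>y. mollifier r (x - y) *\<^sub>R (f y - a))"
    unfolding scaleR_diff_right
    by (intro Bochner_Integration.integrable_diff integrable_moll_kernel 1 assms)
  have "(LINT y|lebesgue. mollifier r (x - y) *\<^sub>R (f y - a))
    = moll r f x - (LINT y|lebesgue. mollifier r (x - y) *\<^sub>R a)"
    unfolding scaleR_diff_right moll_def conv_def
    by (rule Bochner_Integration.integral_diff[OF integrable_moll_kernel[OF assms] 1])
  also have "(LINT y|lebesgue. mollifier r (x - y) *\<^sub>R a) = a"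
    using integrable_mollifier[OF r] by (simp add: integral_mollifier[OF r])
  finally show "moll r f x - a = (LINT y|lebesgue. mollifier r (x - y) *\<^sub>R (f y - a))" by simp
qed

lemma mem_cube_iff: "y \<in> cube x r \<longleftrightarrow> x - y \<in> cube 0 r"
  by (simp add: cube_def abs_minus_commute)

lemma integrable_lebesgue_on_lmeasurable:
  fixes f :: "real^3 \<Rightarrow> 'a::euclidean_space"
  assumes f: "integrable lebesgue f" and S: "S \<in> lmeasurable"
  shows "integrable (lebesgue_on S) (\<lambda>y. norm (f y - a))"
proof -
  have "integrable (lebesgue_on S) f"
    using f S by (simp add: integrable_restrict_space fmeasurableD integrable_mult_indicator)
  moreover have "integrable (lebesgue_on S) (\<lambda>y. a)"
    using S by (simp add: finite_measure.integrable_const finite_measure_lebesgue_on)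
  ultimately show ?thesis by auto
qed

text \<open>Bounds the kernel by its height. The set \<open>S\<close> may exceed the kernel's cube:
  averages over a cube centred at a Lebesgue point thereby control mollifications at neighbouring
  points, where nothing is known about convergence.\<close>

lemma norm_moll_minus_le:
  fixes f :: "real^3 \<Rightarrow> 'a::euclidean_space"
  assumes r: "0 < r" and f: "integrable lebesgue f" and S: "cube x r \<subseteq> S" "S \<in> lmeasurable"
  shows "norm (moll r f x - a) \<le> (LINT y|lebesgue_on S. norm (f y - a)) / (r ^ 3 * bump_mass)"
proof -
  have i: "integrable lebesgue (\<lambda>y. indicator S y *\<^sub>R norm (f y - a))"
    using integrable_lebesgue_on_lmeasurable[OF f S(2)] S(2) by (simp add: integrable_restrict_space fmeasurableD)
  have "norm (moll r f x - a) \<le> (LINT y|lebesgue. 1 / (r ^ 3 * bump_mass) * (indicator S y *\<^sub>R norm (f y - a)))"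
    unfolding moll_minus_const(2)[OF r f]
  proof (rule norm_integral_le)
    show "integrable lebesgue (\<lambda>y. 1 / (r ^ 3 * bump_mass) * (indicator S y *\<^sub>R norm (f y - a)))"
      using i by (rule integrable_mult_right)
    have "norm (mollifier r (x - y) *\<^sub>R (f y - a)) \<le> 1 / (r ^ 3 * bump_mass) * (indicator S y *\<^sub>R norm (f y - a))" for y
    proof (cases "y \<in> S")
      case True
      then show ?thesis
        using mollifier_le[OF r, of "x - y"] mollifier_nonneg[of r "x - y"] r mult_right_mono by fastforce
    next
      case False
      then have "x - y \<notin> cube 0 r" using S(1) mem_cube_iff by blast
      then show ?thesis using False mollifier_eq_0[OF r] by simp
    qed
    then show "AE y in lebesgue. norm (mollifier r (x - y) *\<^sub>R (f y - a))
        \<le> 1 / (r ^ 3 * bump_mass) * (indicator S y *\<^sub>R norm (f y - a))"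
      by (rule AE_I2)
  qed
  also have "\<dots> = (LINT y|lebesgue_on S. norm (f y - a)) / (r ^ 3 * bump_mass)"
    using S(2) by (simp add: integral_restrict_space fmeasurableD)
  finally show ?thesis .
qed

text \<open>The kernel is a probability density, so the mollification is an average of values within
  \<open>B\<close> of \<open>a\<close>. Taking \<open>a = 0\<close> preserves essential bounds;
  taking a value of \<open>f\<close> measures the mollification error.\<close>

lemma norm_moll_minus_le_AE:
  fixes f :: "real^3 \<Rightarrow> 'a::euclidean_space"
  assumes r: "0 < r" and f: "integrable lebesgue f"
    and B: "AE y in lebesgue. y \<in> cube x r \<longrightarrow> norm (f y - a) \<le> B"
  shows "norm (moll r f x - a) \<le> B"
proof -
  have "norm (moll r f x - a) \<le> (LINT y|lebesgue. mollifier r (x - y) * B)"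
    unfolding moll_minus_const(2)[OF r f]
  proof (rule norm_integral_le)
    show "integrable lebesgue (\<lambda>y. mollifier r (x - y) * B)"
      using integrable_mollifier[OF r] by simp
    show "AE y in lebesgue. norm (mollifier r (x - y) *\<^sub>R (f y - a)) \<le> mollifier r (x - y) * B"
      using B
    proof eventually_elim
      case (elim y)
      show ?case
      proof (cases "y \<in> cube x r")
        case True
        then show ?thesis using elim mollifier_nonneg[of r "x - y"] r by (simp add: mult_left_mono)
      next
        case False
        then show ?thesis using mollifier_eq_0[OF r] mem_cube_iff by simp
      qed
    qed
  qed
  also have "\<dots> = B" using integral_mollifier[OF r] by simp
  finally show ?thesis .
qed

lemma moll_tendsto:
  fixes f :: "real^3 \<Rightarrow> 'a::euclidean_space"
  assumes f: "integrable lebesgue f" and x: "lebesgue_point f x"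
  shows "((\<lambda>r. moll r f x) \<longlongrightarrow> f x) (at_right 0)"
proof -
  have "((\<lambda>r. (LINT y|lebesgue_on (cube x r). norm (f y - f x)) / r ^ 3 / bump_mass) \<longlongrightarrow> 0 / bump_mass) (at_right 0)"
    using x unfolding lebesgue_point_def using bump_mass_pos by (intro tendsto_divide tendsto_const) auto
  then have lim: "((\<lambda>r. (LINT y|lebesgue_on (cube x r). norm (f y - f x)) / (r ^ 3 * bump_mass)) \<longlongrightarrow> 0) (at_right 0)"
    by simp
  have "\<forall>\<^sub>F r in at_right 0. norm (moll r f x - f x)
        \<le> (LINT y|lebesgue_on (cube x r). norm (f y - f x)) / (r ^ 3 * bump_mass)"
    using eventually_at_right_less[of 0]
    by eventually_elim (rule norm_moll_minus_le[OF _ f order_refl cube_lmeasurable])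
  then have "((\<lambda>r. moll r f x - f x) \<longlongrightarrow> 0) (at_right 0)"
    using lim by (rule Lim_null_comparison)
  then show ?thesis by (simp add: LIM_zero_iff)
qed

lemma lebesgue_point_continuous:
  fixes f :: "real^3 \<Rightarrow> 'a::euclidean_space"
  assumes f: "integrable lebesgue f" and x: "isCont f x"
  shows "lebesgue_point f x"
  unfolding lebesgue_point_def
proof (rule tendstoI)
  fix e :: real assume "e > 0"
  \<comment> \<open>The cube has volume \<open>8 * r ^ 3\<close>, so the integral is at most 8/9 of
    \<open>e * r ^ 3\<close>, strictly below the target.\<close>
  then have "e / 9 > 0" by simp
  then obtain d where "d > 0" and d: "\<And>y. dist y x < d \<Longrightarrow> dist (f y) (f x) < e / 9"
    using x unfolding continuous_at_eps_delta by blast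
  have "\<forall>\<^sub>F r in at_right 0. r > 0 \<and> 2 * r < d"
    unfolding eventually_at_right_field using \<open>d > 0\<close> by (intro exI[of _ "d/2"]) auto
  then show "\<forall>\<^sub>F r in at_right 0. dist ((LINT y|lebesgue_on (cube x r). norm (f y - f x)) / r ^ 3) 0 < e"
  proof eventually_elim
    case (elim r)
    have "(LINT y|lebesgue_on (cube x r). norm (f y - f x)) \<le> (LINT y|lebesgue_on (cube x r). e / 9)"
    proof (rule integral_mono)
      show "integrable (lebesgue_on (cube x r)) (\<lambda>y. norm (f y - f x))"
        by (rule integrable_lebesgue_on_lmeasurable[OF f cube_lmeasurable])
      show "integrable (lebesgue_on (cube x r)) (\<lambda>y. e / 9)"
        by (simp add: finite_measure.integrable_const finite_measure_lebesgue_on)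
      show "norm (f y - f x) \<le> e / 9" if "y \<in> space (lebesgue_on (cube x r))" for y
      proof -
        have "y \<in> cball x (2 * r)" using that cube_subset_cball[of r x] elim by auto
        then show ?thesis using d[of y] elim by (auto simp: dist_norm norm_minus_commute)
      qed
    qed
    also have "\<dots> = 8 * r ^ 3 * (e / 9)"
      using elim by (simp add: measure_restrict_space measure_cube power_mult_distrib)
    also have "\<dots> < e * r ^ 3" using elim \<open>e > 0\<close> by simp
    finally show ?case using elim by (simp add: pos_divide_less_eq)
  qed
qed

lemma smooth_compose_reflect: "smooth K \<Longrightarrow> smooth (\<lambda>y. K (x - y))"
  unfolding smooth_def
proof
  fix k assume K: "\<forall>k. Ck k K"
  have "Ck k (\<lambda>y. x + (-1) *\<^sub>R y)"
    by (intro Ck_add Ck_const Ck_linear bounded_linear_scaleR_right)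
  then have "Ck k (\<lambda>y. x - y)" by simp
  then show "Ck k (\<lambda>y. K (x - y))"
    using K[rule_format, of k] by (rule Ck_compose[rotated])
qed

lemma partial_compose_reflect: 
  assumes "K differentiable (at (x - y))" shows "partial j (\<lambda>y. K (x - y)) y = - partial j K (x - y)"
proof -
  have "((\<lambda>y. x - y) has_derivative (\<lambda>h. - h)) (at y)"
    by (auto intro!: derivative_eq_intros)
  from diff_chain_at[OF this has_derivative_partial[OF assms]]
  have "((\<lambda>y. K (x - y)) has_derivative (\<lambda>h. \<Sum>j\<in>UNIV. (- h) $ j *\<^sub>R partial j K (x - y))) (at y)"
    by (simp add: o_def)
  from partial_eqI[OF this, of j] sum_axis_scaleR[of j "\<lambda>j. partial j K (x - y)"]
  show ?thesis by (simp add: sum_negf)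
qed

lemma test_function_mollifier:
  assumes "0 < r" "cube x r \<subseteq> \<Omega>"
  shows "test_function \<Omega> (\<lambda>y. mollifier r (x - y))"
  unfolding test_function_def
proof (intro conjI exI)
  show "smooth (\<lambda>y. mollifier r (x - y))" by (rule smooth_compose_reflect[OF smooth_mollifier])
  show "\<forall>y. y \<notin> cube x r \<longrightarrow> mollifier r (x - y) = 0"
    using mollifier_eq_0[OF assms(1)] mem_cube_iff by simp
qed (use assms compact_cube in auto)

lemma integral_lebesgue_on_indicator:
  fixes f :: "real^3 \<Rightarrow> 'a::euclidean_space"
  assumes "\<Omega> \<in> sets lebesgue"
  shows "(LINT y|lebesgue_on \<Omega>. k y *\<^sub>R f y) = (LINT y|lebesgue. k y *\<^sub>R (indicator \<Omega> y *\<^sub>R f y))"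
  using assms by (simp add: integral_restrict_space mult.commute)

text \<open>The reflected kernel is a test function as long as its cube stays in \<Omega>. The sign
  from reflecting it cancels the sign in the weak derivative, so the derivative moves from the
  kernel to \<open>g\<close>.\<close>

lemma partial_moll:
  fixes f g :: "real^3 \<Rightarrow> 'a::euclidean_space"
  assumes wp: "has_weak_partial \<Omega> j f g" and \<Omega>: "open \<Omega>" and r: "0 < r" and x: "cube x r \<subseteq> \<Omega>"
    and f: "integrable lebesgue (\<lambda>y. indicator \<Omega> y *\<^sub>R f y)"
  shows "partial j (moll r (\<lambda>y. indicator \<Omega> y *\<^sub>R f y)) x = moll r (\<lambda>y. indicator \<Omega> y *\<^sub>R g y) x"
proof -
  have \<Omega>s: "\<Omega> \<in> sets lebesgue" using \<Omega> by auto
  have "(LINT y|lebesgue_on \<Omega>. partial j (\<lambda>y. mollifier r (x - y)) y *\<^sub>R f y)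
    = - (LINT y|lebesgue_on \<Omega>. mollifier r (x - y) *\<^sub>R g y)"
    using wp test_function_mollifier[OF r x] unfolding has_weak_partial_def by blast
  moreover have "partial j (\<lambda>y. mollifier r (x - y)) y = - partial j (mollifier r) (x - y)" for y
    by (rule partial_compose_reflect[OF smooth_differentiable[OF smooth_mollifier]])
  ultimately have "(LINT y|lebesgue_on \<Omega>. partial j (mollifier r) (x - y) *\<^sub>R f y)
    = (LINT y|lebesgue_on \<Omega>. mollifier r (x - y) *\<^sub>R g y)"
    by simp
  then have "conv (partial j (mollifier r)) (\<lambda>y. indicator \<Omega> y *\<^sub>R f y) x = moll r (\<lambda>y. indicator \<Omega> y *\<^sub>R g y) x"
    unfolding moll_def conv_def integral_lebesgue_on_indicator[OF \<Omega>s] .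
  moreover have "partial j (conv (mollifier r) (\<lambda>y. indicator \<Omega> y *\<^sub>R f y))
      = conv (partial j (mollifier r)) (\<lambda>y. indicator \<Omega> y *\<^sub>R f y)"
    using mollifier_eq_0[OF r] by (rule partial_conv[OF smooth_mollifier compact_cube _ f])
  ultimately show ?thesis by (simp add: moll_def)
qed

lemma integrable_indicator_compact:
  fixes h :: "real^3 \<Rightarrow> 'a::euclidean_space"
  assumes "locally_integrable \<Omega> h" "compact K" "K \<subseteq> \<Omega>"
  shows "integrable lebesgue (\<lambda>y. indicator K y *\<^sub>R h y)"
  using assms by (simp add: locally_integrable_def set_integrable_def)

lemma AE_lebesgue_on_iff: "\<Omega> \<in> sets lebesgue \<Longrightarrow>
    (AE x in lebesgue_on \<Omega>. P x) \<longleftrightarrow> (AE x in lebesgue. x \<in> \<Omega> \<longrightarrow> P x)"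
  by (simp add: AE_restrict_space_iff)

text \<open>Kernels centred near an interior point are test functions, so the mollifications of
  \<open>h\<close> vanish there, while at Lebesgue points they converge to \<open>h\<close>. The
  argument is local because \<open>h\<close> is only locally integrable: it is cut off to a cube
  before mollifying.\<close>

lemma fundamental_lemma:
  fixes h :: "real^3 \<Rightarrow> 'a::euclidean_space"
  assumes \<Omega>: "open \<Omega>" and h: "locally_integrable \<Omega> h"
    and zero: "\<And>\<phi>::real^3 \<Rightarrow> real. test_function \<Omega> \<phi> \<Longrightarrow> (LINT x|lebesgue_on \<Omega>. \<phi> x *\<^sub>R h x) = 0"
  shows "AE x in lebesgue_on \<Omega>. h x = 0"
proof -
  have \<Omega>s: "\<Omega> \<in> sets lebesgue" using \<Omega> by auto
  have loc: "\<exists>U. open U \<and> x0 \<in> U \<and> negligible {x \<in> U. h x \<noteq> 0}" if x0: "x0 \<in> \<Omega>" for x0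
  proof -
    obtain \<rho> where \<rho>: "\<rho> > 0" "cball x0 \<rho> \<subseteq> \<Omega>"
      using \<Omega> x0 open_contains_cball by blast
    \<comment> \<open>Halving leaves \<open>cube x0 s\<close> inside the ball of radius
      \<open>\<rho>\<close>. Restricting both the distance from \<open>x0\<close> and the kernel
      size to \<open>s / 2\<close> then keeps every kernel inside the cut-off cube.\<close>
    define s where "s = \<rho> / 2"
    have s: "s > 0" "cube x0 s \<subseteq> \<Omega>"
      using \<rho> cube_subset_cball[of s x0] by (auto simp: s_def)
    let ?F = "\<lambda>y. indicator (cube x0 s) y *\<^sub>R h y"
    have F: "integrable lebesgue ?F"
      by (rule integrable_indicator_compact[OF h compact_cube s(2)])
    have "h x = 0" if x: "x \<in> ball x0 (s/2)" and L: "lebesgue_point ?F x" for x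
    proof -
      have "x \<in> cube x0 (s/2)" using x cball_subset_cube[of x0 "s/2"] by auto
      then have xc: "\<bar>x $ i - x0 $ i\<bar> \<le> s/2" for i by (simp add: cube_def)
      have sub: "cube x r \<subseteq> cube x0 s" if "r < s/2" for r
      proof
        fix y assume "y \<in> cube x r"
        then have "\<bar>y $ i - x $ i\<bar> \<le> r" for i by (simp add: cube_def)
        then have "\<bar>y $ i - x0 $ i\<bar> \<le> s" for i using xc[of i] that
          by (smt (verit) \<open>\<And>i. \<bar>y $ i - x $ i\<bar> \<le> r\<close> field_sum_of_halves)
        then show "y \<in> cube x0 s" by (simp add: cube_def)
      qed
      have "moll r ?F x = 0" if r: "0 < r" "r < s/2" for r
      proof -
        have "moll r ?F x = (LINT y|lebesgue_on \<Omega>. mollifier r (x - y) *\<^sub>R h y)"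
          unfolding moll_def conv_def integral_lebesgue_on_indicator[OF \<Omega>s]
        proof (rule Bochner_Integration.integral_cong)
          fix y
          show "mollifier r (x - y) *\<^sub>R ?F y = mollifier r (x - y) *\<^sub>R (indicator \<Omega> y *\<^sub>R h y)"
          proof (cases "y \<in> cube x r")
            case True
            then have "y \<in> cube x0 s" "y \<in> \<Omega>" using sub[OF r(2)] s(2) by auto
            then show ?thesis by simp
          next
            case False
            then show ?thesis using mollifier_eq_0[OF r(1)] mem_cube_iff by simp
          qed
        qed simp
        also have "\<dots> = 0"
          using sub[OF r(2)] s(2) by (intro zero test_function_mollifier[OF r(1)]) auto
        finally show ?thesis .
      qed
      then have "((\<lambda>r. moll r ?F x) \<longlongrightarrow> 0) (at_right 0)"
        by (intro tendsto_eventually) (auto simp: eventually_at_right_field s(1) intro!: exI[of _ "s/2"])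
      with moll_tendsto[OF F L] have "?F x = 0"
        using tendsto_unique trivial_limit_at_right_real by blast
      moreover have "x \<in> cube x0 s"
        using \<open>x \<in> cube x0 (s/2)\<close> cube_mono[of "s/2" s x0] s(1) by auto
      ultimately show ?thesis by simp
    qed
    then have "{x \<in> ball x0 (s/2). h x \<noteq> 0} \<subseteq> {x. \<not> lebesgue_point ?F x}" by blast
    moreover have "negligible {x. \<not> lebesgue_point ?F x}"
      using ae_lebesgue_point[OF F] AE_lebesgue_iff_negligible by blast
    ultimately have "negligible {x \<in> ball x0 (s/2). h x \<noteq> 0}"
      using negligible_subset by blast
    then show ?thesis using s(1) by (intro exI[of _ "ball x0 (s/2)"]) auto
  qed
  \<comment> \<open>Each point of the set has a neighbourhood meeting it in a null set, and local
    negligibility implies negligibility.\<close>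
  have "negligible {x \<in> \<Omega>. h x \<noteq> 0}"
  proof (subst locally_negligible_alt, intro ballI)
    fix x assume x: "x \<in> {x \<in> \<Omega>. h x \<noteq> 0}"
    then obtain U where U: "open U" "x \<in> U" "negligible {x \<in> U. h x \<noteq> 0}" using loc by blast
    then show "\<exists>V. openin (top_of_set {x \<in> \<Omega>. h x \<noteq> 0}) V \<and> x \<in> V \<and> negligible V"
      using x by (intro exI[of _ "{x \<in> \<Omega>. h x \<noteq> 0} \<inter> U"]) (auto intro: negligible_subset openin_open_Int)
  qed
  then show ?thesis
    unfolding AE_lebesgue_on_iff[OF \<Omega>s] AE_lebesgue_iff_negligible by (simp add: not_imp conj_commute)
qed

lemma locally_integrable_test_scaleR:
  fixes \<phi> :: "real^3 \<Rightarrow> real" and h :: "real^3 \<Rightarrow> 'a::euclidean_space"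
  assumes \<Omega>: "\<Omega> \<in> sets lebesgue" and \<phi>: "test_function \<Omega> \<phi>" and h: "locally_integrable \<Omega> h"
  shows "integrable (lebesgue_on \<Omega>) (\<lambda>x. \<phi> x *\<^sub>R h x)"
proof -
  obtain K where K: "compact K" "K \<subseteq> \<Omega>" "\<And>x. x \<notin> K \<Longrightarrow> \<phi> x = 0" and s: "smooth \<phi>"
    using \<phi> unfolding test_function_def by blast
  obtain B where B: "\<And>x. norm (\<phi> x) \<le> B"
    using bounded_compact_support[OF smooth_continuous[OF s] K(1,3)] by blast
  have "integrable lebesgue (\<lambda>x. \<phi> x *\<^sub>R (indicator K x *\<^sub>R h x))"
  proof (rule Bochner_Integration.integrable_bound)
    have i: "integrable lebesgue (\<lambda>x. indicator K x *\<^sub>R h x)"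
      by (rule integrable_indicator_compact[OF h K(1,2)])
    then show "integrable lebesgue (\<lambda>x. B * norm (indicator K x *\<^sub>R h x))"
      by (intro integrable_mult_right integrable_norm)
    show "(\<lambda>x. \<phi> x *\<^sub>R (indicator K x *\<^sub>R h x)) \<in> borel_measurable lebesgue"
      by (intro borel_measurable_scaleR continuous_imp_borel_lebesgue smooth_continuous s
          borel_measurable_integrable i)
    have "norm (\<phi> x *\<^sub>R v) \<le> norm (B * norm v)" for x and v :: 'a
    proof -
      have "\<bar>\<phi> x\<bar> * norm v \<le> \<bar>B\<bar> * norm v"
        using B[of x] by (intro mult_right_mono) auto
      then show ?thesis by (simp add: abs_mult)
    qed
    then show "AE x in lebesgue. norm (\<phi> x *\<^sub>R (indicator K x *\<^sub>R h x)) \<le> norm (B * norm (indicator K x *\<^sub>R h x))"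
      by (intro AE_I2)
  qed
  moreover have "(\<lambda>x. \<phi> x *\<^sub>R (indicator K x *\<^sub>R h x)) = (\<lambda>x. indicator \<Omega> x *\<^sub>R (\<phi> x *\<^sub>R h x))"
  proof
    fix x
    show "\<phi> x *\<^sub>R (indicator K x *\<^sub>R h x) = indicator \<Omega> x *\<^sub>R (\<phi> x *\<^sub>R h x)"
      using K(2,3) by (cases "x \<in> K") (auto simp: indicator_def)
  qed
  ultimately have "integrable lebesgue (\<lambda>x. indicator \<Omega> x *\<^sub>R (\<phi> x *\<^sub>R h x))"
    by (simp only:)
  then show ?thesis
    using \<Omega> by (simp only: integrable_restrict_space space_completion space_lborel space_borel Int_UNIV_right)
qed

lemma locally_integrable_diff:
  "locally_integrable \<Omega> f \<Longrightarrow> locally_integrable \<Omega> g \<Longrightarrow> locally_integrable \<Omega> (\<lambda>x. f x - g x)"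
  by (auto simp: locally_integrable_def)

lemma has_weak_partial_unique:
  fixes f g g' :: "real^3 \<Rightarrow> 'a::euclidean_space"
  assumes \<Omega>: "open \<Omega>" and g: "has_weak_partial \<Omega> j f g" and g': "has_weak_partial \<Omega> j f g'"
  shows "AE x in lebesgue_on \<Omega>. g x = g' x"
proof -
  have \<Omega>s: "\<Omega> \<in> sets lebesgue" using \<Omega> by auto
  have "AE x in lebesgue_on \<Omega>. g x - g' x = 0"
  proof (rule fundamental_lemma[OF \<Omega>])
    have li: "locally_integrable \<Omega> g" "locally_integrable \<Omega> g'"
      using g g' by (auto simp: has_weak_partial_def)
    then show "locally_integrable \<Omega> (\<lambda>x. g x - g' x)" by (rule locally_integrable_diff)
    fix \<phi> :: "real^3 \<Rightarrow> real" assume t: "test_function \<Omega> \<phi>"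
    have "(LINT x|lebesgue_on \<Omega>. \<phi> x *\<^sub>R (g x - g' x))
      = (LINT x|lebesgue_on \<Omega>. \<phi> x *\<^sub>R g x) - (LINT x|lebesgue_on \<Omega>. \<phi> x *\<^sub>R g' x)"
      unfolding scaleR_diff_right
      by (intro Bochner_Integration.integral_diff locally_integrable_test_scaleR[OF \<Omega>s t] li)
    then show "(LINT x|lebesgue_on \<Omega>. \<phi> x *\<^sub>R (g x - g' x)) = 0"
      using g g' t by (auto simp: has_weak_partial_def)
  qed
  then show ?thesis by simp
qed

section \<open>Bounded weak gradients\<close>

text \<open>Convolutions and Lebesgue points are formulated on the whole space; functions on
  \<Omega> enter them through their extension by zero.\<close>

abbreviation ext0 :: "(real^3) set \<Rightarrow> (real^3 \<Rightarrow> 'a::real_vector) \<Rightarrow> real^3 \<Rightarrow> 'a" where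
  "ext0 \<Omega> f \<equiv> (\<lambda>y. indicator \<Omega> y *\<^sub>R f y)"

lemma integrable_ext0_iff:
  fixes f :: "real^3 \<Rightarrow> 'a::euclidean_space"
  shows "\<Omega> \<in> sets lebesgue \<Longrightarrow> integrable lebesgue (ext0 \<Omega> f) \<longleftrightarrow> integrable (lebesgue_on \<Omega>) f"
  by (simp add: integrable_restrict_space)

lemma measurable_ext0_iff:
  fixes f :: "real^3 \<Rightarrow> 'a::euclidean_space"
  shows "\<Omega> \<in> sets lebesgue \<Longrightarrow> ext0 \<Omega> f \<in> borel_measurable lebesgue \<longleftrightarrow> f \<in> borel_measurable (lebesgue_on \<Omega>)"
  by (simp add: borel_measurable_restrict_space_iff)

lemma measurable_lebesgue_on_AE_cong:
  fixes f :: "real^3 \<Rightarrow> 'a::euclidean_space"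
  assumes \<Omega>: "\<Omega> \<in> sets lebesgue" and f: "f \<in> borel_measurable (lebesgue_on \<Omega>)"
    and ae: "AE x in lebesgue_on \<Omega>. f x = g x"
  shows "g \<in> borel_measurable (lebesgue_on \<Omega>)"
proof -
  have "AE x in lebesgue. ext0 \<Omega> f x = ext0 \<Omega> g x"
    using ae unfolding AE_lebesgue_on_iff[OF \<Omega>] by (auto elim!: eventually_mono simp: indicator_def)
  with measurable_ext0_iff[OF \<Omega>, THEN iffD2, OF f] have "ext0 \<Omega> g \<in> borel_measurable lebesgue"
    by (rule borel_measurable_AE)
  then show ?thesis by (rule measurable_ext0_iff[OF \<Omega>, THEN iffD1])
qed

lemma Linf_AE_cong:
  assumes "\<Omega> \<in> sets lebesgue" "Linf \<Omega> f" "AE x in lebesgue_on \<Omega>. f x = g x"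
  shows "Linf \<Omega> g"
proof -
  obtain c where "AE x in lebesgue_on \<Omega>. norm (f x) \<le> c" using assms(2) by (auto simp: Linf_def)
  with assms(3) have "AE x in lebesgue_on \<Omega>. norm (g x) \<le> c" by eventually_elim simp
  moreover have "g \<in> borel_measurable (lebesgue_on \<Omega>)"
    using assms(2) by (intro measurable_lebesgue_on_AE_cong[OF assms(1) _ assms(3)]) (simp add: Linf_def)
  ultimately show ?thesis by (auto simp: Linf_def)
qed

lemma Linf_integrable:
  assumes "\<Omega> \<in> lmeasurable" "Linf \<Omega> f"
  shows "integrable (lebesgue_on \<Omega>) f"
proof -
  interpret finite_measure "lebesgue_on \<Omega>" using assms(1) by (rule finite_measure_lebesgue_on)
  show ?thesis using assms(2) integrable_const_bound unfolding Linf_def by blast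
qed

lemma Linf_norm_AE:
  assumes "Linf \<Omega> f" shows "AE x in lebesgue_on \<Omega>. norm (f x) \<le> Linf_norm \<Omega> f"
proof -
  let ?E = "esssup (lebesgue_on \<Omega>) (\<lambda>x. ereal (norm (f x)))"
  obtain c where c: "AE x in lebesgue_on \<Omega>. norm (f x) \<le> c" using assms by (auto simp: Linf_def)
  have "?E \<le> ereal c"
    using assms c by (intro esssup_I) (auto simp: Linf_def elim!: eventually_mono)
  moreover have "AE x in lebesgue_on \<Omega>. ereal (norm (f x)) \<le> ?E" by (rule esssup_AE)
  ultimately show ?thesis
    unfolding Linf_norm_def by (cases ?E) (auto elim!: eventually_mono)
qed

text \<open>The essential supremum is minus infinity over a null space and infinity for a
  non-measurable function; \<open>real_of_ereal\<close> sends both to 0. In the remaining case it is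
  compared with that of the zero function.\<close>

lemma Linf_norm_nonneg: "0 \<le> Linf_norm \<Omega> f"
proof (cases "emeasure (lebesgue_on \<Omega>) (space (lebesgue_on \<Omega>)) = 0
    \<or> (\<lambda>x. ereal (norm (f x))) \<notin> borel_measurable (lebesgue_on \<Omega>)")
  case True
  then show ?thesis
    unfolding Linf_norm_def
  proof
    assume "(\<lambda>x. ereal (norm (f x))) \<notin> borel_measurable (lebesgue_on \<Omega>)"
    then show "0 \<le> real_of_ereal (esssup (lebesgue_on \<Omega>) (\<lambda>x. ereal (norm (f x))))"
      by (simp add: esssup_non_measurable top_ereal_def)
  next
    assume 0: "emeasure (lebesgue_on \<Omega>) (space (lebesgue_on \<Omega>)) = 0"
    show "0 \<le> real_of_ereal (esssup (lebesgue_on \<Omega>) (\<lambda>x. ereal (norm (f x))))"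
    proof (cases "(\<lambda>x. ereal (norm (f x))) \<in> borel_measurable (lebesgue_on \<Omega>)")
      case True
      have "esssup (lebesgue_on \<Omega>) (\<lambda>x. ereal (norm (f x))) = - \<infinity>"
        using esssup_zero_space[OF 0 True] by simp
      then show ?thesis by simp
    qed (simp add: esssup_non_measurable top_ereal_def)
  qed
next
  case False
  then have "esssup (lebesgue_on \<Omega>) (\<lambda>x. 0::ereal) \<le> esssup (lebesgue_on \<Omega>) (\<lambda>x. ereal (norm (f x)))"
    by (intro esssup_mono) auto
  moreover have "esssup (lebesgue_on \<Omega>) (\<lambda>x. 0::ereal) = 0"
    using False by (intro esssup_const) auto
  ultimately show ?thesis unfolding Linf_norm_def by (simp add: real_of_ereal_pos)
qed

text \<open>\<open>W1inf\<close> provides some bounded weak derivative; uniqueness transfers its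
  boundedness to the one selected by \<open>weak_partial\<close>.\<close>

lemma W1inf_weak_partial:
  assumes \<Omega>: "open \<Omega>" and f: "W1inf \<Omega> f"
  shows "has_weak_partial \<Omega> j f (weak_partial \<Omega> j f)" "Linf \<Omega> (weak_partial \<Omega> j f)"
proof -
  obtain g where g: "has_weak_partial \<Omega> j f g" "Linf \<Omega> g" using f by (auto simp: W1inf_def)
  show w: "has_weak_partial \<Omega> j f (weak_partial \<Omega> j f)"
    unfolding weak_partial_def by (rule someI_ex[of "has_weak_partial \<Omega> j f"]) (use g(1) in blast)
  show "Linf \<Omega> (weak_partial \<Omega> j f)"
    using Linf_AE_cong[OF _ g(2) has_weak_partial_unique[OF \<Omega> g(1) w]] \<Omega> by auto
qed

lemma W1inf_norm_ge:
  "Linf_norm \<Omega> f \<le> W1inf_norm \<Omega> f" "Linf_norm \<Omega> (weak_partial \<Omega> j f) \<le> W1inf_norm \<Omega> f"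
  unfolding W1inf_norm_def by (auto simp: le_max_iff_disj intro!: disjI2 Max_ge)

lemma W1inf_norm_nonneg: "0 \<le> W1inf_norm \<Omega> f"
  using Linf_norm_nonneg W1inf_norm_ge(1) order_trans by blast


lemma sum_partial_bound:
  fixes D :: "3 \<Rightarrow> 'a::real_normed_vector"
  assumes "\<And>j. norm (D j) \<le> L"
  shows "norm (\<Sum>j\<in>UNIV. h $ j *\<^sub>R D j) \<le> 3 * L * norm (h :: real^3)"
proof -
  have "norm (\<Sum>j\<in>UNIV. h $ j *\<^sub>R D j) \<le> (\<Sum>j\<in>(UNIV :: 3 set). norm h * L)"
    by (rule sum_norm_le) (auto intro!: mult_mono component_le_norm_cart assms)
  then show ?thesis by (simp add: mult_ac)
qed

text \<open>The mean value inequality after subtracting the linear map with columns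
  \<open>A j\<close>. The choice \<open>A = 0\<close> gives Lipschitz bounds, and the gradient at a
  point gives differentiability there.\<close>

lemma partial_increment_bound:
  fixes F :: "real^3 \<Rightarrow> 'a::euclidean_space"
  assumes F: "\<And>z. z \<in> S \<Longrightarrow> F differentiable (at z)" and S: "convex S" "x \<in> S" "y \<in> S"
    and b: "\<And>z j. z \<in> S \<Longrightarrow> norm (partial j F z - A j) \<le> L"
  shows "norm (F y - F x - (\<Sum>j\<in>UNIV. (y - x) $ j *\<^sub>R A j)) \<le> 3 * L * norm (y - x)"
proof -
  let ?g = "\<lambda>w. F w - (\<Sum>j\<in>UNIV. w $ j *\<^sub>R A j)"
  have "norm (?g y - ?g x) \<le> 3 * L * norm (y - x)"
  proof (rule differentiable_bound[OF S(1) _ _ S(3) S(2)])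
    fix z assume z: "z \<in> S"
    have "(F has_derivative (\<lambda>h. \<Sum>j\<in>UNIV. h $ j *\<^sub>R partial j F z)) (at z within S)"
      by (rule has_derivative_at_withinI[OF has_derivative_partial[OF F[OF z]]])
    moreover have "((\<lambda>w. \<Sum>j\<in>UNIV. w $ j *\<^sub>R A j) has_derivative
          (\<lambda>w. \<Sum>j\<in>UNIV. w $ j *\<^sub>R A j)) (at z within S)"
      by (intro bounded_linear_imp_has_derivative bounded_linear_sum bounded_linear_scaleR_const
            bounded_linear_vec_nth)
    ultimately show "(?g has_derivative (\<lambda>h. (\<Sum>j\<in>UNIV. h $ j *\<^sub>R partial j F z)
          - (\<Sum>j\<in>UNIV. h $ j *\<^sub>R A j))) (at z within S)"
      by (rule has_derivative_diff)
    have "0 \<le> L" using order_trans[OF norm_ge_zero b[OF z, of 1]] .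
    then show "onorm (\<lambda>h. (\<Sum>j\<in>UNIV. h $ j *\<^sub>R partial j F z) - (\<Sum>j\<in>UNIV. h $ j *\<^sub>R A j)) \<le> 3 * L"
      using sum_partial_bound[of "\<lambda>j. partial j F z - A j" L] b[OF z]
      by (intro onorm_bound) (auto simp: sum_subtractf scaleR_diff_right)
  qed
  moreover have "?g y - ?g x = F y - F x - (\<Sum>j\<in>UNIV. (y - x) $ j *\<^sub>R A j)"
    by (simp add: scaleR_diff_left sum_subtractf)
  ultimately show ?thesis by simp
qed

text \<open>Gradients of mollifications are mollified gradients, hence bounded by \<open>L\<close>;
  the resulting Lipschitz bound passes to the limit at the two Lebesgue points. The ball provides
  convexity.\<close>

lemma weak_gradient_Lipschitz:
  fixes f :: "real^3 \<Rightarrow> 'a::euclidean_space"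
  assumes \<Omega>: "open \<Omega>" and f: "integrable lebesgue (ext0 \<Omega> f)"
    and wp: "\<And>j. has_weak_partial \<Omega> j f (g j)" and g: "\<And>j. integrable lebesgue (ext0 \<Omega> (g j))"
    and L: "\<And>j. AE x in lebesgue_on \<Omega>. norm (g j x) \<le> L"
    and R: "ball c R \<subseteq> \<Omega>" and xy: "x \<in> ball c R" "y \<in> ball c R"
    and lp: "lebesgue_point (ext0 \<Omega> f) x" "lebesgue_point (ext0 \<Omega> f) y"
  shows "norm (f y - f x) \<le> 3 * L * norm (y - x)"
proof -
  have \<Omega>s: "\<Omega> \<in> sets lebesgue" using \<Omega> by auto
  \<comment> \<open>Halfway between the farther of the two points and the boundary of the ball,
    which leaves a margin for the kernel cubes.\<close>
  define R' where "R' = (max (dist c x) (dist c y) + R) / 2"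
  have R': "R' < R" "x \<in> ball c R'" "y \<in> ball c R'" using xy by (auto simp: R'_def)
  have bound: "norm (moll r (ext0 \<Omega> f) y - moll r (ext0 \<Omega> f) x) \<le> 3 * L * norm (y - x)"
    if r: "0 < r" "2 * r < R - R'" for r
  proof -
    have "norm (moll r (ext0 \<Omega> f) y - moll r (ext0 \<Omega> f) x - (\<Sum>j\<in>UNIV. (y - x) $ j *\<^sub>R 0)) \<le> 3 * L * norm (y - x)"
    proof (rule partial_increment_bound[of "ball c R'"])
      show "moll r (ext0 \<Omega> f) differentiable at z" for z
        by (intro smooth_differentiable smooth_moll r f)
      fix z and j :: 3 assume z: "z \<in> ball c R'"
      have cz: "cube z r \<subseteq> \<Omega>"
      proof
        fix w assume "w \<in> cube z r"
        then have "dist z w \<le> 2 * r" using cube_subset_cball[of r z] r by auto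
        then have "dist c w < R"
          using z r dist_triangle[of c w z] by (simp add: mem_ball)
        then show "w \<in> \<Omega>" using R by auto
      qed
      have "norm (moll r (ext0 \<Omega> (g j)) z - 0) \<le> L"
      proof (rule norm_moll_minus_le_AE[OF r(1) g])
        show "AE y in lebesgue. y \<in> cube z r \<longrightarrow> norm (ext0 \<Omega> (g j) y - 0) \<le> L"
          using L[of j] unfolding AE_lebesgue_on_iff[OF \<Omega>s]
          by eventually_elim (use cz in auto)
      qed
      then show "norm (partial j (moll r (ext0 \<Omega> f)) z - 0) \<le> L"
        by (simp add: partial_moll[OF wp \<Omega> r(1) cz f])
    qed (use R' in auto)
    then show ?thesis by simp
  qed
  have lim: "((\<lambda>r. norm (moll r (ext0 \<Omega> f) y - moll r (ext0 \<Omega> f) x)) \<longlongrightarrow> norm (ext0 \<Omega> f y - ext0 \<Omega> f x)) (at_right 0)"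
    by (intro tendsto_norm tendsto_diff moll_tendsto f lp)
  have "norm (ext0 \<Omega> f y - ext0 \<Omega> f x) \<le> 3 * L * norm (y - x)"
  proof (rule tendsto_upperbound[OF lim])
    show "\<forall>\<^sub>F r in at_right 0. norm (moll r (ext0 \<Omega> f) y - moll r (ext0 \<Omega> f) x) \<le> 3 * L * norm (y - x)"
      unfolding eventually_at_right_field using bound R'(1) by (intro exI[of _ "(R - R') / 2"]) auto
  qed simp
  moreover have "x \<in> \<Omega>" "y \<in> \<Omega>" using xy R by auto
  ultimately show ?thesis by simp
qed

lemma lebesgue_point_ext0_continuous:
  fixes f :: "real^3 \<Rightarrow> 'a::euclidean_space"
  assumes "open \<Omega>" "integrable lebesgue (ext0 \<Omega> f)" "continuous_on \<Omega> f" "x \<in> \<Omega>"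
  shows "lebesgue_point (ext0 \<Omega> f) x"
proof (rule lebesgue_point_continuous[OF assms(2)])
  have "isCont f x" using assms continuous_on_eq_continuous_at by blast
  moreover have "\<forall>\<^sub>F y in nhds x. f y = ext0 \<Omega> f y"
    using eventually_nhds_in_open[OF assms(1,4)] by eventually_elim simp
  ultimately show "isCont (ext0 \<Omega> f) x"
    using isCont_cong[of f "ext0 \<Omega> f" x] by simp
qed

text \<open>
  Rademacher's theorem at Lebesgue points of the gradient: for the increment \<open>h\<close> the function is
  mollified at scale \<open>\<eta> |h|\<close> with a small fixed \<open>\<eta>\<close>; the mollified gradient is close to \<open>g x\<close>, and the
  Lipschitz bound controls the mollification error by a multiple of \<open>\<eta> |h|\<close>.
\<close>

lemma weak_gradient_derivative:
  fixes f :: "real^3 \<Rightarrow> 'a::euclidean_space"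
  assumes \<Omega>: "open \<Omega>" and f: "integrable lebesgue (ext0 \<Omega> f)" "continuous_on \<Omega> f"
    and wp: "\<And>j. has_weak_partial \<Omega> j f (g j)" and g: "\<And>j. integrable lebesgue (ext0 \<Omega> (g j))"
    and L: "\<And>j. AE x in lebesgue_on \<Omega>. norm (g j x) \<le> L"
    and x: "x \<in> \<Omega>" and lp: "\<And>j. lebesgue_point (ext0 \<Omega> (g j)) x"
  shows "(f has_derivative (\<lambda>h. \<Sum>j\<in>UNIV. h $ j *\<^sub>R g j x)) (at x)"
  unfolding has_derivative_at_alt
proof (intro conjI allI impI)
  show "bounded_linear (\<lambda>h. \<Sum>j\<in>UNIV. h $ j *\<^sub>R g j x)"
    by (intro bounded_linear_sum bounded_linear_scaleR_const bounded_linear_vec_nth)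
  fix e :: real assume e: "e > 0"
  obtain R where R: "R > 0" "ball x R \<subseteq> \<Omega>" using \<Omega> x open_contains_ball by blast
  define L' where "L' = max L 0"
  have L': "L' \<ge> 0" "\<And>j. AE x in lebesgue_on \<Omega>. norm (g j x) \<le> L'"
  proof -
    show "L' \<ge> 0" by (simp add: L'_def)
    show "AE x in lebesgue_on \<Omega>. norm (g j x) \<le> L'" for j
      using L[of j] by eventually_elim (simp add: L'_def)
  qed
  have Lip: "norm (f z - f y) \<le> 3 * L' * norm (z - y)" if "y \<in> ball x R" "z \<in> ball x R" for y z
    using that R by (intro weak_gradient_Lipschitz[OF \<Omega> f(1) wp g L'(2) R(2)]
      lebesgue_point_ext0_continuous[OF \<Omega> f]) auto
  \<comment> \<open>Mollifying at scale \<open>\<eta> * t\<close> errs by at most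
    \<open>6 * L' * \<eta> * t\<close> at each of the two endpoints; this choice keeps the sum below
    \<open>e / 2 * t\<close>.\<close>
  define \<eta> where "\<eta> = min 1 (e / (24 * (L' + 1)))"
  have \<eta>: "0 < \<eta>" "\<eta> \<le> 1" "12 * L' * \<eta> \<le> e / 2"
  proof -
    show "0 < \<eta>" using e L'(1) by (simp add: \<eta>_def)
    show "\<eta> \<le> 1" by (simp add: \<eta>_def)
    have "12 * L' * \<eta> \<le> 12 * (L' + 1) * (e / (24 * (L' + 1)))"
      using L'(1) e by (intro mult_mono) (auto simp: \<eta>_def min_def)
    also have "\<dots> = e / 2" using L'(1) by (simp add: field_simps)
    finally show "12 * L' * \<eta> \<le> e / 2" .
  qed
  let ?Q = "\<lambda>j s. (LINT y|lebesgue_on (cube x s). norm (ext0 \<Omega> (g j) y - ext0 \<Omega> (g j) x)) / s ^ 3"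
  \<comment> \<open>The average over the cube of half side \<open>2 * t\<close> is compared with a
    kernel of scale \<open>\<eta> * t\<close>, at the cost of the factor
    \<open>8 / (\<eta> ^ 3 * bump_mass)\<close>. After it the gradient error is
    \<open>e / 6\<close>, and \<open>partial_increment_bound\<close> multiplies this by 3.\<close>
  define e' where "e' = e / 6 * \<eta> ^ 3 * bump_mass / 8"
  have "e' > 0" using e \<eta> bump_mass_pos by (simp add: e'_def)
  have "\<forall>\<^sub>F s in at_right 0. \<forall>j\<in>UNIV. ?Q j s < e'"
    using lp \<open>e' > 0\<close> unfolding lebesgue_point_def
    by (intro eventually_ball_finite ballI order_tendstoD(2)) auto
  then obtain d where d: "d > 0" "\<And>j s. 0 < s \<Longrightarrow> s < d \<Longrightarrow> ?Q j s < e'"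
    unfolding eventually_at_right_field by blast
  show "\<exists>d>0. \<forall>y. norm (y - x) < d \<longrightarrow>
      norm (f y - f x - (\<Sum>j\<in>UNIV. (y - x) $ j *\<^sub>R g j x)) \<le> e * norm (y - x)"
  proof (intro exI conjI allI impI)
    show "min (d / 2) (R / 3) > 0" using d R by simp
    fix y assume y: "norm (y - x) < min (d / 2) (R / 3)"
    show "norm (f y - f x - (\<Sum>j\<in>UNIV. (y - x) $ j *\<^sub>R g j x)) \<le> e * norm (y - x)"
    proof (cases "y = x")
      case False
      define t where "t = norm (y - x)"
      have t: "0 < t" "2 * t < d" "3 * t < R" using y False by (auto simp: t_def)
      define r where "r = \<eta> * t"
      have r: "0 < r" "r \<le> t" using \<eta> t by (auto simp: r_def mult_left_le_one_le)
      let ?f = "moll r (ext0 \<Omega> f)"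
      have cb: "cube z r \<subseteq> cube x (2 * t)" "cube z r \<subseteq> ball x R" if z: "z \<in> cball x t" for z
      proof -
        have zx: "\<bar>z $ i - x $ i\<bar> \<le> t" for i
          using z cball_subset_cube[of x t] by (auto simp: cube_def)
        have "\<bar>w $ i - x $ i\<bar> \<le> 2 * t" if "\<bar>w $ i - z $ i\<bar> \<le> r" for w i
          using that zx[of i] r(2) by linarith
        then show "cube z r \<subseteq> cube x (2 * t)"
          by (auto simp: cube_def)
        have "cube z r \<subseteq> cball z (2 * r)" using cube_subset_cball r(1) by auto
        also have "\<dots> \<subseteq> ball x R"
        proof
          fix w assume "w \<in> cball z (2 * r)"
          then show "w \<in> ball x R"
            using z r t dist_triangle[of x w z] by (simp add: mem_ball)
        qed
        finally show "cube z r \<subseteq> ball x R" .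
      qed
      have near: "norm (?f z - f z) \<le> 6 * L' * r" if z: "z \<in> cball x t" for z
      proof (rule norm_moll_minus_le_AE[OF r(1) f(1)], rule AE_I2, rule impI)
        fix w assume w: "w \<in> cube z r"
        then have w': "w \<in> ball x R" "norm (w - z) \<le> 2 * r"
          using cb(2)[OF z] cube_subset_cball[of r z] r by (auto simp: dist_norm norm_minus_commute)
        have "z \<in> ball x R" using z t by auto
        have "norm (f w - f z) \<le> 3 * L' * norm (w - z)" by (rule Lip) fact+
        also have "\<dots> \<le> 3 * L' * (2 * r)" using w'(2) L'(1) by (intro mult_left_mono) auto
        finally show "norm (ext0 \<Omega> f w - f z) \<le> 6 * L' * r" using w' R by auto
      qed
      have m1: "norm (?f y - ?f x - (\<Sum>j\<in>UNIV. (y - x) $ j *\<^sub>R g j x)) \<le> 3 * (e / 6) * norm (y - x)"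
      proof (rule partial_increment_bound[of "cball x t"])
        show "?f differentiable at z" for z
          by (intro smooth_differentiable smooth_moll r f)
        fix z and j :: 3 assume z: "z \<in> cball x t"
        have cz: "cube z r \<subseteq> \<Omega>" using cb(2)[OF z] R by auto
        have "partial j ?f z - g j x = moll r (ext0 \<Omega> (g j)) z - ext0 \<Omega> (g j) x"
          using x by (simp add: partial_moll[OF wp \<Omega> r(1) cz f(1)])
        also have "norm \<dots> \<le> (LINT y|lebesgue_on (cube x (2 * t)). norm (ext0 \<Omega> (g j) y - ext0 \<Omega> (g j) x)) / (r ^ 3 * bump_mass)"
          by (rule norm_moll_minus_le[OF r(1) g cb(1)[OF z] cube_lmeasurable])
        also have "\<dots> = ?Q j (2 * t) * (8 / (\<eta> ^ 3 * bump_mass))"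
          using t \<eta> bump_mass_pos by (simp add: r_def power_mult_distrib field_simps)
        also have "\<dots> \<le> e' * (8 / (\<eta> ^ 3 * bump_mass))"
          using d(2)[of "2 * t" j] t \<eta> bump_mass_pos by (intro mult_right_mono) auto
        also have "\<dots> = e / 6"
          using \<eta> bump_mass_pos by (simp add: e'_def field_simps)
        finally show "norm (partial j ?f z - g j x) \<le> e / 6" .
      qed (auto simp: t_def dist_norm norm_minus_commute)
      have m2: "norm (?f y - f y) \<le> 6 * L' * r" "norm (?f x - f x) \<le> 6 * L' * r"
        by (rule near; simp add: t_def dist_norm norm_minus_commute)+
      have eq: "f y - f x - (\<Sum>j\<in>UNIV. (y - x) $ j *\<^sub>R g j x)
        = (?f y - ?f x - (\<Sum>j\<in>UNIV. (y - x) $ j *\<^sub>R g j x)) - (?f y - f y) + (?f x - f x)" by simp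
      have "norm (f y - f x - (\<Sum>j\<in>UNIV. (y - x) $ j *\<^sub>R g j x))
          \<le> 3 * (e / 6) * norm (y - x) + 6 * L' * r + 6 * L' * r"
        unfolding eq using m1 m2 norm_triangle_ineq[of "(?f y - ?f x - (\<Sum>j\<in>UNIV. (y - x) $ j *\<^sub>R g j x)) - (?f y - f y)" "?f x - f x"]
          norm_triangle_ineq4[of "?f y - ?f x - (\<Sum>j\<in>UNIV. (y - x) $ j *\<^sub>R g j x)" "?f y - f y"]
        by linarith
      also have "\<dots> = e / 2 * t + (12 * L' * \<eta>) * t" by (simp add: r_def t_def algebra_simps)
      also have "\<dots> \<le> e / 2 * t + e / 2 * t" using \<eta>(3) t by (intro add_mono mult_right_mono) auto
      finally show ?thesis by (simp add: t_def)
    qed simp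
  qed
qed

section \<open>Change of variables\<close>

lemma integrable_lebesgue_AE_eq:
  fixes f g :: "real^3 \<Rightarrow> 'a::euclidean_space"
  assumes f: "integrable lebesgue f" and ae: "AE x in lebesgue. f x = g x"
  shows "integrable lebesgue g" "(LINT x|lebesgue. g x) = (LINT x|lebesgue. f x)"
proof -
  have m: "f \<in> borel_measurable lebesgue" using f by auto
  then have m': "g \<in> borel_measurable lebesgue" using ae by (rule borel_measurable_AE)
  show "integrable lebesgue g" using integrable_cong_AE[OF m m' ae] f by simp
  show "(LINT x|lebesgue. g x) = (LINT x|lebesgue. f x)" using integral_cong_AE[OF m m' ae] by simp
qed

lemma integrable_lebesgue_on_AE_eq:
  fixes f g :: "real^3 \<Rightarrow> 'a::euclidean_space"
  assumes S: "S \<in> sets lebesgue" and \<Omega>: "\<Omega> \<in> sets lebesgue"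
    and f: "integrable (lebesgue_on S) f" and ae: "AE x in lebesgue. ext0 S f x = ext0 \<Omega> g x"
  shows "integrable (lebesgue_on \<Omega>) g" "(LINT x|lebesgue_on \<Omega>. g x) = (LINT x|lebesgue_on S. f x)"
  using integrable_lebesgue_AE_eq[OF integrable_ext0_iff[THEN iffD2, OF S f] ae] S \<Omega>
  by (simp_all add: integrable_restrict_space integral_restrict_space)

lemma absolutely_integrable_on_iff_lebesgue_on:
  fixes f :: "real^3 \<Rightarrow> 'a::euclidean_space"
  shows "S \<in> sets lebesgue \<Longrightarrow> f absolutely_integrable_on S \<longleftrightarrow> integrable (lebesgue_on S) f"
  by (simp add: set_integrable_def integrable_restrict_space)

text \<open>The classical formula asks for a derivative at every point. The null set where it fails
  is removed from \<open>U\<close>; the hypothesis \<open>null\<close> makes its image null too, so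
  neither integral changes.\<close>

lemma change_of_variables_real:
  fixes f :: "real^3 \<Rightarrow> real" and T :: "real^3 \<Rightarrow> real^3"
  assumes U: "U \<in> sets lebesgue" and TU: "T ` U \<in> sets lebesgue" and inj: "inj_on T U"
    and d: "AE x in lebesgue_on U. (T has_derivative (\<lambda>h. G x *v h)) (at x)"
    and null: "\<And>N. N \<subseteq> U \<Longrightarrow> negligible N \<Longrightarrow> negligible (T ` N)"
    and f: "integrable (lebesgue_on (T ` U)) f"
  shows "integrable (lebesgue_on U) (\<lambda>x. \<bar>det (G x)\<bar> * f (T x))"
    and "(LINT x|lebesgue_on U. \<bar>det (G x)\<bar> * f (T x)) = (LINT y|lebesgue_on (T ` U). f y)"
proof -
  define N where "N = {x \<in> U. \<not> (T has_derivative (\<lambda>h. G x *v h)) (at x)}"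
  have N: "negligible N" "N \<subseteq> U"
    using d unfolding AE_lebesgue_on_iff[OF U] AE_lebesgue_iff_negligible N_def by (auto simp: not_imp)
  then have TN: "negligible (T ` N)" using null by blast
  define S where "S = U - N"
  have S: "S \<in> sets lebesgue" "S \<subseteq> U"
    using N U by (auto simp: S_def negligible_imp_sets)
  have TS: "T ` S = T ` U - T ` N"
    unfolding S_def using inj N(2) by (simp add: inj_on_image_set_diff)
  have TSs: "T ` S \<in> sets lebesgue" using TU TN negligible_imp_sets by (auto simp: TS)
  \<comment> \<open>The transformation theorem is applied to functions with values in
    \<open>real^1\<close>; the single component is extracted afterwards.\<close>
  let ?f = "\<lambda>y. f y *\<^sub>R (axis 1 1 :: real^1)"
  have ae1: "AE y in lebesgue. ext0 (T ` U) f y = ext0 (T ` S) f y"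
    unfolding AE_lebesgue_iff_negligible
    by (rule negligible_subset[OF TN]) (auto simp: TS indicator_def)
  have fS: "integrable (lebesgue_on (T ` S)) f" "(LINT y|lebesgue_on (T ` S). f y) = (LINT y|lebesgue_on (T ` U). f y)"
    using integrable_lebesgue_on_AE_eq[OF TU TSs f ae1] by auto
  then have F: "integrable (lebesgue_on (T ` S)) ?f" by auto
  then have Fa: "?f absolutely_integrable_on T ` S"
    using absolutely_integrable_on_iff_lebesgue_on[OF TSs] by blast
  have "(\<lambda>x. \<bar>det (matrix (\<lambda>h. G x *v h))\<bar> *\<^sub>R ?f (T x)) absolutely_integrable_on S \<and>
      integral S (\<lambda>x. \<bar>det (matrix (\<lambda>h. G x *v h))\<bar> *\<^sub>R ?f (T x)) = integral (T ` S) ?f"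
  proof (rule has_absolute_integral_change_of_variables[THEN iffD2])
    show "S \<in> sets lebesgue" by fact
    show "inj_on T S" using inj S(2) inj_on_subset by blast
    show "(T has_derivative (\<lambda>h. G x *v h)) (at x within S)" if "x \<in> S" for x
      using that has_derivative_at_withinI by (auto simp: S_def N_def)
  qed (use Fa in auto)
  then have D: "(\<lambda>x. \<bar>det (G x)\<bar> *\<^sub>R ?f (T x)) absolutely_integrable_on S"
      "integral S (\<lambda>x. \<bar>det (G x)\<bar> *\<^sub>R ?f (T x)) = integral (T ` S) ?f"
    by simp_all
  then have DL: "integrable (lebesgue_on S) (\<lambda>x. \<bar>det (G x)\<bar> *\<^sub>R ?f (T x))"
    using absolutely_integrable_on_iff_lebesgue_on[OF S(1)] by blast
  have eqL: "(LINT x|lebesgue_on S. \<bar>det (G x)\<bar> *\<^sub>R ?f (T x)) = (LINT y|lebesgue_on (T ` S). ?f y)"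
    using D(2) lebesgue_integral_eq_integral[OF DL S(1)] lebesgue_integral_eq_integral[OF F TSs] by simp
  have i: "integrable (lebesgue_on S) (\<lambda>x. \<bar>det (G x)\<bar> * f (T x))"
    using integrable_bounded_linear[OF bounded_linear_vec_nth[of 1] DL] by simp
  have e: "(LINT x|lebesgue_on S. \<bar>det (G x)\<bar> * f (T x)) = (LINT y|lebesgue_on (T ` S). f y)"
    using arg_cong[OF eqL, of "\<lambda>v. v $ 1"]
      integral_bounded_linear[OF bounded_linear_vec_nth[of 1] DL] integral_bounded_linear[OF bounded_linear_vec_nth[of 1] F]
    by simp
  have ae2: "AE x in lebesgue. ext0 S (\<lambda>x. \<bar>det (G x)\<bar> * f (T x)) x = ext0 U (\<lambda>x. \<bar>det (G x)\<bar> * f (T x)) x"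
    unfolding AE_lebesgue_iff_negligible
    by (rule negligible_subset[OF N(1)]) (auto simp: S_def indicator_def)
  show "integrable (lebesgue_on U) (\<lambda>x. \<bar>det (G x)\<bar> * f (T x))"
    "(LINT x|lebesgue_on U. \<bar>det (G x)\<bar> * f (T x)) = (LINT y|lebesgue_on (T ` U). f y)"
    using integrable_lebesgue_on_AE_eq[OF S(1) U i ae2] e fS(2) by auto
qed

lemma change_of_variables:
  fixes f :: "real^3 \<Rightarrow> 'a::euclidean_space" and T :: "real^3 \<Rightarrow> real^3"
  assumes U: "U \<in> sets lebesgue" and TU: "T ` U \<in> sets lebesgue" and inj: "inj_on T U"
    and d: "AE x in lebesgue_on U. (T has_derivative (\<lambda>h. G x *v h)) (at x)"
    and null: "\<And>N. N \<subseteq> U \<Longrightarrow> negligible N \<Longrightarrow> negligible (T ` N)"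
    and f: "integrable (lebesgue_on (T ` U)) f"
  shows "integrable (lebesgue_on U) (\<lambda>x. \<bar>det (G x)\<bar> *\<^sub>R f (T x))"
    and "(LINT x|lebesgue_on U. \<bar>det (G x)\<bar> *\<^sub>R f (T x)) = (LINT y|lebesgue_on (T ` U). f y)"
proof -
  have fb: "integrable (lebesgue_on (T ` U)) (\<lambda>y. f y \<bullet> b)" for b
    using f by (rule integrable_inner_left)
  note cv = change_of_variables_real[OF U TU inj d null fb]
  have rep: "\<bar>det (G x)\<bar> *\<^sub>R f (T x) = (\<Sum>b\<in>Basis. (\<bar>det (G x)\<bar> * (f (T x) \<bullet> b)) *\<^sub>R b)" for x
    unfolding scaleR_scaleR[symmetric] scaleR_sum_right[symmetric] by (simp add: euclidean_representation)
  have ib: "integrable (lebesgue_on U) (\<lambda>x. (\<bar>det (G x)\<bar> * (f (T x) \<bullet> b)) *\<^sub>R b)" for b :: 'a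
    by (intro integrable_scaleR_left cv(1))
  show "integrable (lebesgue_on U) (\<lambda>x. \<bar>det (G x)\<bar> *\<^sub>R f (T x))"
    unfolding rep by (intro Bochner_Integration.integrable_sum ib)
  have "(LINT x|lebesgue_on U. \<bar>det (G x)\<bar> *\<^sub>R f (T x))
      = (\<Sum>b\<in>Basis. (LINT x|lebesgue_on U. (\<bar>det (G x)\<bar> * (f (T x) \<bullet> b)) *\<^sub>R b))"
    unfolding rep by (intro Bochner_Integration.integral_sum ib)
  also have "\<dots> = (\<Sum>b\<in>Basis. (LINT y|lebesgue_on (T ` U). f y \<bullet> b) *\<^sub>R b)"
    using cv by (intro sum.cong) auto
  also have "\<dots> = (\<Sum>b\<in>Basis. ((LINT y|lebesgue_on (T ` U). f y) \<bullet> b) *\<^sub>R b)"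
    using f by simp
  also have "\<dots> = (LINT y|lebesgue_on (T ` U). f y)" by (rule euclidean_representation)
  finally show "(LINT x|lebesgue_on U. \<bar>det (G x)\<bar> *\<^sub>R f (T x)) = (LINT y|lebesgue_on (T ` U). f y)" .
qed

lemma bounded_open_lmeasurable: "open \<Omega> \<Longrightarrow> bounded \<Omega> \<Longrightarrow> \<Omega> \<in> lmeasurable"
  by (rule lmeasurable_open)

locale W1inf_map =
  fixes \<Omega> :: "(real^3) set" and T :: "real^3 \<Rightarrow> real^3"
  assumes open_dom: "open \<Omega>" and bounded_dom: "bounded \<Omega>"
    and cont: "continuous_on \<Omega> T" and W1: "W1inf \<Omega> T"
begin

abbreviation "dT \<equiv> weak_jacobian \<Omega> T"

lemma sets_dom [simp]: "\<Omega> \<in> sets lebesgue"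
  using open_dom by auto

lemma lmeasurable_dom: "\<Omega> \<in> lmeasurable"
  using open_dom bounded_dom by (rule bounded_open_lmeasurable)

lemma integrable_map: "integrable lebesgue (ext0 \<Omega> T)"
  using Linf_integrable[OF lmeasurable_dom, of T] W1 integrable_ext0_iff[OF sets_dom, of T]
  unfolding W1inf_def by blast

lemma wp: "has_weak_partial \<Omega> j T (weak_partial \<Omega> j T)" "Linf \<Omega> (weak_partial \<Omega> j T)"
  using W1inf_weak_partial[OF open_dom W1] by auto

lemma integrable_wp: "integrable lebesgue (ext0 \<Omega> (weak_partial \<Omega> j T))"
  using Linf_integrable[OF lmeasurable_dom wp(2)] integrable_ext0_iff[OF sets_dom, of "weak_partial \<Omega> j T"] by blast

lemma wp_bound: "AE x in lebesgue_on \<Omega>. norm (weak_partial \<Omega> j T x) \<le> W1inf_norm \<Omega> T"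
  using Linf_norm_AE[OF wp(2), of j] by eventually_elim (rule order_trans[OF _ W1inf_norm_ge(2)])

lemma weak_jacobian_mult: "dT x *v h = (\<Sum>j\<in>UNIV. h $ j *\<^sub>R weak_partial \<Omega> j T x)"
  by (simp add: matrix_vector_mult_def weak_jacobian_def vec_eq_iff mult.commute)

text \<open>Almost every point is a Lebesgue point of all three weak partials, and there they form
  the classical derivative.\<close>

lemma AE_derivative: "AE x in lebesgue_on \<Omega>. (T has_derivative (\<lambda>h. dT x *v h)) (at x)"
proof -
  have "AE x in lebesgue. \<forall>j\<in>UNIV. lebesgue_point (ext0 \<Omega> (weak_partial \<Omega> j T)) x"
    by (intro AE_finite_allI ae_lebesgue_point integrable_wp) auto
  then show ?thesis
    unfolding AE_lebesgue_on_iff[OF sets_dom]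
  proof eventually_elim
    case (elim x)
    show ?case
      unfolding weak_jacobian_mult
      using elim by (auto intro!: weak_gradient_derivative[OF open_dom integrable_map cont wp(1) integrable_wp wp_bound])
  qed
qed

text \<open>Continuity makes every point a Lebesgue point of the map, so the bound holds everywhere
  and not merely almost everywhere. This is what makes images of null sets null.\<close>

lemma locally_Lipschitz:
  assumes "x \<in> \<Omega>"
  shows "\<exists>U B. open U \<and> x \<in> U \<and> (\<forall>y\<in>\<Omega> \<inter> U. norm (T y - T x) \<le> B * norm (y - x))"
proof -
  obtain R where R: "R > 0" "ball x R \<subseteq> \<Omega>" using open_dom assms open_contains_ball by blast
  have "norm (T y - T x) \<le> 3 * W1inf_norm \<Omega> T * norm (y - x)" if "y \<in> ball x R" for y
    using that R
    by (intro weak_gradient_Lipschitz[OF open_dom integrable_map wp(1) integrable_wp wp_bound R(2)]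
        lebesgue_point_ext0_continuous[OF open_dom integrable_map cont]) auto
  then show ?thesis
    using R by (intro exI[of _ "ball x R"] exI[of _ "3 * W1inf_norm \<Omega> T"]) auto
qed

lemma negligible_image:
  assumes "N \<subseteq> \<Omega>" "negligible N" shows "negligible (T ` N)"
proof (rule negligible_locally_Lipschitz_image[OF _ assms(2)])
  fix x assume "x \<in> N"
  then obtain U B where "open U" "x \<in> U" "\<forall>y\<in>\<Omega> \<inter> U. norm (T y - T x) \<le> B * norm (y - x)"
    using locally_Lipschitz assms(1) by blast
  then show "\<exists>U B. open U \<and> x \<in> U \<and> (\<forall>y\<in>N \<inter> U. norm (T y - T x) \<le> B * norm (y - x))"
    using assms(1) by blast
qed simp

lemma measurable_jacobian_nth: "(\<lambda>x. dT x $ k $ j) \<in> borel_measurable (lebesgue_on \<Omega>)"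
proof -
  have "weak_partial \<Omega> j T \<in> borel_measurable (lebesgue_on \<Omega>)" using wp(2) by (simp add: Linf_def)
  then have "(\<lambda>x. weak_partial \<Omega> j T x \<bullet> axis k 1) \<in> borel_measurable (lebesgue_on \<Omega>)"
    by (intro borel_measurable_inner borel_measurable_const)
  moreover have "weak_partial \<Omega> j T x \<bullet> axis k 1 = dT x $ k $ j" for x
    by (simp add: weak_jacobian_def inner_axis)
  ultimately show ?thesis by simp
qed

lemma jacobian_nth_bound: "AE x in lebesgue_on \<Omega>. \<forall>k j. \<bar>dT x $ k $ j\<bar> \<le> W1inf_norm \<Omega> T"
proof -
  have "AE x in lebesgue_on \<Omega>. \<forall>j\<in>UNIV. norm (weak_partial \<Omega> j T x) \<le> W1inf_norm \<Omega> T"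
    by (intro AE_finite_allI wp_bound) auto
  then show ?thesis
    by eventually_elim (auto simp: weak_jacobian_def intro: order_trans[OF component_le_norm_cart])
qed

end

text \<open>The inverse is a parameter of its own instead of \<open>inv_into\<close>, so that the
  two maps play the same role and \<open>swap\<close> yields every result for the inverse as
  well.\<close>

locale W1inf_homeo = T: W1inf_map \<Omega> T + S: W1inf_map \<Omega> S for \<Omega> T S +
  assumes T_in: "x \<in> \<Omega> \<Longrightarrow> T x \<in> \<Omega>" and S_in: "x \<in> \<Omega> \<Longrightarrow> S x \<in> \<Omega>"
    and ST: "x \<in> \<Omega> \<Longrightarrow> S (T x) = x" and TS: "x \<in> \<Omega> \<Longrightarrow> T (S x) = x"
begin

lemma swap: "W1inf_homeo \<Omega> S T"
  by unfold_locales (fact S_in T_in TS ST)+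

text \<open>The exceptional set of the composition lies in the image under \<open>S\<close> of the
  original exceptional set, and \<open>S\<close> maps null sets to null sets.\<close>

lemma AE_compose:
  assumes "AE y in lebesgue_on \<Omega>. P y" shows "AE x in lebesgue_on \<Omega>. P (T x)"
proof -
  have "negligible {y \<in> \<Omega>. \<not> P y}"
    using assms unfolding AE_lebesgue_on_iff[OF T.sets_dom] AE_lebesgue_iff_negligible by (simp add: not_imp)
  then have "negligible (S ` {y \<in> \<Omega>. \<not> P y})" by (intro S.negligible_image) auto
  moreover have "{x \<in> \<Omega>. \<not> P (T x)} \<subseteq> S ` {y \<in> \<Omega>. \<not> P y}"
  proof
    fix x assume "x \<in> {x \<in> \<Omega>. \<not> P (T x)}"
    then have "T x \<in> {y \<in> \<Omega>. \<not> P y}" "x = S (T x)" using T_in ST by auto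
    then show "x \<in> S ` {y \<in> \<Omega>. \<not> P y}" by blast
  qed
  ultimately have "negligible {x \<in> \<Omega>. \<not> P (T x)}" by (rule negligible_subset)
  then show ?thesis
    unfolding AE_lebesgue_on_iff[OF T.sets_dom] AE_lebesgue_iff_negligible by (simp add: not_imp)
qed

text \<open>The chain rule for \<open>S\<close> after \<open>T\<close>, which is the identity near
  \<open>x\<close>. That \<open>S\<close> is differentiable at \<open>T x\<close> for almost every
  \<open>x\<close> is an instance of \<open>AE_compose\<close>.\<close>

lemma AE_inverse_jacobian:
  "AE x in lebesgue_on \<Omega>. S.dT (T x) ** T.dT x = mat 1 \<and> T.dT x ** S.dT (T x) = mat 1"
  using T.AE_derivative AE_compose[OF S.AE_derivative] AE_space
proof eventually_elim
  case (elim x)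
  then have x: "x \<in> \<Omega>" by simp
  have "((\<lambda>x. S (T x)) has_derivative (\<lambda>h. S.dT (T x) *v (T.dT x *v h))) (at x)"
    using diff_chain_at[OF elim(1,2)] by (simp add: o_def)
  moreover have "((\<lambda>x. S (T x)) has_derivative (\<lambda>h. h)) (at x)"
    by (rule has_derivative_transform_within_open[OF has_derivative_ident T.open_dom x]) (simp add: ST)
  ultimately have "(\<lambda>h. S.dT (T x) *v (T.dT x *v h)) = (\<lambda>h. h)"
    by (rule has_derivative_unique)
  then have "(S.dT (T x) ** T.dT x) *v h = mat 1 *v h" for h
    by (simp add: matrix_vector_mul_assoc[symmetric] fun_eq_iff)
  then have "S.dT (T x) ** T.dT x = mat 1" by (simp add: matrix_eq)
  then show ?case using matrix_left_right_inverse by blast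
qed

text \<open>The image is the preimage of \<open>U\<close> under the continuous inverse.\<close>

lemma open_image:
  assumes "open U" "U \<subseteq> \<Omega>" shows "open (T ` U)"
proof -
  have "T ` U = {y \<in> \<Omega>. S y \<in> U}"
  proof
    show "T ` U \<subseteq> {y \<in> \<Omega>. S y \<in> U}" using assms(2) T_in ST by auto
    show "{y \<in> \<Omega>. S y \<in> U} \<subseteq> T ` U" using TS by (metis (mono_tags, lifting) image_eqI mem_Collect_eq subsetI)
  qed
  also have "\<dots> = S -` U \<inter> \<Omega>" by auto
  finally show ?thesis
    using S.cont T.open_dom assms(1) by (simp add: continuous_on_open_vimage)
qed

lemma change_variables:
  fixes f :: "real^3 \<Rightarrow> 'a::euclidean_space"
  assumes U: "open U" "U \<subseteq> \<Omega>" and f: "integrable (lebesgue_on (T ` U)) f"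
  shows "integrable (lebesgue_on U) (\<lambda>x. \<bar>det (T.dT x)\<bar> *\<^sub>R f (T x))"
    and "(LINT x|lebesgue_on U. \<bar>det (T.dT x)\<bar> *\<^sub>R f (T x)) = (LINT y|lebesgue_on (T ` U). f y)"
proof -
  have Us: "U \<in> sets lebesgue" "T ` U \<in> sets lebesgue"
    using U open_image[OF U] by auto
  have inj: "inj_on T U" using U(2) ST by (metis inj_onI subsetD)
  have d: "AE x in lebesgue_on U. (T has_derivative (\<lambda>h. T.dT x *v h)) (at x)"
    using T.AE_derivative U(2) unfolding AE_lebesgue_on_iff[OF T.sets_dom] AE_lebesgue_on_iff[OF Us(1)]
    by (auto elim!: eventually_mono)
  have null: "negligible (T ` N)" if "N \<subseteq> U" "negligible N" for N
    using that U(2) by (intro T.negligible_image) auto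
  show "integrable (lebesgue_on U) (\<lambda>x. \<bar>det (T.dT x)\<bar> *\<^sub>R f (T x))"
    "(LINT x|lebesgue_on U. \<bar>det (T.dT x)\<bar> *\<^sub>R f (T x)) = (LINT y|lebesgue_on (T ` U). f y)"
    using change_of_variables[OF Us inj d null f] by auto
qed

end

section \<open>Covariant pull-back of smooth fields\<close>

lemma line_derivative:
  fixes f :: "real^'n::finite \<Rightarrow> real"
  assumes "f differentiable (at (x + s *\<^sub>R axis j 1))"
  shows "((\<lambda>s. f (x + s *\<^sub>R axis j 1)) has_field_derivative partial j f (x + s *\<^sub>R axis j 1)) (at s)"
proof -
  have "((\<lambda>s. x + s *\<^sub>R axis j 1) has_derivative (\<lambda>h. h *\<^sub>R axis j 1)) (at s)"
    by (auto intro!: derivative_eq_intros)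
  from diff_chain_at[OF this has_derivative_partial[OF assms]]
  have "((\<lambda>s. f (x + s *\<^sub>R axis j 1)) has_derivative (\<lambda>h. \<Sum>i\<in>UNIV. (h *\<^sub>R axis j 1 :: real^'n) $ i *\<^sub>R partial i f (x + s *\<^sub>R axis j 1))) (at s)"
    by (simp add: o_def)
  moreover have "(\<Sum>i\<in>UNIV. (h *\<^sub>R axis j 1 :: real^'n) $ i *\<^sub>R partial i f (x + s *\<^sub>R axis j 1))
      = h * partial j f (x + s *\<^sub>R axis j 1)" for h
    using sum_axis_scaleR[of j "\<lambda>i. h *\<^sub>R partial i f (x + s *\<^sub>R axis j 1)"] by (simp add: mult_ac)
  ultimately show ?thesis
    unfolding has_field_derivative_def by (simp add: mult_commute_abs)
qed

text \<open>The mean value theorem twice: in direction \<open>m\<close> for the increment in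
  direction \<open>l\<close>, and then in direction \<open>l\<close> for the partial derivative
  obtained.\<close>

lemma second_difference:
  fixes f :: "real^3 \<Rightarrow> real"
  assumes f: "smooth f" and h: "h > 0"
  shows "\<exists>\<sigma> \<tau>. 0 < \<sigma> \<and> \<sigma> < h \<and> 0 < \<tau> \<and> \<tau> < h \<and>
    f (x + h *\<^sub>R axis m 1 + h *\<^sub>R axis l 1) - f (x + h *\<^sub>R axis m 1) - f (x + h *\<^sub>R axis l 1) + f x
      = h * (h * partial l (partial m f) (x + \<sigma> *\<^sub>R axis m 1 + \<tau> *\<^sub>R axis l 1))"
proof -
  let ?a = "\<lambda>s. f (x + h *\<^sub>R axis l 1 + s *\<^sub>R axis m 1) - f (x + s *\<^sub>R axis m 1)"
  have d: "(?a has_field_derivative (partial m f (x + h *\<^sub>R axis l 1 + s *\<^sub>R axis m 1)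
      - partial m f (x + s *\<^sub>R axis m 1))) (at s)" for s
    by (intro DERIV_diff line_derivative smooth_differentiable f)
  from MVT2[OF h d] obtain \<sigma> where \<sigma>: "0 < \<sigma>" "\<sigma> < h" "?a h - ?a 0 = h * (partial m f (x + h *\<^sub>R axis l 1 + \<sigma> *\<^sub>R axis m 1)
      - partial m f (x + \<sigma> *\<^sub>R axis m 1))" by auto
  let ?b = "\<lambda>t. partial m f (x + \<sigma> *\<^sub>R axis m 1 + t *\<^sub>R axis l 1)"
  have d': "(?b has_field_derivative (partial l (partial m f) (x + \<sigma> *\<^sub>R axis m 1 + t *\<^sub>R axis l 1))) (at t)" for t
    by (intro line_derivative smooth_differentiable smooth_partial f)
  from MVT2[OF h d'] obtain \<tau> where \<tau>: "0 < \<tau>" "\<tau> < h"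
      "?b h - ?b 0 = h * partial l (partial m f) (x + \<sigma> *\<^sub>R axis m 1 + \<tau> *\<^sub>R axis l 1)" by auto
  have "f (x + h *\<^sub>R axis m 1 + h *\<^sub>R axis l 1) - f (x + h *\<^sub>R axis m 1) - f (x + h *\<^sub>R axis l 1) + f x = ?a h - ?a 0"
    by (simp add: add_ac)
  also have "\<dots> = h * (?b h - ?b 0)" unfolding \<sigma>(3) by (simp add: add_ac)
  also have "\<dots> = h * (h * partial l (partial m f) (x + \<sigma> *\<^sub>R axis m 1 + \<tau> *\<^sub>R axis l 1))" unfolding \<tau>(3) ..
  finally show ?thesis using \<sigma> \<tau> by blast
qed

text \<open>The second difference is symmetric in the two directions, so
  \<open>second_difference\<close> equates the two mixed derivatives at nearby points; continuity
  does the rest.\<close>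

lemma partial_commute_real:
  fixes f :: "real^3 \<Rightarrow> real"
  assumes f: "smooth f"
  shows "partial l (partial m f) x = partial m (partial l f) x"
proof (rule ccontr)
  assume ne: "partial l (partial m f) x \<noteq> partial m (partial l f) x"
  define e where "e = \<bar>partial l (partial m f) x - partial m (partial l f) x\<bar> / 2"
  have e: "e > 0" using ne by (simp add: e_def)
  have near: "\<exists>d>0. \<forall>y. dist y x < d \<longrightarrow> dist (partial l (partial m f) y) (partial l (partial m f) x) < e" for l m
    using smooth_continuous[OF smooth_partial[OF smooth_partial[OF f]], of UNIV l m] e
    unfolding continuous_on_iff by auto
  obtain d1 where d1: "d1 > 0" "\<And>y. dist y x < d1 \<Longrightarrow> dist (partial l (partial m f) y) (partial l (partial m f) x) < e"
    using near by blast
  obtain d2 where d2: "d2 > 0" "\<And>y. dist y x < d2 \<Longrightarrow> dist (partial m (partial l f) y) (partial m (partial l f) x) < e"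
    using near by blast
  \<comment> \<open>The intermediate points lie within \<open>2 * h\<close> of \<open>x\<close>,
    which a third of the smaller radius keeps inside both neighbourhoods.\<close>
  define h where "h = min d1 d2 / 3"
  have h: "h > 0" "2 * h < d1" "2 * h < d2" using d1(1) d2(1) by (auto simp: h_def min_def)
  obtain \<sigma> \<tau> where 1: "0 < \<sigma>" "\<sigma> < h" "0 < \<tau>" "\<tau> < h"
    "f (x + h *\<^sub>R axis m 1 + h *\<^sub>R axis l 1) - f (x + h *\<^sub>R axis m 1) - f (x + h *\<^sub>R axis l 1) + f x
      = h * (h * partial l (partial m f) (x + \<sigma> *\<^sub>R axis m 1 + \<tau> *\<^sub>R axis l 1))"
    using second_difference[OF f h(1)] by blast
  obtain \<sigma>' \<tau>' where 2: "0 < \<sigma>'" "\<sigma>' < h" "0 < \<tau>'" "\<tau>' < h"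
    "f (x + h *\<^sub>R axis l 1 + h *\<^sub>R axis m 1) - f (x + h *\<^sub>R axis l 1) - f (x + h *\<^sub>R axis m 1) + f x
      = h * (h * partial m (partial l f) (x + \<sigma>' *\<^sub>R axis l 1 + \<tau>' *\<^sub>R axis m 1))"
    using second_difference[OF f h(1)] by blast
  have dst: "dist (x + a *\<^sub>R axis i 1 + b *\<^sub>R axis j 1) x < 2 * h" if "0 < a" "a < h" "0 < b" "b < h" for a b and i j :: 3
  proof -
    have "norm (a *\<^sub>R axis i 1 + b *\<^sub>R axis j (1::real)) \<le> norm (a *\<^sub>R axis i (1::real)) + norm (b *\<^sub>R axis j (1::real))"
      by (rule norm_triangle_ineq)
    then show ?thesis using that by (simp add: dist_norm add.assoc)
  qed
  have comm: "x + h *\<^sub>R axis l 1 + h *\<^sub>R axis m 1 = x + h *\<^sub>R axis m 1 + h *\<^sub>R axis l 1" by (simp add: add_ac)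
  have "h * (h * partial l (partial m f) (x + \<sigma> *\<^sub>R axis m 1 + \<tau> *\<^sub>R axis l 1))
      = h * (h * partial m (partial l f) (x + \<sigma>' *\<^sub>R axis l 1 + \<tau>' *\<^sub>R axis m 1))"
    using 1(5) 2(5)[unfolded comm] by linarith
  then have "partial l (partial m f) (x + \<sigma> *\<^sub>R axis m 1 + \<tau> *\<^sub>R axis l 1)
      = partial m (partial l f) (x + \<sigma>' *\<^sub>R axis l 1 + \<tau>' *\<^sub>R axis m 1)" using h(1) by simp
  moreover have "dist (partial l (partial m f) (x + \<sigma> *\<^sub>R axis m 1 + \<tau> *\<^sub>R axis l 1)) (partial l (partial m f) x) < e"
    using dst[OF 1(1-4), of m l] h by (intro d1(2)) linarith
  moreover have "dist (partial m (partial l f) (x + \<sigma>' *\<^sub>R axis l 1 + \<tau>' *\<^sub>R axis m 1)) (partial m (partial l f) x) < e"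
    using dst[OF 2(1-4), of l m] h by (intro d2(2)) linarith
  ultimately have "\<bar>partial l (partial m f) x - partial m (partial l f) x\<bar> < 2 * e"
    by (auto simp: dist_real_def)
  then show False by (simp add: e_def)
qed

lemma smooth_nth: "smooth f \<Longrightarrow> smooth (\<lambda>x. f x $ k)"
  unfolding smooth_def by (auto intro: Ck_nth)

lemma partial_nth_smooth: "smooth f \<Longrightarrow> partial j (\<lambda>x. f x $ k) = (\<lambda>x. partial j f x $ k)"
  by (rule ext, rule partial_nth, rule smooth_differentiable)

lemma partial_commute:
  fixes f :: "real^3 \<Rightarrow> real^3"
  assumes f: "smooth f"
  shows "partial l (partial m f) x = partial m (partial l f) x"
proof -
  have "partial l (partial m f) x $ k = partial m (partial l f) x $ k" for k
  proof -
    have "partial l (partial m (\<lambda>x. f x $ k)) x = partial m (partial l (\<lambda>x. f x $ k)) x"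
      by (rule partial_commute_real[OF smooth_nth[OF f]])
    then show ?thesis
      unfolding partial_nth_smooth[OF f] partial_nth_smooth[OF smooth_partial[OF f]] .
  qed
  then show ?thesis by (simp add: vec_eq_iff)
qed

definition jac :: "(real^3 \<Rightarrow> real^3) \<Rightarrow> real^3 \<Rightarrow> real^3^3" where
  "jac S x = (\<chi> k j. partial j S x $ k)"

text \<open>The pull-back of \<phi> as a one-form: the formula of \<open>pull_back\<close> with the
  classical Jacobian in place of the weak one.\<close>

definition smooth_pull :: "(real^3 \<Rightarrow> real^3) \<Rightarrow> (real^3 \<Rightarrow> complex^3) \<Rightarrow> real^3 \<Rightarrow> complex^3" where
  "smooth_pull S \<phi> x = complex_mat (transpose (jac S x)) *v \<phi> (S x)"

lemma smooth_pull_nth: "smooth_pull S \<phi> x $ m = (\<Sum>k\<in>UNIV. partial m S x $ k *\<^sub>R \<phi> (S x) $ k)"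
  by (simp add: smooth_pull_def matrix_vector_mult_def complex_mat_def transpose_def jac_def scaleR_conv_of_real)

lemma smooth_compose: "smooth f \<Longrightarrow> smooth g \<Longrightarrow> smooth (\<lambda>x. f (g x))"
  unfolding smooth_def by (auto intro: Ck_compose)

lemma smooth_scaleR: "smooth f \<Longrightarrow> smooth g \<Longrightarrow> smooth (\<lambda>x. f x *\<^sub>R g x)"
  unfolding smooth_def by (auto intro: Ck_scaleR)

lemma smooth_sum: "(\<And>i. i \<in> I \<Longrightarrow> smooth (f i)) \<Longrightarrow> smooth (\<lambda>x. \<Sum>i\<in>I. f i x)"
  unfolding smooth_def by (auto intro: Ck_sum)

lemma smooth_smooth_pull:
  assumes "smooth S" "smooth \<phi>" shows "smooth (smooth_pull S \<phi>)"
proof -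
  have "smooth (\<lambda>x. smooth_pull S \<phi> x $ m)" for m
    unfolding smooth_pull_nth
    by (intro smooth_sum smooth_scaleR[OF smooth_nth[OF smooth_partial[OF assms(1)]]
          smooth_nth[OF smooth_compose[OF assms(2,1)]]])
  then show ?thesis unfolding smooth_def by (auto intro: Ck_vec)
qed

lemma partial_sum:
  assumes "finite I" "\<And>i. i \<in> I \<Longrightarrow> f i differentiable (at x)"
  shows "partial j (\<lambda>x. \<Sum>i\<in>I. f i x) x = (\<Sum>i\<in>I. partial j (f i) x)"
proof -
  have "((\<lambda>x. \<Sum>i\<in>I. f i x) has_derivative (\<lambda>h. \<Sum>i\<in>I. \<Sum>j\<in>UNIV. h$j *\<^sub>R partial j (f i) x)) (at x)"
    using assms by (intro has_derivative_sum has_derivative_partial)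
  from partial_eqI[OF this] show ?thesis by (simp add: sum_axis_scaleR)
qed

text \<open>The terms are kept apart on purpose: the second derivatives of \<open>S\<close>,
  symmetric in \<open>n\<close> and \<open>m\<close>, cancel in the curl, and the products of first
  derivatives combine to cofactors.\<close>

lemma partial_smooth_pull:
  assumes S: "smooth S" and \<phi>: "smooth \<phi>"
  shows "partial n (smooth_pull S \<phi>) x $ m
    = (\<Sum>k\<in>UNIV. partial n (partial m S) x $ k *\<^sub>R \<phi> (S x) $ k)
    + (\<Sum>k\<in>UNIV. partial m S x $ k *\<^sub>R (\<Sum>l\<in>UNIV. partial n S x $ l *\<^sub>R partial l \<phi> (S x) $ k))"
proof -
  have sS: "smooth (\<lambda>x. partial m S x $ k)" for k
    by (rule smooth_nth[OF smooth_partial[OF S]])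
  have s\<phi>: "smooth (\<lambda>x. \<phi> (S x) $ k)" for k
    by (rule smooth_nth[OF smooth_compose[OF \<phi> S]])
  have "partial n (smooth_pull S \<phi>) x $ m = partial n (\<lambda>x. smooth_pull S \<phi> x $ m) x"
    unfolding partial_nth_smooth[OF smooth_smooth_pull[OF assms]] ..
  also have "\<dots> = (\<Sum>k\<in>UNIV. partial n (\<lambda>x. partial m S x $ k *\<^sub>R \<phi> (S x) $ k) x)"
    unfolding smooth_pull_nth
    by (intro partial_sum smooth_differentiable[OF smooth_scaleR[OF sS s\<phi>]]) simp
  also have "\<dots> = (\<Sum>k\<in>UNIV. partial m S x $ k *\<^sub>R (\<Sum>l\<in>UNIV. partial n S x $ l *\<^sub>R partial l \<phi> (S x) $ k)
      + partial n (partial m S) x $ k *\<^sub>R \<phi> (S x) $ k)"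
  proof (rule sum.cong)
    fix k :: 3
    have 1: "partial n (\<lambda>x. partial m S x $ k) x = partial n (partial m S) x $ k"
      unfolding partial_nth_smooth[OF smooth_partial[OF S]] ..
    have "partial n (\<lambda>x. \<phi> (S x) $ k) x = partial n (\<lambda>x. \<phi> (S x)) x $ k"
      unfolding partial_nth_smooth[OF smooth_compose[OF \<phi> S]] ..
    also have "\<dots> = (\<Sum>l\<in>UNIV. partial n S x $ l *\<^sub>R partial l \<phi> (S x)) $ k"
      by (subst partial_compose) (auto intro: smooth_differentiable assms)
    finally have 2: "partial n (\<lambda>x. \<phi> (S x) $ k) x = (\<Sum>l\<in>UNIV. partial n S x $ l *\<^sub>R partial l \<phi> (S x) $ k)"
      by simp
    show "partial n (\<lambda>x. partial m S x $ k *\<^sub>R \<phi> (S x) $ k) x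
      = partial m S x $ k *\<^sub>R (\<Sum>l\<in>UNIV. partial n S x $ l *\<^sub>R partial l \<phi> (S x) $ k)
        + partial n (partial m S) x $ k *\<^sub>R \<phi> (S x) $ k"
      unfolding 2[symmetric] 1[symmetric]
      by (rule bounded_bilinear.partial_prod[OF bounded_bilinear_scaleR])
        (rule smooth_differentiable[OF sS] smooth_differentiable[OF s\<phi>])+
  qed simp
  finally show ?thesis by (simp add: sum.distrib add.commute)
qed

text \<open>The curl transforms like a two-form. In each component one instance of the symmetry of
  second derivatives, rewriting in one direction only, removes the terms without derivatives of
  \<phi>; the rest are 2 by 2 minors of the Jacobian.\<close>

lemma curl_smooth_pull:
  assumes S: "smooth S" and \<phi>: "smooth \<phi>"
  shows "curl (smooth_pull S \<phi>) x = complex_mat (cofactor_matrix (jac S x)) *v curl \<phi> (S x)"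
proof -
  note sym = partial_commute[OF S]
  have 1: "curl (smooth_pull S \<phi>) x $ 1 = (complex_mat (cofactor_matrix (jac S x)) *v curl \<phi> (S x)) $ 1"
    by (simp add: curl_def partial_smooth_pull[OF assms] sym[of 3 2] sum_3 complex_mat_def cofactor_matrix_def
      jac_def matrix_vector_mult_def det_3 axis_def scaleR_conv_of_real algebra_simps)
  have 2: "curl (smooth_pull S \<phi>) x $ 2 = (complex_mat (cofactor_matrix (jac S x)) *v curl \<phi> (S x)) $ 2"
    by (simp add: curl_def partial_smooth_pull[OF assms] sym[of 3 1] sum_3 complex_mat_def cofactor_matrix_def
      jac_def matrix_vector_mult_def det_3 axis_def scaleR_conv_of_real algebra_simps)
  have 3: "curl (smooth_pull S \<phi>) x $ 3 = (complex_mat (cofactor_matrix (jac S x)) *v curl \<phi> (S x)) $ 3"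
    by (simp add: curl_def partial_smooth_pull[OF assms] sym[of 2 1] sum_3 complex_mat_def cofactor_matrix_def
      jac_def matrix_vector_mult_def det_3 axis_def scaleR_conv_of_real algebra_simps)
  show ?thesis unfolding vec_eq_iff forall_3 using 1 2 3 by blast
qed

section \<open>Algebra, measurability and entrywise bounds for products with matrices\<close>

lemma bdot_3: "u \<odot> v = u $ 1 * v $ 1 + u $ 2 * v $ 2 + u $ 3 * v $ 3"
  by (simp add: bdot_def sum_3)

lemma norm_bdot_le: "cmod (u \<odot> v) \<le> 3 * norm u * norm v"
proof -
  have "cmod (u \<odot> v) \<le> (\<Sum>k\<in>(UNIV :: 3 set). norm u * norm v)"
    unfolding bdot_def
    by (rule sum_norm_le) (auto simp: norm_mult intro!: mult_mono Finite_Cartesian_Product.norm_nth_le)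
  then show ?thesis by simp
qed

lemma bounded_bilinear_bdot: "bounded_bilinear (\<odot>)"
proof
  show "\<exists>K. \<forall>a b. norm (a \<odot> b) \<le> norm a * norm b * K"
    using norm_bdot_le by (intro exI[of _ 3]) (auto simp: mult_ac)
qed (simp_all add: bdot_3 algebra_simps)

lemmas bdot_simps = bounded_bilinear.add_left[OF bounded_bilinear_bdot] bounded_bilinear.add_right[OF bounded_bilinear_bdot]
  bounded_bilinear.diff_left[OF bounded_bilinear_bdot] bounded_bilinear.diff_right[OF bounded_bilinear_bdot]
  bounded_bilinear.scaleR_left[OF bounded_bilinear_bdot] bounded_bilinear.scaleR_right[OF bounded_bilinear_bdot]
  bounded_bilinear.zero_left[OF bounded_bilinear_bdot] bounded_bilinear.zero_right[OF bounded_bilinear_bdot]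

lemma measurable_bdot:
  "f \<in> borel_measurable M \<Longrightarrow> g \<in> borel_measurable M \<Longrightarrow> (\<lambda>x. f x \<odot> g x) \<in> borel_measurable M"
  using bounded_bilinear.continuous_on[OF bounded_bilinear_bdot]
  by (rule borel_measurable_continuous_Pair[rotated 2]) (auto intro!: continuous_intros)

lemma measurable_vecI:
  fixes f :: "'b \<Rightarrow> 'a::euclidean_space^'n::finite"
  assumes "\<And>k. (\<lambda>x. f x $ k) \<in> borel_measurable M"
  shows "f \<in> borel_measurable M"
  using assms
  by (subst borel_measurable_euclidean_space) (auto simp: Basis_vec_def inner_axis intro!: borel_measurable_inner)

lemma measurable_vec_nth:
  fixes f :: "'b \<Rightarrow> 'a::euclidean_space^'n::finite"
  assumes "f \<in> borel_measurable M" shows "(\<lambda>x. f x $ k) \<in> borel_measurable M"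
proof -
  have "(\<lambda>v::'a^'n. v $ k) \<in> borel_measurable borel"
    by (intro borel_measurable_continuous_onI linear_continuous_on bounded_linear_vec_nth)
  from measurable_compose[OF assms this] show ?thesis .
qed

lemma measurable_complex_mat_mult:
  assumes "\<And>k j. (\<lambda>x. A x $ k $ j) \<in> borel_measurable M" "v \<in> borel_measurable M"
  shows "(\<lambda>x. complex_mat (A x) *v v x) \<in> borel_measurable M"
proof (rule measurable_vecI)
  fix k
  have "(\<lambda>x. \<Sum>j\<in>UNIV. complex_of_real (A x $ k $ j) * v x $ j) \<in> borel_measurable M"
    by (intro borel_measurable_sum borel_measurable_times measurable_vec_nth assms(2)
        measurable_compose[OF assms(1) borel_measurable_continuous_onI] continuous_intros)
  then show "(\<lambda>x. (complex_mat (A x) *v v x) $ k) \<in> borel_measurable M"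
    by (simp add: matrix_vector_mult_def complex_mat_def)
qed

lemma measurable_mat_mult:
  fixes A :: "'b \<Rightarrow> complex^3^3"
  assumes "\<And>k j. (\<lambda>x. A x $ k $ j) \<in> borel_measurable M" "v \<in> borel_measurable M"
  shows "(\<lambda>x. A x *v v x) \<in> borel_measurable M"
proof (rule measurable_vecI)
  fix k
  have "(\<lambda>x. \<Sum>j\<in>UNIV. (A x $ k $ j) * v x $ j) \<in> borel_measurable M"
    by (intro borel_measurable_sum borel_measurable_times assms measurable_vec_nth)
  then show "(\<lambda>x. (A x *v v x) $ k) \<in> borel_measurable M"
    by (simp add: matrix_vector_mult_def)
qed

lemma norm_le_sum_nth: "norm (v :: 'a::real_normed_vector^3) \<le> norm (v $ 1) + norm (v $ 2) + norm (v $ 3)"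
  using L2_set_le_sum[of UNIV "\<lambda>i. norm (v $ i)"] by (simp add: norm_vec_def sum_3)

text \<open>Three terms in each component and three components account for the factor 9.\<close>

lemma norm_mat_mult_le:
  fixes A :: "complex^3^3"
  assumes "\<And>k j. cmod (A $ k $ j) \<le> c"
  shows "norm (A *v v) \<le> 9 * c * norm v"
proof -
  have "norm ((A *v v) $ k) \<le> (\<Sum>j\<in>(UNIV :: 3 set). c * norm v)" for k
    unfolding matrix_vector_mult_def
    by (simp del: sum_constant, rule sum_norm_le)
      (auto simp: norm_mult intro!: mult_mono assms Finite_Cartesian_Product.norm_nth_le order_trans[OF norm_ge_zero assms])
  then have "norm ((A *v v) $ k) \<le> 3 * c * norm v" for k by (simp add: mult.assoc)
  from this[of 1] this[of 2] this[of 3] norm_le_sum_nth[of "A *v v"] show ?thesis by simp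
qed

lemma cofactor_nth_bound:
  assumes "\<And>k j. \<bar>A $ k $ j\<bar> \<le> L" shows "\<bar>cofactor_matrix A $ k $ j\<bar> \<le> 2 * L\<^sup>2"
proof -
  have L: "0 \<le> L" using order_trans[OF abs_ge_zero assms] .
  have p: "\<bar>A $ a $ b * A $ c $ d\<bar> \<le> L\<^sup>2" for a b c d
    unfolding abs_mult power2_eq_square using L by (intro mult_mono assms) auto
  have q: "\<bar>A $ a $ b * A $ c $ d - A $ e $ f * A $ g $ h\<bar> \<le> 2 * L\<^sup>2" for a b c d e f g h
    using p[of a b c d] p[of e f g h] by linarith
  have "\<forall>k j. \<bar>cofactor_matrix A $ k $ j\<bar> \<le> 2 * L\<^sup>2"
    unfolding forall_3 cofactor_matrix_def det_3
    using q by (simp add: axis_def)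
  then show ?thesis by blast
qed

lemma det_bound:
  fixes A :: "real^3^3"
  assumes "\<And>k j. \<bar>A $ k $ j\<bar> \<le> L" shows "\<bar>det A\<bar> \<le> 6 * L ^ 3"
proof -
  have L: "0 \<le> L" using order_trans[OF abs_ge_zero assms] .
  have p: "\<bar>A $ a $ b * A $ c $ d * A $ e $ f\<bar> \<le> L ^ 3" for a b c d e f
    unfolding abs_mult power3_eq_cube using L by (intro mult_mono assms mult_nonneg_nonneg) auto
  show ?thesis
    unfolding det_3
    using p[of 1 1 2 2 3 3] p[of 1 2 2 3 3 1] p[of 1 3 2 1 3 2] p[of 1 1 2 3 3 2] p[of 1 2 2 1 3 3] p[of 1 3 2 2 3 1]
    by linarith
qed

text \<open>Multiply \<open>matrix_mul_cofactor_matrix\<close> by \<open>B\<close> from the left.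
  With \<open>B\<close> the Jacobian of the inverse map, cofactors are traded for that Jacobian
  throughout the change of variables.\<close>

lemma cofactor_eq_det_inverse:
  fixes A B :: "real^3^3"
  assumes "B ** A = mat 1" shows "cofactor_matrix A = det A *\<^sub>R B"
proof -
  have "cofactor_matrix A = B ** (A ** cofactor_matrix A)"
    by (simp add: matrix_mul_assoc assms)
  also have "\<dots> = B ** mat (det A)" by (simp add: matrix_mul_cofactor_matrix)
  also have "\<dots> = det A *\<^sub>R B"
    by (simp add: vec_eq_iff matrix_matrix_mult_def mat_def if_distrib cong: if_cong)
  finally show ?thesis .
qed

lemma complex_mat_scaleR_mult: "complex_mat (c *\<^sub>R A) *v v = c *\<^sub>R (complex_mat A *v v)"
proof -
  have "(complex_mat (c *\<^sub>R A) *v v) $ k = c *\<^sub>R ((complex_mat A *v v) $ k)" for k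
    by (simp add: matrix_vector_mult_def complex_mat_def scaleR_sum_right) (simp add: scaleR_conv_of_real mult.assoc)
  then show ?thesis by (simp add: vec_eq_iff)
qed

lemma bdot_transpose_left: "(complex_mat (transpose A) *v u) \<odot> v = u \<odot> (complex_mat A *v v)"
  by (simp add: bdot_3 matrix_vector_mult_def complex_mat_def transpose_def sum_3 algebra_simps)

lemma bdot_transpose_right: "u \<odot> (complex_mat (transpose A) *v v) = (complex_mat A *v u) \<odot> v"
  by (simp add: bdot_3 matrix_vector_mult_def complex_mat_def transpose_def sum_3 algebra_simps)

section \<open>Fields with zero tangential trace\<close>

lemma curl_nth: "curl \<phi> x $ 1 = partial 2 \<phi> x $ 3 - partial 3 \<phi> x $ 2"
  "curl \<phi> x $ 2 = partial 3 \<phi> x $ 1 - partial 1 \<phi> x $ 3"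
  "curl \<phi> x $ 3 = partial 1 \<phi> x $ 2 - partial 2 \<phi> x $ 1"
  by (simp_all add: curl_def)

lemma smooth_diff_nth:
  assumes "smooth f" "smooth g" shows "smooth (\<lambda>x. f x $ a - g x $ b)"
  unfolding smooth_def
proof
  fix k
  have "Ck k (\<lambda>x. f x $ a + (-1) *\<^sub>R (g x $ b))"
    by (intro Ck_add Ck_cscaleR Ck_nth smoothD assms)
  then show "Ck k (\<lambda>x. f x $ a - g x $ b)" by simp
qed

lemma smooth_curl: assumes "smooth \<phi>" shows "smooth (curl \<phi>)"
proof -
  have "smooth (\<lambda>x. curl \<phi> x $ i)" for i
  proof -
    have "\<forall>i. smooth (\<lambda>x. curl \<phi> x $ i)"
      unfolding forall_3 curl_nth
      by (intro conjI smooth_diff_nth smooth_partial assms)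
    then show ?thesis by blast
  qed
  then show ?thesis unfolding smooth_def by (auto intro: Ck_vec)
qed

lemma smooth_bounded_on:
  assumes "smooth \<phi>" "bounded S" shows "\<exists>C\<ge>0. \<forall>x\<in>S. norm (\<phi> x) \<le> C"
proof -
  have "compact (\<phi> ` closure S)"
    using assms by (intro compact_continuous_image smooth_continuous) (auto simp: compact_closure)
  then obtain C where "C > 0" "\<And>x. x \<in> closure S \<Longrightarrow> norm (\<phi> x) \<le> C"
    using compact_imp_bounded bounded_pos by (metis imageI)
  then show ?thesis using closure_subset by (metis less_imp_le subsetD)
qed

lemma continuous_measurable_on:
  "continuous_on UNIV f \<Longrightarrow> f \<in> borel_measurable (lebesgue_on S)"
  using measurable_restrict_space1[OF continuous_imp_borel_lebesgue] by blast

lemma integrable_bdot_bounded: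
  assumes U: "integrable M U" and g: "g \<in> borel_measurable M" and b: "AE x in M. norm (g x) \<le> C"
  shows "integrable M (\<lambda>x. U x \<odot> g x)"
proof (rule Bochner_Integration.integrable_bound)
  show "integrable M (\<lambda>x. 3 * C * norm (U x))" using U by auto
  show "(\<lambda>x. U x \<odot> g x) \<in> borel_measurable M" using U g by (auto intro: measurable_bdot)
  show "AE x in M. norm (U x \<odot> g x) \<le> norm (3 * C * norm (U x))"
    using b
  proof eventually_elim
    case (elim x)
    have "norm (U x \<odot> g x) \<le> 3 * norm (U x) * norm (g x)" by (rule norm_bdot_le)
    also have "\<dots> \<le> 3 * norm (U x) * C" using elim by (intro mult_left_mono) auto
    also have "\<dots> \<le> norm (3 * C * norm (U x))" by (simp add: mult_ac)
    finally show ?case .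
  qed
qed

lemma L2_integrable:
  assumes "\<Omega> \<in> lmeasurable" "L2 \<Omega> U" shows "integrable (lebesgue_on \<Omega>) U"
proof (rule Bochner_Integration.integrable_bound)
  interpret finite_measure "lebesgue_on \<Omega>" using assms(1) by (rule finite_measure_lebesgue_on)
  show "integrable (lebesgue_on \<Omega>) (\<lambda>x. 1 + (norm (U x))\<^sup>2)" using assms(2) by (auto simp: L2_def)
  show "AE x in lebesgue_on \<Omega>. norm (U x) \<le> norm (1 + (norm (U x))\<^sup>2)"
  proof (rule AE_I2)
    fix x
    have "0 \<le> (norm (U x) - 1)\<^sup>2" by simp
    then have "2 * norm (U x) \<le> 1 + (norm (U x))\<^sup>2" by (simp add: power2_eq_square algebra_simps)
    moreover have "norm (U x) \<ge> 0" by simp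
    ultimately show "norm (U x) \<le> norm (1 + (norm (U x))\<^sup>2)" by (simp only: real_norm_def)
  qed
qed (use assms in \<open>simp add: L2_def\<close>)

lemma L2_AE_cong:
  assumes "\<Omega> \<in> sets lebesgue" "L2 \<Omega> U" and ae: "AE x in lebesgue_on \<Omega>. U x = V x"
  shows "L2 \<Omega> V"
proof -
  have m: "V \<in> borel_measurable (lebesgue_on \<Omega>)"
    using measurable_lebesgue_on_AE_cong[OF assms(1) _ ae] assms(2) by (simp add: L2_def)
  have "integrable (lebesgue_on \<Omega>) (\<lambda>x. (norm (V x))\<^sup>2)"
    using assms(2) m ae
    by (subst integrable_cong_AE[where g="\<lambda>x. (norm (U x))\<^sup>2"]) (auto simp: L2_def elim!: eventually_mono)
  with m show ?thesis by (simp add: L2_def)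
qed

text \<open>
  By Green's formula this says \<open>W = curl U\<close> and \<open>n \<times> U = 0\<close> at once; unlike membership in
  \<open>H0curl\<close> it does not refer to the selected representative \<open>weak_curl\<close>.
\<close>

definition zero_trace_curl ::
  "(real^3) set \<Rightarrow> (real^3 \<Rightarrow> complex^3) \<Rightarrow> (real^3 \<Rightarrow> complex^3) \<Rightarrow> bool" where
  "zero_trace_curl \<Omega> U W \<longleftrightarrow> L2 \<Omega> U \<and> L2 \<Omega> W \<and>
     (\<forall>\<phi>. smooth \<phi> \<longrightarrow> (LINT x|lebesgue_on \<Omega>. W x \<odot> \<phi> x) = (LINT x|lebesgue_on \<Omega>. U x \<odot> curl \<phi> x))"

lemma integrable_L2_smooth:
  assumes \<Omega>: "open \<Omega>" "bounded \<Omega>" and U: "L2 \<Omega> U" and \<phi>: "smooth \<phi>"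
  shows "integrable (lebesgue_on \<Omega>) (\<lambda>x. U x \<odot> \<phi> x)"
proof -
  obtain C where "\<forall>x\<in>\<Omega>. norm (\<phi> x) \<le> C" using smooth_bounded_on[OF \<phi> \<Omega>(2)] by blast
  then show ?thesis
    using L2_integrable[OF bounded_open_lmeasurable[OF \<Omega>] U]
    by (intro integrable_bdot_bounded continuous_measurable_on smooth_continuous \<phi>) (auto intro!: AE_I2)
qed

lemma L2_locally_integrable:
  assumes "\<Omega> \<in> lmeasurable" "L2 \<Omega> U" shows "locally_integrable \<Omega> U"
  unfolding locally_integrable_def
proof (intro allI impI)
  fix K assume K: "compact K \<and> K \<subseteq> \<Omega>"
  have "set_integrable lebesgue \<Omega> U"
    using L2_integrable[OF assms] assms(1) by (simp add: set_integrable_def integrable_restrict_space fmeasurableD)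
  then show "set_integrable lebesgue K U"
    by (rule set_integrable_subset) (use K in \<open>auto simp: lmeasurable_compact fmeasurableD\<close>)
qed

lemma zero_trace_has_weak_curl:
  assumes "\<Omega> \<in> lmeasurable" "zero_trace_curl \<Omega> U W" shows "has_weak_curl \<Omega> U W"
proof -
  have "L2 \<Omega> U" "L2 \<Omega> W" using assms(2) by (auto simp: zero_trace_curl_def)
  then have "locally_integrable \<Omega> U" "locally_integrable \<Omega> W"
    by (auto intro: L2_locally_integrable[OF assms(1)])
  then show ?thesis
    using assms(2) by (simp add: has_weak_curl_def zero_trace_curl_def test_function_def)
qed

lemma smooth_of_real_axis:
  fixes \<psi> :: "real^3 \<Rightarrow> real"
  assumes "smooth \<psi>" shows "smooth (\<lambda>x. axis l (complex_of_real (\<psi> x)) :: complex^3)"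
proof -
  have "linear (\<lambda>r. axis l (complex_of_real r) :: complex^3)"
    by (rule linearI) (auto simp: vec_eq_iff axis_def scaleR_conv_of_real[where 'a=complex])
  then have bl: "bounded_linear (\<lambda>r. axis l (complex_of_real r) :: complex^3)"
    by (simp add: linear_conv_bounded_linear)
  show ?thesis unfolding smooth_def using bounded_linear.Ck_comp[OF bl] smoothD[OF assms] by blast
qed

lemma bdot_axis: "u \<odot> axis l (complex_of_real r) = r *\<^sub>R u $ l"
  by (simp add: bdot_def axis_def if_distrib scaleR_conv_of_real[where 'a=complex] mult.commute cong: if_cong)

text \<open>Test fields with a single nonzero component reduce the claim to
  \<open>fundamental_lemma\<close> for each component of the difference.\<close>

lemma has_weak_curl_unique:
  assumes \<Omega>: "open \<Omega>" and W: "has_weak_curl \<Omega> U W" and W': "has_weak_curl \<Omega> U W'"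
  shows "AE x in lebesgue_on \<Omega>. W x = W' x"
proof -
  have \<Omega>s: "\<Omega> \<in> sets lebesgue" using \<Omega> by auto
  have "AE x in lebesgue_on \<Omega>. W x $ l - W' x $ l = 0" for l
  proof (rule fundamental_lemma[OF \<Omega>])
    have "locally_integrable \<Omega> (\<lambda>x. V x $ l)" if "locally_integrable \<Omega> V" for V :: "real^3 \<Rightarrow> complex^3"
      unfolding locally_integrable_def set_integrable_def
    proof (intro allI impI)
      fix K assume "compact K \<and> K \<subseteq> \<Omega>"
      then have "integrable lebesgue (\<lambda>x. indicator K x *\<^sub>R V x)"
        using that integrable_indicator_compact by blast
      from integrable_bounded_linear[OF bounded_linear_vec_nth[of l] this]
      show "integrable lebesgue (\<lambda>x. indicator K x *\<^sub>R V x $ l)" by simp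
    qed
    then have li: "locally_integrable \<Omega> (\<lambda>x. W x $ l)" "locally_integrable \<Omega> (\<lambda>x. W' x $ l)"
      using W W' by (auto simp: has_weak_curl_def)
    then show "locally_integrable \<Omega> (\<lambda>x. W x $ l - W' x $ l)" by (rule locally_integrable_diff)
    fix \<psi> :: "real^3 \<Rightarrow> real" assume t: "test_function \<Omega> \<psi>"
    then have "test_function \<Omega> (\<lambda>x. axis l (complex_of_real (\<psi> x)) :: complex^3)"
      unfolding test_function_def using smooth_of_real_axis by (auto simp: axis_def vec_eq_iff)
    note tf = this
    have "(LINT x|lebesgue_on \<Omega>. W x \<odot> axis l (complex_of_real (\<psi> x)))
        = (LINT x|lebesgue_on \<Omega>. W' x \<odot> axis l (complex_of_real (\<psi> x)))"
      using W[unfolded has_weak_curl_def, THEN conjunct2, THEN conjunct2, rule_format, OF tf]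
        W'[unfolded has_weak_curl_def, THEN conjunct2, THEN conjunct2, rule_format, OF tf]
      by (rule trans[OF sym])
    then have eq: "(LINT x|lebesgue_on \<Omega>. \<psi> x *\<^sub>R W x $ l) = (LINT x|lebesgue_on \<Omega>. \<psi> x *\<^sub>R W' x $ l)"
      by (simp add: bdot_axis)
    have "(LINT x|lebesgue_on \<Omega>. \<psi> x *\<^sub>R (W x $ l - W' x $ l))
      = (LINT x|lebesgue_on \<Omega>. \<psi> x *\<^sub>R W x $ l) - (LINT x|lebesgue_on \<Omega>. \<psi> x *\<^sub>R W' x $ l)"
      unfolding scaleR_diff_right
      by (intro Bochner_Integration.integral_diff locally_integrable_test_scaleR[OF \<Omega>s t] li)
    then show "(LINT x|lebesgue_on \<Omega>. \<psi> x *\<^sub>R (W x $ l - W' x $ l)) = 0" using eq by simp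
  qed
  then have "AE x in lebesgue_on \<Omega>. \<forall>l\<in>UNIV. W x $ l - W' x $ l = 0"
    by (intro AE_finite_allI) auto
  then show ?thesis by eventually_elim (simp add: vec_eq_iff)
qed

lemma weak_curl_eq:
  assumes "open \<Omega>" "has_weak_curl \<Omega> U W"
  shows "AE x in lebesgue_on \<Omega>. weak_curl \<Omega> U x = W x"
proof -
  have "has_weak_curl \<Omega> U (weak_curl \<Omega> U)"
    unfolding weak_curl_def by (rule someI_ex[of "has_weak_curl \<Omega> U"]) (use assms(2) in blast)
  then show ?thesis using has_weak_curl_unique[OF assms(1)] assms(2) by blast
qed

text \<open>Together with \<open>H0curlI\<close> this translates between \<open>H0curl\<close> and
  \<open>zero_trace_curl\<close>. Splitting the trace integral requires both products to be
  integrable: square integrable fields are integrable on a bounded set, and smooth fields are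
  bounded there.\<close>

lemma H0curlD:
  assumes \<Omega>: "open \<Omega>" "bounded \<Omega>" and U: "U \<in> H0curl \<Omega>"
  shows "zero_trace_curl \<Omega> U (weak_curl \<Omega> U)" "\<And>x. x \<notin> \<Omega> \<Longrightarrow> U x = 0"
proof -
  have \<Omega>s: "\<Omega> \<in> sets lebesgue" using \<Omega> by auto
  obtain W where W: "L2 \<Omega> U" "has_weak_curl \<Omega> U W" "L2 \<Omega> W"
    using U by (auto simp: H0curl_def Hcurl_def)
  have ae: "AE x in lebesgue_on \<Omega>. W x = weak_curl \<Omega> U x"
    using weak_curl_eq[OF \<Omega>(1) W(2)] by eventually_elim simp
  have W': "L2 \<Omega> (weak_curl \<Omega> U)"
    by (rule L2_AE_cong[OF \<Omega>s W(3) ae])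
  have "(LINT x|lebesgue_on \<Omega>. weak_curl \<Omega> U x \<odot> \<phi> x) = (LINT x|lebesgue_on \<Omega>. U x \<odot> curl \<phi> x)"
    if \<phi>: "smooth \<phi>" for \<phi>
  proof -
    have "0 = (LINT x|lebesgue_on \<Omega>. weak_curl \<Omega> U x \<odot> \<phi> x - U x \<odot> curl \<phi> x)"
      using U \<phi> by (simp add: H0curl_def tangential_trace_def)
    also have "\<dots> = (LINT x|lebesgue_on \<Omega>. weak_curl \<Omega> U x \<odot> \<phi> x) - (LINT x|lebesgue_on \<Omega>. U x \<odot> curl \<phi> x)"
      by (intro Bochner_Integration.integral_diff integrable_L2_smooth[OF \<Omega>] W W' \<phi> smooth_curl)
    finally show ?thesis by simp
  qed
  with W W' show "zero_trace_curl \<Omega> U (weak_curl \<Omega> U)" by (simp add: zero_trace_curl_def)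
  show "U x = 0" if "x \<notin> \<Omega>" for x using U that by (simp add: H0curl_def)
qed

lemma H0curlI:
  assumes \<Omega>: "open \<Omega>" "bounded \<Omega>" and z: "zero_trace_curl \<Omega> U W" and off: "\<And>x. x \<notin> \<Omega> \<Longrightarrow> U x = 0"
  shows "U \<in> H0curl \<Omega>" "AE x in lebesgue_on \<Omega>. weak_curl \<Omega> U x = W x"
proof -
  have \<Omega>s: "\<Omega> \<in> sets lebesgue" using \<Omega> by auto
  have hw: "has_weak_curl \<Omega> U W" by (rule zero_trace_has_weak_curl[OF bounded_open_lmeasurable[OF \<Omega>] z])
  show ae: "AE x in lebesgue_on \<Omega>. weak_curl \<Omega> U x = W x" by (rule weak_curl_eq[OF \<Omega>(1) hw])
  have L: "L2 \<Omega> U" "L2 \<Omega> W" using z by (auto simp: zero_trace_curl_def)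
  have ae': "AE x in lebesgue_on \<Omega>. W x = weak_curl \<Omega> U x" using ae by eventually_elim simp
  have L': "L2 \<Omega> (weak_curl \<Omega> U)" by (rule L2_AE_cong[OF \<Omega>s L(2) ae'])
  have "tangential_trace \<Omega> U \<phi> = 0" if \<phi>: "smooth \<phi>" for \<phi>
  proof -
    have "tangential_trace \<Omega> U \<phi> = (LINT x|lebesgue_on \<Omega>. weak_curl \<Omega> U x \<odot> \<phi> x) - (LINT x|lebesgue_on \<Omega>. U x \<odot> curl \<phi> x)"
      unfolding tangential_trace_def
      by (intro Bochner_Integration.integral_diff integrable_L2_smooth[OF \<Omega>] L L' \<phi> smooth_curl)
    also have "(LINT x|lebesgue_on \<Omega>. weak_curl \<Omega> U x \<odot> \<phi> x) = (LINT x|lebesgue_on \<Omega>. W x \<odot> \<phi> x)"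
    proof (rule integral_cong_AE)
      show "AE x in lebesgue_on \<Omega>. weak_curl \<Omega> U x \<odot> \<phi> x = W x \<odot> \<phi> x" using ae by eventually_elim simp
    qed (intro borel_measurable_integrable integrable_L2_smooth[OF \<Omega>] L L' \<phi>)+
    finally show ?thesis using z \<phi> by (simp add: zero_trace_curl_def)
  qed
  then show "U \<in> H0curl \<Omega>" using L hw off by (auto simp: H0curl_def Hcurl_def)
qed

lemma zero_trace_diff:
  assumes \<Omega>: "open \<Omega>" "bounded \<Omega>" and "zero_trace_curl \<Omega> U W" "zero_trace_curl \<Omega> U' W'"
  shows "zero_trace_curl \<Omega> (\<lambda>x. U x - U' x) (\<lambda>x. W x - W' x)"
proof -
  have L: "L2 \<Omega> U" "L2 \<Omega> W" "L2 \<Omega> U'" "L2 \<Omega> W'" using assms by (auto simp: zero_trace_curl_def)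
  have L2d: "L2 \<Omega> (\<lambda>x. A x - B x)" if "L2 \<Omega> A" "L2 \<Omega> B" for A B
    unfolding L2_def
  proof
    show m: "(\<lambda>x. A x - B x) \<in> borel_measurable (lebesgue_on \<Omega>)" using that by (auto simp: L2_def)
    show "integrable (lebesgue_on \<Omega>) (\<lambda>x. (norm (A x - B x))\<^sup>2)"
    proof (rule Bochner_Integration.integrable_bound)
      show "integrable (lebesgue_on \<Omega>) (\<lambda>x. 2 * (norm (A x))\<^sup>2 + 2 * (norm (B x))\<^sup>2)"
        using that by (auto simp: L2_def)
      show "(\<lambda>x. (norm (A x - B x))\<^sup>2) \<in> borel_measurable (lebesgue_on \<Omega>)" using m by simp
      show "AE x in lebesgue_on \<Omega>. norm ((norm (A x - B x))\<^sup>2) \<le> norm (2 * (norm (A x))\<^sup>2 + 2 * (norm (B x))\<^sup>2)"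
      proof (rule AE_I2)
        fix x
        have "(norm (A x - B x))\<^sup>2 \<le> (norm (A x) + norm (B x))\<^sup>2"
          by (intro power_mono norm_triangle_ineq4) simp
        also have "\<dots> \<le> 2 * (norm (A x))\<^sup>2 + 2 * (norm (B x))\<^sup>2"
          using zero_le_power2[of "norm (A x) - norm (B x)"] by (simp add: power2_eq_square algebra_simps)
        finally show "norm ((norm (A x - B x))\<^sup>2) \<le> norm (2 * (norm (A x))\<^sup>2 + 2 * (norm (B x))\<^sup>2)" by simp
      qed
    qed
  qed
  have "(LINT x|lebesgue_on \<Omega>. (W x - W' x) \<odot> \<phi> x) = (LINT x|lebesgue_on \<Omega>. (U x - U' x) \<odot> curl \<phi> x)"
    if \<phi>: "smooth \<phi>" for \<phi>
    using that assms unfolding bdot_simps zero_trace_curl_def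
    by (simp add: Bochner_Integration.integral_diff integrable_L2_smooth[OF \<Omega>] smooth_curl)
  then show ?thesis using L L2d by (simp add: zero_trace_curl_def)
qed

text \<open>The test fields of \<open>zero_trace_curl\<close> are smooth on the whole space and need
  not vanish near the boundary of \<open>D\<close>. Green's identity on \<open>D\<close> is
  therefore already the one on \<Omega>, and the extended curl has no singular part on the
  boundary.\<close>

lemma zero_trace_ext:
  assumes \<Omega>: "\<Omega> \<in> sets lebesgue" and D: "D \<in> sets lebesgue" "D \<subseteq> \<Omega>"
    and z: "zero_trace_curl D U W" and off: "\<And>x. x \<notin> D \<Longrightarrow> U x = 0"
  shows "zero_trace_curl \<Omega> U (ext0 D W)"
proof -
  have U: "U = ext0 D U" using off by (auto simp: fun_eq_iff indicator_def)
  have "indicator \<Omega> x *\<^sub>R ext0 D V x = ext0 D V x" for x and V :: "real^3 \<Rightarrow> complex^3"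
    using D(2) by (auto simp: indicator_def)
  note ind = this
  have L: "L2 \<Omega> (ext0 D V)" if "L2 D V" for V
  proof -
    have "ext0 D V \<in> borel_measurable (lebesgue_on \<Omega>)"
      using that measurable_ext0_iff[OF D(1), of V] measurable_restrict_space1 unfolding L2_def by blast
    moreover have "integrable (lebesgue_on \<Omega>) (\<lambda>x. (norm (ext0 D V x))\<^sup>2)"
    proof -
      have "integrable lebesgue (\<lambda>x. indicator D x *\<^sub>R (norm (V x))\<^sup>2)"
        using that D by (simp add: L2_def integrable_restrict_space)
      moreover have "indicator D x *\<^sub>R (norm (V x))\<^sup>2 = indicator \<Omega> x *\<^sub>R (norm (ext0 D V x))\<^sup>2" for x
        using D(2) by (auto simp: indicator_def)
      ultimately show ?thesis using \<Omega> by (simp add: integrable_restrict_space)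
    qed
    ultimately show ?thesis by (simp add: L2_def)
  qed
  have I: "(LINT x|lebesgue_on \<Omega>. ext0 D V x \<odot> g x) = (LINT x|lebesgue_on D. V x \<odot> g x)" for V g
  proof -
    have "indicator \<Omega> x *\<^sub>R (ext0 D V x \<odot> g x) = indicator D x *\<^sub>R (V x \<odot> g x)" for x
      using D(2) by (auto simp: indicator_def bdot_simps)
    then show ?thesis using \<Omega> D by (simp add: integral_restrict_space)
  qed
  have "zero_trace_curl \<Omega> (ext0 D U) (ext0 D W)"
    using z L unfolding zero_trace_curl_def I by blast
  then show ?thesis using U by simp
qed

lemma conj_vec_nth [simp]: "conj_vec v $ k = cnj (v $ k)"
  by (simp add: conj_vec_def)

lemma bounded_linear_conj_vec: "bounded_linear conj_vec"
proof -
  have "linear conj_vec" by (rule linearI) (auto simp: vec_eq_iff)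
  then show ?thesis by (simp add: linear_conv_bounded_linear)
qed

lemma norm_conj_vec [simp]: "norm (conj_vec v) = norm v"
  by (simp add: norm_vec_def)

lemma conj_vec_conj_vec [simp]: "conj_vec (conj_vec v) = v"
  by (simp add: vec_eq_iff)

lemma cnj_bdot: "cnj (u \<odot> v) = conj_vec u \<odot> conj_vec v"
  by (simp add: bdot_3)

lemma smooth_conj: "smooth \<phi> \<Longrightarrow> smooth (\<lambda>x. conj_vec (\<phi> x))"
  unfolding smooth_def using bounded_linear.Ck_comp[OF bounded_linear_conj_vec] by blast

lemma curl_conj: assumes "smooth \<phi>" shows "curl (\<lambda>x. conj_vec (\<phi> x)) x = conj_vec (curl \<phi> x)"
proof -
  have "partial j (\<lambda>x. conj_vec (\<phi> x)) x = conj_vec (partial j \<phi> x)" for j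
  proof -
    have "(\<phi> has_derivative (\<lambda>h. \<Sum>j\<in>UNIV. h$j *\<^sub>R partial j \<phi> x)) (at x)"
      by (rule has_derivative_partial[OF smooth_differentiable[OF assms]])
    from partial_eqI[OF bounded_linear.has_derivative[OF bounded_linear_conj_vec this], of j]
    show ?thesis using sum_axis_scaleR[of j "\<lambda>j. partial j \<phi> x"] by simp
  qed
  then show ?thesis by (simp add: vec_eq_iff forall_3 curl_nth)
qed

lemma L2_conj: assumes "L2 \<Omega> V" shows "L2 \<Omega> (\<lambda>x. conj_vec (V x))"
  using assms bounded_linear.continuous_on[OF bounded_linear_conj_vec continuous_on_id, of UNIV]
  unfolding L2_def by (auto intro: measurable_compose[OF _ borel_measurable_continuous_onI])

text \<open>Conjugating the test field conjugates both sides of the identity. The result supplies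
  the curl of the conjugated second argument of \<open>Phi\<close>.\<close>

lemma zero_trace_conj:
  assumes \<Omega>: "open \<Omega>" "bounded \<Omega>" and z: "zero_trace_curl \<Omega> U W"
  shows "zero_trace_curl \<Omega> (\<lambda>x. conj_vec (U x)) (\<lambda>x. conj_vec (W x))"
proof -
  have L2: "L2 \<Omega> U" "L2 \<Omega> W" using z by (auto simp: zero_trace_curl_def)
  have C: "(LINT x|lebesgue_on \<Omega>. conj_vec (V x) \<odot> \<psi> x) = cnj (LINT x|lebesgue_on \<Omega>. V x \<odot> conj_vec (\<psi> x))"
    if "L2 \<Omega> V" "smooth \<psi>" for V \<psi>
    using integral_bounded_linear[OF bounded_linear_cnj integrable_L2_smooth[OF \<Omega> that(1) smooth_conj[OF that(2)]]]
    by (simp add: cnj_bdot)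
  have "(LINT x|lebesgue_on \<Omega>. conj_vec (W x) \<odot> \<phi> x) = (LINT x|lebesgue_on \<Omega>. conj_vec (U x) \<odot> curl \<phi> x)"
    if \<phi>: "smooth \<phi>" for \<phi>
  proof -
    have "(LINT x|lebesgue_on \<Omega>. W x \<odot> conj_vec (\<phi> x)) = (LINT x|lebesgue_on \<Omega>. U x \<odot> curl (\<lambda>x. conj_vec (\<phi> x)) x)"
      using z smooth_conj[OF \<phi>] unfolding zero_trace_curl_def by blast
    then show ?thesis
      unfolding C[OF L2(2) \<phi>] C[OF L2(1) smooth_curl[OF \<phi>]] curl_conj[OF \<phi>] by simp
  qed
  then show ?thesis using L2_conj L2 by (simp add: zero_trace_curl_def)
qed

lemma bdot_dominated_convergence:
  assumes W: "integrable M W" and m: "\<And>n. \<psi> n \<in> borel_measurable M" "\<psi>' \<in> borel_measurable M"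
    and lim: "AE x in M. (\<lambda>n. \<psi> n x) \<longlonglongrightarrow> \<psi>' x" and b: "\<And>n. AE x in M. norm (\<psi> n x) \<le> C"
  shows "integrable M (\<lambda>x. W x \<odot> \<psi>' x)" "(\<lambda>n. LINT x|M. W x \<odot> \<psi> n x) \<longlonglongrightarrow> (LINT x|M. W x \<odot> \<psi>' x)"
proof -
  have 1: "integrable M (\<lambda>x. 3 * norm (W x) * C)" using W by auto
  have 2: "AE x in M. norm (W x \<odot> \<psi> n x) \<le> 3 * norm (W x) * C" for n
    using b[of n]
  proof eventually_elim
    case (elim x)
    have "norm (W x \<odot> \<psi> n x) \<le> 3 * norm (W x) * norm (\<psi> n x)" by (rule norm_bdot_le)
    also have "\<dots> \<le> 3 * norm (W x) * C" using elim by (intro mult_left_mono) auto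
    finally show ?case .
  qed
  have 3: "AE x in M. (\<lambda>n. W x \<odot> \<psi> n x) \<longlonglongrightarrow> W x \<odot> \<psi>' x"
    using lim by eventually_elim (intro bounded_bilinear.tendsto[OF bounded_bilinear_bdot] tendsto_const)
  have 4: "(\<lambda>x. W x \<odot> \<psi>' x) \<in> borel_measurable M" "(\<lambda>x. W x \<odot> \<psi> n x) \<in> borel_measurable M" for n
    using W m by (auto intro: measurable_bdot)
  show "integrable M (\<lambda>x. W x \<odot> \<psi>' x)" "(\<lambda>n. LINT x|M. W x \<odot> \<psi> n x) \<longlonglongrightarrow> (LINT x|M. W x \<odot> \<psi>' x)"
    by (rule integrable_dominated_convergence[OF 4 1 3 2], rule integral_dominated_convergence[OF 4 1 3 2])
qed

lemma tendsto_cofactor_matrix: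
  assumes "\<And>k j. (\<lambda>n. A n $ k $ j) \<longlonglongrightarrow> A' $ k $ j"
  shows "(\<lambda>n. cofactor_matrix (A n) $ k $ j) \<longlonglongrightarrow> cofactor_matrix A' $ k $ j"
proof -
  have q: "(\<lambda>n. A n $ a $ b * A n $ c $ d - A n $ e $ f * A n $ g $ h)
      \<longlonglongrightarrow> A' $ a $ b * A' $ c $ d - A' $ e $ f * A' $ g $ h" for a b c d e f g h
    by (intro tendsto_diff tendsto_mult assms)
  have "\<forall>k j. (\<lambda>n. cofactor_matrix (A n) $ k $ j) \<longlonglongrightarrow> cofactor_matrix A' $ k $ j"
    unfolding forall_3 cofactor_matrix_def det_3
    using q by (simp add: axis_def)
  then show ?thesis by blast
qed

lemma measurable_cofactor_matrix:
  assumes "\<And>k j. (\<lambda>x. A x $ k $ j) \<in> borel_measurable M"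
  shows "(\<lambda>x. cofactor_matrix (A x) $ k $ j) \<in> borel_measurable M"
proof -
  have q: "(\<lambda>x. A x $ a $ b * A x $ c $ d - A x $ e $ f * A x $ g $ h) \<in> borel_measurable M" for a b c d e f g h
    by (intro borel_measurable_diff borel_measurable_times assms)
  have "\<forall>k j. (\<lambda>x. cofactor_matrix (A x) $ k $ j) \<in> borel_measurable M"
    unfolding forall_3 cofactor_matrix_def det_3
    using q by (simp add: axis_def)
  then show ?thesis by blast
qed

lemma tendsto_complex_mat_mult:
  assumes "\<And>k j. (\<lambda>n. A n $ k $ j) \<longlonglongrightarrow> A' $ k $ j" "v \<longlonglongrightarrow> v'"
  shows "(\<lambda>n. complex_mat (A n) *v v n) \<longlonglongrightarrow> complex_mat A' *v v'"
proof (rule vec_tendstoI)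
  fix k
  have "(\<lambda>n. \<Sum>j\<in>UNIV. complex_of_real (A n $ k $ j) * v n $ j) \<longlonglongrightarrow> (\<Sum>j\<in>UNIV. complex_of_real (A' $ k $ j) * v' $ j)"
    by (intro tendsto_intros assms)
  then show "(\<lambda>n. (complex_mat (A n) *v v n) $ k) \<longlonglongrightarrow> (complex_mat A' *v v') $ k"
    by (simp add: matrix_vector_mult_def complex_mat_def)
qed

lemma norm_complex_mat_mult_le:
  assumes "\<And>k j. \<bar>A $ k $ j\<bar> \<le> c" shows "norm (complex_mat A *v v) \<le> 9 * c * norm v"
  by (rule norm_mat_mult_le) (simp add: complex_mat_def assms)

section \<open>Pull-back of fields with zero tangential trace\<close>

lemma measurable_lebesgue_on_subset:
  "f \<in> borel_measurable (lebesgue_on \<Omega>) \<Longrightarrow> D \<subseteq> \<Omega> \<Longrightarrow> f \<in> borel_measurable (lebesgue_on D)"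
  by (rule measurable_restrict_mono)

lemma AE_lebesgue_on_subset:
  assumes "AE x in lebesgue_on \<Omega>. P x" "D \<subseteq> \<Omega>" "\<Omega> \<in> sets lebesgue" "D \<in> sets lebesgue"
  shows "AE x in lebesgue_on D. P x"
  using assms(1) assms(2) unfolding AE_lebesgue_on_iff[OF assms(3)] AE_lebesgue_on_iff[OF assms(4)]
  by (auto elim!: eventually_mono)

context W1inf_map
begin

lemma moll_map_bound:
  assumes r: "0 < r" shows "norm (moll r (ext0 \<Omega> T) y) \<le> Linf_norm \<Omega> T"
proof -
  have "norm (moll r (ext0 \<Omega> T) y - 0) \<le> Linf_norm \<Omega> T"
  proof (rule norm_moll_minus_le_AE[OF r integrable_map])
    have "AE x in lebesgue_on \<Omega>. norm (T x) \<le> Linf_norm \<Omega> T"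
      using W1 by (intro Linf_norm_AE) (simp add: W1inf_def)
    then show "AE x in lebesgue. x \<in> cube y r \<longrightarrow> norm (ext0 \<Omega> T x - 0) \<le> Linf_norm \<Omega> T"
      unfolding AE_lebesgue_on_iff[OF sets_dom]
      by eventually_elim (auto simp: indicator_def Linf_norm_nonneg)
  qed
  then show ?thesis by simp
qed

lemma moll_wp_bound:
  assumes r: "0 < r" shows "norm (moll r (ext0 \<Omega> (weak_partial \<Omega> j T)) y) \<le> W1inf_norm \<Omega> T"
proof -
  have "norm (moll r (ext0 \<Omega> (weak_partial \<Omega> j T)) y - 0) \<le> W1inf_norm \<Omega> T"
  proof (rule norm_moll_minus_le_AE[OF r integrable_wp])
    show "AE x in lebesgue. x \<in> cube y r \<longrightarrow> norm (ext0 \<Omega> (weak_partial \<Omega> j T) x - 0) \<le> W1inf_norm \<Omega> T"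
      using wp_bound[of j] unfolding AE_lebesgue_on_iff[OF sets_dom]
      by eventually_elim (auto simp: indicator_def W1inf_norm_nonneg)
  qed
  then show ?thesis by simp
qed

text \<open>
  The covariant pull-back of a smooth field by the Lipschitz map is not smooth; it is the limit of
  the pull-backs by the mollified map, which are admissible test fields.
\<close>

lemma zero_trace_limit:
  assumes D: "open D" "D \<subseteq> \<Omega>" and r0: "r0 > 0" "\<And>y. y \<in> D \<Longrightarrow> cube y r0 \<subseteq> \<Omega>"
    and z: "zero_trace_curl D E W" and \<phi>: "smooth \<phi>"
  shows "integrable (lebesgue_on D) (\<lambda>y. W y \<odot> (complex_mat (transpose (dT y)) *v \<phi> (T y)))"
    and "integrable (lebesgue_on D) (\<lambda>y. E y \<odot> (complex_mat (cofactor_matrix (dT y)) *v curl \<phi> (T y)))"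
    and "(LINT y|lebesgue_on D. W y \<odot> (complex_mat (transpose (dT y)) *v \<phi> (T y)))
       = (LINT y|lebesgue_on D. E y \<odot> (complex_mat (cofactor_matrix (dT y)) *v curl \<phi> (T y)))"
proof -
  have Ds: "D \<in> sets lebesgue" using D by auto
  have Db: "bounded D" using D(2) bounded_dom bounded_subset by blast
  have Dl: "D \<in> lmeasurable" by (rule bounded_open_lmeasurable[OF D(1) Db])
  have WE: "integrable (lebesgue_on D) W" "integrable (lebesgue_on D) E"
    using z L2_integrable[OF Dl] by (auto simp: zero_trace_curl_def)
  \<comment> \<open>A sequence, because dominated convergence is applied along sequences; its bound
    \<open>r0\<close> keeps all kernels centred in \<open>D\<close> inside \<Omega>.\<close>
  define r where "r n = r0 / (real n + 1)" for n
  have r: "0 < r n" "r n \<le> r0" for n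
  proof -
    show "0 < r n" using r0(1) by (simp add: r_def add_nonneg_pos)
    have "r0 * 1 \<le> r0 * (real n + 1)" using r0(1) by (intro mult_left_mono) auto
    then show "r n \<le> r0" by (simp add: r_def pos_divide_le_eq add_nonneg_pos)
  qed
  have "r \<longlonglongrightarrow> 0"
  proof -
    have "(\<lambda>n. r0 * inverse (real (Suc n))) \<longlonglongrightarrow> r0 * 0"
      by (intro tendsto_mult tendsto_const LIMSEQ_inverse_real_of_nat)
    then show ?thesis by (simp add: r_def[abs_def] divide_inverse add.commute)
  qed
  then have rlim: "filterlim r (at_right 0) sequentially"
    using r(1) less_imp_neq[OF r(1)] by (auto simp: filterlim_at intro!: always_eventually)
  let ?T = "\<lambda>n. moll (r n) (ext0 \<Omega> T)"
  have sm: "smooth (?T n)" for n by (rule smooth_moll[OF r(1) integrable_map])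
  \<comment> \<open>On \<open>D\<close> the kernel cubes avoid the boundary of \<Omega>, so the zero
    extension does not disturb the gradient of the mollified map.\<close>
  have jac: "jac (?T n) y = (\<chi> k j. moll (r n) (ext0 \<Omega> (weak_partial \<Omega> j T)) y $ k)" if y: "y \<in> D" for n y
  proof -
    have "cube y (r n) \<subseteq> \<Omega>" using r0(2)[OF y] cube_mono[OF r(2)] by blast
    then show ?thesis
      unfolding jac_def using partial_moll[OF wp(1) open_dom r(1) _ integrable_map] by (simp add: vec_eq_iff)
  qed
  define b where "b = Linf_norm \<Omega> T"
  define L where "L = W1inf_norm \<Omega> T"
  have jb: "\<bar>jac (?T n) y $ k $ j\<bar> \<le> L" if "y \<in> D" for n y k j
    unfolding jac[OF that] L_def
    using order_trans[OF component_le_norm_cart moll_wp_bound[OF r(1)]] by simp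
  have Lim_T: "(\<lambda>n. ?T n y) \<longlonglongrightarrow> T y" if y: "y \<in> D" for y
  proof -
    have "y \<in> \<Omega>" using y D by auto
    then have "((\<lambda>r. moll r (ext0 \<Omega> T) y) \<longlongrightarrow> ext0 \<Omega> T y) (at_right 0)"
      by (intro moll_tendsto integrable_map lebesgue_point_ext0_continuous[OF open_dom integrable_map cont])
    from filterlim_compose[OF this rlim] show ?thesis using \<open>y \<in> \<Omega>\<close> by simp
  qed
  have Lim_J: "AE y in lebesgue_on D. \<forall>k j. (\<lambda>n. jac (?T n) y $ k $ j) \<longlonglongrightarrow> dT y $ k $ j"
  proof -
    have "AE x in lebesgue. \<forall>j\<in>UNIV. lebesgue_point (ext0 \<Omega> (weak_partial \<Omega> j T)) x"
      by (intro AE_finite_allI ae_lebesgue_point integrable_wp) auto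
    then show ?thesis
      unfolding AE_lebesgue_on_iff[OF Ds]
    proof eventually_elim
      case (elim y)
      show ?case
      proof (intro impI allI)
        fix k j assume y: "y \<in> D"
        then have "y \<in> \<Omega>" using D by auto
        have "((\<lambda>r. moll r (ext0 \<Omega> (weak_partial \<Omega> j T)) y) \<longlongrightarrow> ext0 \<Omega> (weak_partial \<Omega> j T) y) (at_right 0)"
          using elim by (intro moll_tendsto integrable_wp) auto
        from tendsto_vec_nth[OF filterlim_compose[OF this rlim], of k]
        show "(\<lambda>n. jac (?T n) y $ k $ j) \<longlonglongrightarrow> dT y $ k $ j"
          using \<open>y \<in> \<Omega>\<close> by (simp add: jac[OF y] weak_jacobian_def)
      qed
    qed
  qed
  have Lim_\<phi>: "(\<lambda>n. \<psi> (?T n y)) \<longlonglongrightarrow> \<psi> (T y)" if "smooth \<psi>" "y \<in> D" for \<psi> :: "real^3 \<Rightarrow> complex^3" and y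
  proof -
    have "isCont \<psi> (T y)" using smooth_continuous[OF that(1), of UNIV] continuous_on_eq_continuous_at by blast
    then show ?thesis using Lim_T[OF that(2)] by (rule isCont_tendsto_compose)
  qed
  have mT: "(\<lambda>y. \<psi> (T y)) \<in> borel_measurable (lebesgue_on D)" if "smooth \<psi>" for \<psi> :: "real^3 \<Rightarrow> complex^3"
  proof -
    have "continuous_on D (\<lambda>y. \<psi> (T y))"
      by (rule continuous_on_compose2[OF smooth_continuous[OF that, of UNIV]])
        (use cont D(2) continuous_on_subset in blast)+
    then show ?thesis by (rule continuous_imp_measurable_on_sets_lebesgue[OF _ Ds])
  qed
  have mJ: "(\<lambda>y. dT y $ k $ j) \<in> borel_measurable (lebesgue_on D)" for k j
    by (rule measurable_lebesgue_on_subset[OF measurable_jacobian_nth D(2)])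
  \<comment> \<open>The mollified maps need not take values in \<Omega>, but they stay in the ball
    of radius \<open>b\<close>, on which smooth fields are bounded; this bound is uniform in
    \<open>n\<close>.\<close>
  have bd: "\<exists>C\<ge>0. \<forall>n y. norm (\<psi> (?T n y)) \<le> C" if s: "smooth \<psi>" for \<psi> :: "real^3 \<Rightarrow> complex^3"
  proof -
    obtain C where "C \<ge> 0" "\<forall>x\<in>cball 0 b. norm (\<psi> x) \<le> C" using smooth_bounded_on[OF s bounded_cball] by blast
    then show ?thesis using moll_map_bound[OF r(1)] by (auto simp: b_def)
  qed
  obtain C where C: "C \<ge> 0" "\<And>n y. norm (\<phi> (?T n y)) \<le> C" using bd[OF \<phi>] by blast
  obtain C' where C': "C' \<ge> 0" "\<And>n y. norm (curl \<phi> (?T n y)) \<le> C'" using bd[OF smooth_curl[OF \<phi>]] by blast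
  have L0: "L \<ge> 0" by (simp add: L_def W1inf_norm_nonneg)
  have sp: "smooth (smooth_pull (?T n) \<phi>)" for n by (rule smooth_smooth_pull[OF sm \<phi>])
  have lim1: "integrable (lebesgue_on D) (\<lambda>y. W y \<odot> (complex_mat (transpose (dT y)) *v \<phi> (T y)))"
     "(\<lambda>n. LINT y|lebesgue_on D. W y \<odot> smooth_pull (?T n) \<phi> y)
       \<longlonglongrightarrow> (LINT y|lebesgue_on D. W y \<odot> (complex_mat (transpose (dT y)) *v \<phi> (T y)))"
  proof -
    have m: "smooth_pull (?T n) \<phi> \<in> borel_measurable (lebesgue_on D)" for n
      by (rule continuous_measurable_on[OF smooth_continuous[OF sp]])
    have m': "(\<lambda>y. complex_mat (transpose (dT y)) *v \<phi> (T y)) \<in> borel_measurable (lebesgue_on D)"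
      by (intro measurable_complex_mat_mult mT[OF \<phi>]) (simp add: transpose_def mJ)
    have l: "AE y in lebesgue_on D. (\<lambda>n. smooth_pull (?T n) \<phi> y) \<longlonglongrightarrow> complex_mat (transpose (dT y)) *v \<phi> (T y)"
      using Lim_J AE_space
    proof eventually_elim
      case (elim y)
      then show ?case unfolding smooth_pull_def
        by (intro tendsto_complex_mat_mult Lim_\<phi> \<phi>) (auto simp: transpose_def)
    qed
    have bb: "AE y in lebesgue_on D. norm (smooth_pull (?T n) \<phi> y) \<le> 9 * L * C" for n
      using AE_space
    proof eventually_elim
      case (elim y)
      then have "norm (smooth_pull (?T n) \<phi> y) \<le> 9 * L * norm (\<phi> (?T n y))"
        unfolding smooth_pull_def by (intro norm_complex_mat_mult_le) (simp add: transpose_def jb)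
      also have "\<dots> \<le> 9 * L * C" using L0 C by (intro mult_left_mono) auto
      finally show ?case .
    qed
    show "integrable (lebesgue_on D) (\<lambda>y. W y \<odot> (complex_mat (transpose (dT y)) *v \<phi> (T y)))"
     "(\<lambda>n. LINT y|lebesgue_on D. W y \<odot> smooth_pull (?T n) \<phi> y)
       \<longlonglongrightarrow> (LINT y|lebesgue_on D. W y \<odot> (complex_mat (transpose (dT y)) *v \<phi> (T y)))"
      using bdot_dominated_convergence[OF WE(1) m m' l bb] by auto
  qed
  have lim2: "integrable (lebesgue_on D) (\<lambda>y. E y \<odot> (complex_mat (cofactor_matrix (dT y)) *v curl \<phi> (T y)))"
     "(\<lambda>n. LINT y|lebesgue_on D. E y \<odot> curl (smooth_pull (?T n) \<phi>) y)
       \<longlonglongrightarrow> (LINT y|lebesgue_on D. E y \<odot> (complex_mat (cofactor_matrix (dT y)) *v curl \<phi> (T y)))"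
  proof -
    have m: "curl (smooth_pull (?T n) \<phi>) \<in> borel_measurable (lebesgue_on D)" for n
      by (rule continuous_measurable_on[OF smooth_continuous[OF smooth_curl[OF sp]]])
    have m': "(\<lambda>y. complex_mat (cofactor_matrix (dT y)) *v curl \<phi> (T y)) \<in> borel_measurable (lebesgue_on D)"
      by (intro measurable_complex_mat_mult mT[OF smooth_curl[OF \<phi>]] measurable_cofactor_matrix mJ)
    have l: "AE y in lebesgue_on D. (\<lambda>n. curl (smooth_pull (?T n) \<phi>) y) \<longlonglongrightarrow> complex_mat (cofactor_matrix (dT y)) *v curl \<phi> (T y)"
      using Lim_J AE_space
    proof eventually_elim
      case (elim y)
      then show ?case unfolding curl_smooth_pull[OF sm \<phi>]
        by (intro tendsto_complex_mat_mult Lim_\<phi> smooth_curl \<phi> tendsto_cofactor_matrix) auto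
    qed
    have bb: "AE y in lebesgue_on D. norm (curl (smooth_pull (?T n) \<phi>) y) \<le> 9 * (2 * L\<^sup>2) * C'" for n
      using AE_space
    proof eventually_elim
      case (elim y)
      then have "norm (curl (smooth_pull (?T n) \<phi>) y) \<le> 9 * (2 * L\<^sup>2) * norm (curl \<phi> (?T n y))"
        unfolding curl_smooth_pull[OF sm \<phi>] by (intro norm_complex_mat_mult_le cofactor_nth_bound) (simp add: jb)
      also have "\<dots> \<le> 9 * (2 * L\<^sup>2) * C'" using C' by (intro mult_left_mono) auto
      finally show ?case .
    qed
    show "integrable (lebesgue_on D) (\<lambda>y. E y \<odot> (complex_mat (cofactor_matrix (dT y)) *v curl \<phi> (T y)))"
     "(\<lambda>n. LINT y|lebesgue_on D. E y \<odot> curl (smooth_pull (?T n) \<phi>) y)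
       \<longlonglongrightarrow> (LINT y|lebesgue_on D. E y \<odot> (complex_mat (cofactor_matrix (dT y)) *v curl \<phi> (T y)))"
      using bdot_dominated_convergence[OF WE(2) m m' l bb] by auto
  qed
  have "(LINT y|lebesgue_on D. W y \<odot> smooth_pull (?T n) \<phi> y) = (LINT y|lebesgue_on D. E y \<odot> curl (smooth_pull (?T n) \<phi>) y)" for n
    using z sp unfolding zero_trace_curl_def by blast
  then have "(LINT y|lebesgue_on D. W y \<odot> (complex_mat (transpose (dT y)) *v \<phi> (T y)))
       = (LINT y|lebesgue_on D. E y \<odot> (complex_mat (cofactor_matrix (dT y)) *v curl \<phi> (T y)))"
    using lim1(2) lim2(2) LIMSEQ_unique by simp
  with lim1(1) lim2(1) show "integrable (lebesgue_on D) (\<lambda>y. W y \<odot> (complex_mat (transpose (dT y)) *v \<phi> (T y)))"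
    "integrable (lebesgue_on D) (\<lambda>y. E y \<odot> (complex_mat (cofactor_matrix (dT y)) *v curl \<phi> (T y)))"
    "(LINT y|lebesgue_on D. W y \<odot> (complex_mat (transpose (dT y)) *v \<phi> (T y)))
       = (LINT y|lebesgue_on D. E y \<odot> (complex_mat (cofactor_matrix (dT y)) *v curl \<phi> (T y)))"
    by blast+
qed

end

lemma L2_mat_mult:
  assumes U: "U \<in> sets lebesgue" and V: "L2 U V" and m: "\<And>k j. (\<lambda>x. A x $ k $ j) \<in> borel_measurable (lebesgue_on U)"
    and b: "AE x in lebesgue_on U. \<forall>k j. \<bar>A x $ k $ j\<bar> \<le> c"
  shows "L2 U (\<lambda>x. complex_mat (A x) *v V x)"
  unfolding L2_def
proof
  show mm: "(\<lambda>x. complex_mat (A x) *v V x) \<in> borel_measurable (lebesgue_on U)"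
    using V by (intro measurable_complex_mat_mult m) (simp add: L2_def)
  show "integrable (lebesgue_on U) (\<lambda>x. (norm (complex_mat (A x) *v V x))\<^sup>2)"
  proof (rule Bochner_Integration.integrable_bound)
    show "integrable (lebesgue_on U) (\<lambda>x. (9 * c)\<^sup>2 * (norm (V x))\<^sup>2)" using V by (simp add: L2_def)
    show "(\<lambda>x. (norm (complex_mat (A x) *v V x))\<^sup>2) \<in> borel_measurable (lebesgue_on U)" using mm by simp
    show "AE x in lebesgue_on U. norm ((norm (complex_mat (A x) *v V x))\<^sup>2) \<le> norm ((9 * c)\<^sup>2 * (norm (V x))\<^sup>2)"
      using b
    proof eventually_elim
      case (elim x)
      then have "norm (complex_mat (A x) *v V x) \<le> 9 * c * norm (V x)" by (intro norm_complex_mat_mult_le) auto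
      then have "(norm (complex_mat (A x) *v V x))\<^sup>2 \<le> (9 * c * norm (V x))\<^sup>2" by (intro power_mono) auto
      then show ?case by (simp add: power_mult_distrib)
    qed
  qed
qed

context W1inf_homeo
begin

text \<open>The lower bound on the determinant lets the Jacobian factor be inserted at the price of
  \<open>c\<close>, after which the change of variables applies.\<close>

lemma L2_compose:
  assumes U: "open U" "U \<subseteq> \<Omega>" and c: "c \<ge> 0" "AE x in lebesgue_on U. 0 < det (T.dT x) \<and> 1 \<le> c * det (T.dT x)"
    and E: "L2 (T ` U) E"
  shows "L2 U (\<lambda>x. E (T x))"
    and "(LINT x|lebesgue_on U. (norm (E (T x)))\<^sup>2) \<le> c * (LINT y|lebesgue_on (T ` U). (norm (E y))\<^sup>2)"
proof -
  have Us: "U \<in> sets lebesgue" using U by auto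
  have Ub: "bounded U" using U(2) T.bounded_dom bounded_subset by blast
  have "T ` U \<subseteq> \<Omega>" using U(2) T_in by auto
  then have TUb: "bounded (T ` U)" using T.bounded_dom bounded_subset by blast
  have iE: "integrable (lebesgue_on (T ` U)) E"
    by (rule L2_integrable[OF bounded_open_lmeasurable[OF open_image[OF U] TUb] E])
  have mdet: "(\<lambda>x. det (T.dT x)) \<in> borel_measurable (lebesgue_on U)"
    unfolding det_3
    by (intro borel_measurable_add borel_measurable_diff borel_measurable_times
        measurable_lebesgue_on_subset[OF T.measurable_jacobian_nth U(2)])
  \<comment> \<open>Composing a Lebesgue measurable function with \<open>T\<close> is not measurable
    for free. The change of variables provides measurability of the composition times the
    determinant, which is then divided out.\<close>
  have m: "(\<lambda>x. E (T x)) \<in> borel_measurable (lebesgue_on U)"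
  proof (rule measurable_lebesgue_on_AE_cong[OF Us])
    show "(\<lambda>x. inverse (det (T.dT x)) *\<^sub>R (\<bar>det (T.dT x)\<bar> *\<^sub>R E (T x))) \<in> borel_measurable (lebesgue_on U)"
      by (intro borel_measurable_scaleR borel_measurable_inverse mdet
          borel_measurable_integrable[OF change_variables(1)[OF U iE]])
    show "AE x in lebesgue_on U. inverse (det (T.dT x)) *\<^sub>R (\<bar>det (T.dT x)\<bar> *\<^sub>R E (T x)) = E (T x)"
      using c(2) by eventually_elim simp
  qed
  have i2: "integrable (lebesgue_on (T ` U)) (\<lambda>y. (norm (E y))\<^sup>2)" using E by (simp add: L2_def)
  have i3: "integrable (lebesgue_on U) (\<lambda>x. c * (\<bar>det (T.dT x)\<bar> *\<^sub>R (norm (E (T x)))\<^sup>2))"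
    using change_variables(1)[OF U i2] by (rule integrable_mult_right)
  have le: "AE x in lebesgue_on U. (norm (E (T x)))\<^sup>2 \<le> c * (\<bar>det (T.dT x)\<bar> *\<^sub>R (norm (E (T x)))\<^sup>2)"
    using c(2)
  proof eventually_elim
    case (elim x)
    then have "1 * (norm (E (T x)))\<^sup>2 \<le> (c * det (T.dT x)) * (norm (E (T x)))\<^sup>2"
      by (intro mult_right_mono) auto
    then show ?case using elim by (simp add: mult.assoc)
  qed
  have i4: "integrable (lebesgue_on U) (\<lambda>x. (norm (E (T x)))\<^sup>2)"
  proof (rule Bochner_Integration.integrable_bound[OF i3])
    show "(\<lambda>x. (norm (E (T x)))\<^sup>2) \<in> borel_measurable (lebesgue_on U)" using m by simp
    show "AE x in lebesgue_on U. norm ((norm (E (T x)))\<^sup>2) \<le> norm (c * (\<bar>det (T.dT x)\<bar> *\<^sub>R (norm (E (T x)))\<^sup>2))"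
      using le by eventually_elim (use c(1) in simp)
  qed
  show "L2 U (\<lambda>x. E (T x))" using m i4 by (simp add: L2_def)
  have "(LINT x|lebesgue_on U. (norm (E (T x)))\<^sup>2) \<le> (LINT x|lebesgue_on U. c * (\<bar>det (T.dT x)\<bar> *\<^sub>R (norm (E (T x)))\<^sup>2))"
    by (rule integral_mono_AE[OF i4 i3 le])
  also have "\<dots> = c * (LINT y|lebesgue_on (T ` U). (norm (E y))\<^sup>2)"
    using change_variables(2)[OF U i2] by simp
  finally show "(LINT x|lebesgue_on U. (norm (E (T x)))\<^sup>2) \<le> c * (LINT y|lebesgue_on (T ` U). (norm (E y))\<^sup>2)" .
qed

text \<open>The identity for the pulled-back pair, tested with \<phi>, is
  \<open>S.zero_trace_limit\<close> for the same \<phi>, read in the variable \<open>x\<close>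
  instead of \<open>y = T x\<close>.\<close>

lemma zero_trace_pull_back:
  assumes U: "open U" "U \<subseteq> \<Omega>" and r0: "r0 > 0" "\<And>y. y \<in> T ` U \<Longrightarrow> cube y r0 \<subseteq> \<Omega>"
    and c: "c \<ge> 0" "AE x in lebesgue_on U. 0 < det (T.dT x) \<and> 1 \<le> c * det (T.dT x)"
    and z: "zero_trace_curl (T ` U) E W"
  shows "zero_trace_curl U (\<lambda>x. complex_mat (transpose (T.dT x)) *v E (T x))
     (\<lambda>x. complex_mat (cofactor_matrix (T.dT x)) *v W (T x))"
  unfolding zero_trace_curl_def
proof (intro conjI allI impI)
  have Us: "U \<in> sets lebesgue" using U by auto
  have Ub: "bounded U" using U(2) T.bounded_dom bounded_subset by blast
  have D: "open (T ` U)" "T ` U \<subseteq> \<Omega>" using open_image[OF U] U(2) T_in by auto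
  have mJ: "(\<lambda>x. T.dT x $ k $ j) \<in> borel_measurable (lebesgue_on U)" for k j
    by (rule measurable_lebesgue_on_subset[OF T.measurable_jacobian_nth U(2)])
  have bJ: "AE x in lebesgue_on U. \<forall>k j. \<bar>T.dT x $ k $ j\<bar> \<le> W1inf_norm \<Omega> T"
    by (rule AE_lebesgue_on_subset[OF T.jacobian_nth_bound U(2) _ Us]) simp
  have L: "L2 (T ` U) E" "L2 (T ` U) W" using z by (auto simp: zero_trace_curl_def)
  show LE: "L2 U (\<lambda>x. complex_mat (transpose (T.dT x)) *v E (T x))"
  proof (rule L2_mat_mult[OF Us L2_compose(1)[OF U c L(1)]])
    show "AE x in lebesgue_on U. \<forall>k j. \<bar>transpose (T.dT x) $ k $ j\<bar> \<le> W1inf_norm \<Omega> T"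
      using bJ by eventually_elim (simp add: transpose_def)
  qed (simp add: transpose_def mJ)
  show LW: "L2 U (\<lambda>x. complex_mat (cofactor_matrix (T.dT x)) *v W (T x))"
  proof (rule L2_mat_mult[OF Us L2_compose(1)[OF U c L(2)]])
    show "AE x in lebesgue_on U. \<forall>k j. \<bar>cofactor_matrix (T.dT x) $ k $ j\<bar> \<le> 2 * (W1inf_norm \<Omega> T)\<^sup>2"
      using bJ by eventually_elim (auto intro!: cofactor_nth_bound)
  qed (intro measurable_cofactor_matrix mJ)
  fix \<phi> :: "real^3 \<Rightarrow> complex^3" assume \<phi>: "smooth \<phi>"
  note lim = S.zero_trace_limit[OF D r0 z \<phi>]
  let ?g = "\<lambda>y. W y \<odot> (complex_mat (transpose (S.dT y)) *v \<phi> (S y)) - E y \<odot> (complex_mat (cofactor_matrix (S.dT y)) *v curl \<phi> (S y))"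
  have g: "integrable (lebesgue_on (T ` U)) ?g" using lim(1,2) by (rule Bochner_Integration.integrable_diff)
  have g0: "(LINT y|lebesgue_on (T ` U). ?g y) = 0"
    using lim by (simp add: Bochner_Integration.integral_diff)
  let ?h = "\<lambda>x. (complex_mat (cofactor_matrix (T.dT x)) *v W (T x)) \<odot> \<phi> x - (complex_mat (transpose (T.dT x)) *v E (T x)) \<odot> curl \<phi> x"
  have iW: "integrable (lebesgue_on U) (\<lambda>x. (complex_mat (cofactor_matrix (T.dT x)) *v W (T x)) \<odot> \<phi> x)"
    by (rule integrable_L2_smooth[OF U(1) Ub LW \<phi>])
  have iE: "integrable (lebesgue_on U) (\<lambda>x. (complex_mat (transpose (T.dT x)) *v E (T x)) \<odot> curl \<phi> x)"
    by (rule integrable_L2_smooth[OF U(1) Ub LE smooth_curl[OF \<phi>]])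
  have inv: "AE x in lebesgue_on U. S.dT (T x) ** T.dT x = mat 1 \<and> T.dT x ** S.dT (T x) = mat 1"
    by (rule AE_lebesgue_on_subset[OF AE_inverse_jacobian U(2) _ Us]) simp
  \<comment> \<open>Let A and B be the Jacobians of \<open>T\<close> at \<open>x\<close> and of
    \<open>S\<close> at \<open>T x\<close>. The factor det A turns B into cof A in the curl term. In
    the other term it cancels det B in cof B = det B A, leaving A.\<close>
  have "(LINT x|lebesgue_on U. ?h x) = (LINT x|lebesgue_on U. \<bar>det (T.dT x)\<bar> *\<^sub>R ?g (T x))"
  proof (rule integral_cong_AE)
    show "?h \<in> borel_measurable (lebesgue_on U)"
      by (intro borel_measurable_diff borel_measurable_integrable iW iE)
    show "(\<lambda>x. \<bar>det (T.dT x)\<bar> *\<^sub>R ?g (T x)) \<in> borel_measurable (lebesgue_on U)"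
      by (rule borel_measurable_integrable[OF change_variables(1)[OF U g]])
    show "AE x in lebesgue_on U. ?h x = \<bar>det (T.dT x)\<bar> *\<^sub>R ?g (T x)"
      using inv c(2) AE_space
    proof eventually_elim
      case (elim x)
      let ?A = "T.dT x" and ?B = "S.dT (T x)"
      have x: "S (T x) = x" using elim(3) U(2) ST by auto
      have dd: "det ?A * det ?B = 1" using elim(1) by (metis det_I det_mul)
      have cA: "cofactor_matrix ?A = det ?A *\<^sub>R ?B" using elim(1) cofactor_eq_det_inverse by blast
      have cB: "cofactor_matrix ?B = det ?B *\<^sub>R ?A" using elim(1) cofactor_eq_det_inverse by blast
      have 1: "det ?A *\<^sub>R (W (T x) \<odot> (complex_mat (transpose ?B) *v \<phi> x)) = (complex_mat (cofactor_matrix ?A) *v W (T x)) \<odot> \<phi> x"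
        unfolding cA complex_mat_scaleR_mult bdot_transpose_right by (simp add: bdot_simps)
      have 2: "det ?A *\<^sub>R (E (T x) \<odot> (complex_mat (cofactor_matrix ?B) *v curl \<phi> x)) = (complex_mat (transpose ?A) *v E (T x)) \<odot> curl \<phi> x"
        unfolding cB complex_mat_scaleR_mult bdot_transpose_left by (simp add: bdot_simps dd)
      show ?case using elim(2) unfolding x scaleR_diff_right 1[symmetric] 2[symmetric] by simp
    qed
  qed
  also have "\<dots> = 0" using change_variables(2)[OF U g] g0 by simp
  finally show "(LINT x|lebesgue_on U. (complex_mat (cofactor_matrix (T.dT x)) *v W (T x)) \<odot> \<phi> x)
    = (LINT x|lebesgue_on U. (complex_mat (transpose (T.dT x)) *v E (T x)) \<odot> curl \<phi> x)"
    using iW iE by (simp add: Bochner_Integration.integral_diff)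
qed

end

section \<open>Estimates for the sesquilinear form\<close>

lemma L2_norm_nonneg: "0 \<le> L2_norm \<Omega> U"
  by (simp add: L2_norm_def)

lemma L2_norm_sq: "(L2_norm \<Omega> U)\<^sup>2 = (LINT x|lebesgue_on \<Omega>. (norm (U x))\<^sup>2)"
  by (simp add: L2_norm_def)

lemma integrable_norm_prod:
  assumes "L2 \<Omega> U" "L2 \<Omega> V"
  shows "integrable (lebesgue_on \<Omega>) (\<lambda>x. norm (U x) * norm (V x))"
proof (rule Bochner_Integration.integrable_bound)
  show "integrable (lebesgue_on \<Omega>) (\<lambda>x. (norm (U x))\<^sup>2 + (norm (V x))\<^sup>2)"
    using assms by (simp add: L2_def)
  show "(\<lambda>x. norm (U x) * norm (V x)) \<in> borel_measurable (lebesgue_on \<Omega>)"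
    using assms by (intro borel_measurable_times borel_measurable_norm) (auto simp: L2_def)
  show "AE x in lebesgue_on \<Omega>. norm (norm (U x) * norm (V x)) \<le> norm ((norm (U x))\<^sup>2 + (norm (V x))\<^sup>2)"
  proof (rule AE_I2)
    fix x
    have "0 \<le> (norm (U x) - norm (V x))\<^sup>2" by simp
    then have "2 * (norm (U x) * norm (V x)) \<le> (norm (U x))\<^sup>2 + (norm (V x))\<^sup>2"
      by (simp add: power2_eq_square algebra_simps)
    moreover have "0 \<le> norm (U x) * norm (V x)" by simp
    ultimately have "norm (U x) * norm (V x) \<le> (norm (U x))\<^sup>2 + (norm (V x))\<^sup>2" by linarith
    then show "norm (norm (U x) * norm (V x)) \<le> norm ((norm (U x))\<^sup>2 + (norm (V x))\<^sup>2)" by simp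
  qed
qed

text \<open>The quadratic \<open>key\<close> is nonnegative at its minimum \<open>t = R / P\<close>.
  For \<open>P = 0\<close> it is affine in \<open>t\<close>, which forces
  \<open>R = 0\<close>.\<close>

lemma L2_Cauchy_Schwarz:
  assumes U: "L2 \<Omega> U" and V: "L2 \<Omega> V"
  shows "(LINT x|lebesgue_on \<Omega>. norm (U x) * norm (V x)) \<le> L2_norm \<Omega> U * L2_norm \<Omega> V"
proof -
  define P where "P = (LINT x|lebesgue_on \<Omega>. (norm (U x))\<^sup>2)"
  define Q where "Q = (LINT x|lebesgue_on \<Omega>. (norm (V x))\<^sup>2)"
  define R where "R = (LINT x|lebesgue_on \<Omega>. norm (U x) * norm (V x))"
  have i: "integrable (lebesgue_on \<Omega>) (\<lambda>x. (norm (U x))\<^sup>2)" "integrable (lebesgue_on \<Omega>) (\<lambda>x. (norm (V x))\<^sup>2)"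
    using U V by (auto simp: L2_def)
  have iR: "integrable (lebesgue_on \<Omega>) (\<lambda>x. norm (U x) * norm (V x))" by (rule integrable_norm_prod[OF U V])
  have PQR: "0 \<le> P" "0 \<le> Q" "0 \<le> R" by (auto simp: P_def Q_def R_def)
  have key: "0 \<le> t\<^sup>2 * P - 2 * t * R + Q" for t
  proof -
    have "0 \<le> (LINT x|lebesgue_on \<Omega>. (t * norm (U x) - norm (V x))\<^sup>2)" by simp
    also have "(\<lambda>x. (t * norm (U x) - norm (V x))\<^sup>2)
       = (\<lambda>x. t\<^sup>2 * (norm (U x))\<^sup>2 - 2 * t * (norm (U x) * norm (V x)) + (norm (V x))\<^sup>2)"
      by (simp add: fun_eq_iff power2_eq_square algebra_simps)
    also have "(LINT x|lebesgue_on \<Omega>. t\<^sup>2 * (norm (U x))\<^sup>2 - 2 * t * (norm (U x) * norm (V x)) + (norm (V x))\<^sup>2)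
       = t\<^sup>2 * P - 2 * t * R + Q"
      unfolding P_def Q_def R_def using i iR
      by (subst Bochner_Integration.integral_add, simp, simp, subst Bochner_Integration.integral_diff) auto
    finally show ?thesis .
  qed
  have "R\<^sup>2 \<le> P * Q"
  proof (cases "P = 0")
    case True
    have "R = 0"
    proof (rule ccontr)
      assume "R \<noteq> 0"
      then have "R > 0" using PQR by simp
      \<comment> \<open>This value of \<open>t\<close> makes the affine expression equal to
        -1.\<close>
      then have "0 \<le> - 2 * ((Q + 1) / (2 * R)) * R + Q" using key[of "(Q + 1) / (2 * R)"] True by simp
      then show False using \<open>R > 0\<close> by (simp add: field_simps)
    qed
    then show ?thesis using PQR by simp
  next
    case False
    then have "P > 0" using PQR by simp
    have "(R / P)\<^sup>2 * P - 2 * (R / P) * R + Q = Q - R\<^sup>2 / P"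
      using \<open>P > 0\<close> by (simp add: power2_eq_square field_simps)
    then have "R\<^sup>2 / P \<le> Q" using key[of "R / P"] by simp
    then show ?thesis using \<open>P > 0\<close> by (simp add: pos_divide_le_eq mult.commute)
  qed
  then have "R \<le> sqrt (P * Q)" by (rule real_le_rsqrt)
  then show ?thesis by (simp add: R_def L2_norm_def P_def Q_def real_sqrt_mult)
qed

lemma integrable_mat_bdot:
  assumes U: "L2 \<Omega> U" and V: "L2 \<Omega> V" and m: "\<And>k j. (\<lambda>x. N x $ k $ j) \<in> borel_measurable (lebesgue_on \<Omega>)"
    and b: "AE x in lebesgue_on \<Omega>. \<forall>k j. cmod (N x $ k $ j) \<le> c"
  shows "integrable (lebesgue_on \<Omega>) (\<lambda>x. (N x *v U x) \<odot> V x)"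
proof (rule Bochner_Integration.integrable_bound)
  show "integrable (lebesgue_on \<Omega>) (\<lambda>x. 27 * c * (norm (U x) * norm (V x)))"
    using integrable_norm_prod[OF U V] by (rule integrable_mult_right)
  show "(\<lambda>x. (N x *v U x) \<odot> V x) \<in> borel_measurable (lebesgue_on \<Omega>)"
    using U V by (intro measurable_bdot measurable_mat_mult m) (auto simp: L2_def)
  show "AE x in lebesgue_on \<Omega>. norm ((N x *v U x) \<odot> V x) \<le> norm (27 * c * (norm (U x) * norm (V x)))"
    using b
  proof eventually_elim
    case (elim x)
    have "norm ((N x *v U x) \<odot> V x) \<le> 3 * norm (N x *v U x) * norm (V x)" by (rule norm_bdot_le)
    also have "\<dots> \<le> 3 * (9 * c * norm (U x)) * norm (V x)"
      using norm_mat_mult_le[of "N x" c "U x"] elim by (intro mult_right_mono mult_left_mono) auto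
    also have "\<dots> \<le> norm (27 * c * (norm (U x) * norm (V x)))" by (simp add: mult.assoc)
    finally show ?case .
  qed
qed

lemma L2_norm_conj: "L2_norm \<Omega> (\<lambda>x. conj_vec (V x)) = L2_norm \<Omega> V"
  by (simp add: L2_norm_def)

text \<open>\<open>Phi\<close> is an integral over \<open>D_H\<close> with selected weak curls
  there. Since zero traces permit extension by zero, it reduces to \<open>D\<close> with arbitrary
  curl witnesses, a form in which variables can be changed and linearity is visible.\<close>

lemma Phi_eq:
  assumes DH: "open DH" "bounded DH" and D: "open D" "D \<subseteq> DH"
    and z: "zero_trace_curl D U WU" "zero_trace_curl D V WV"
    and off: "\<And>x. x \<notin> D \<Longrightarrow> U x = 0" "\<And>x. x \<notin> D \<Longrightarrow> V x = 0"
    and mM: "\<And>k j. (\<lambda>x. matrix_inv (\<mu> x) $ k $ j) \<in> borel_measurable (lebesgue_on DH)"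
    and me: "\<And>k j. (\<lambda>x. \<epsilon> x $ k $ j) \<in> borel_measurable (lebesgue_on DH)"
    and bM: "AE x in lebesgue_on DH. \<forall>k j. cmod (matrix_inv (\<mu> x) $ k $ j) \<le> m"
    and be: "AE x in lebesgue_on DH. \<forall>k j. cmod (\<epsilon> x $ k $ j) \<le> m"
  shows "Phi DH \<omega> \<mu> \<epsilon> U V = (LINT x|lebesgue_on D. (matrix_inv (\<mu> x) *v WU x) \<odot> conj_vec (WV x))
     - complex_of_real (\<omega>\<^sup>2) * (LINT x|lebesgue_on D. (\<epsilon> x *v U x) \<odot> conj_vec (V x))"
    and "integrable (lebesgue_on D) (\<lambda>x. (matrix_inv (\<mu> x) *v WU x) \<odot> conj_vec (WV x))"
    and "integrable (lebesgue_on D) (\<lambda>x. (\<epsilon> x *v U x) \<odot> conj_vec (V x))"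
proof -
  have DHs: "DH \<in> sets lebesgue" "D \<in> sets lebesgue" using DH D by auto
  have Db: "bounded D" using D DH bounded_subset by blast
  have L: "L2 D U" "L2 D WU" "L2 D V" "L2 D WV" using z by (auto simp: zero_trace_curl_def)
  show i1: "integrable (lebesgue_on D) (\<lambda>x. (matrix_inv (\<mu> x) *v WU x) \<odot> conj_vec (WV x))"
    by (rule integrable_mat_bdot[OF L(2) L2_conj[OF L(4)] measurable_lebesgue_on_subset[OF mM D(2)]
        AE_lebesgue_on_subset[OF bM D(2) DHs]])
  show i2: "integrable (lebesgue_on D) (\<lambda>x. (\<epsilon> x *v U x) \<odot> conj_vec (V x))"
    by (rule integrable_mat_bdot[OF L(1) L2_conj[OF L(3)] measurable_lebesgue_on_subset[OF me D(2)]
        AE_lebesgue_on_subset[OF be D(2) DHs]])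
  have zU: "zero_trace_curl DH U (ext0 D WU)"
    by (rule zero_trace_ext[OF DHs D(2) z(1) off(1)])
  have zV: "zero_trace_curl DH (\<lambda>x. conj_vec (V x)) (ext0 D (\<lambda>x. conj_vec (WV x)))"
    by (rule zero_trace_ext[OF DHs D(2) zero_trace_conj[OF D(1) Db z(2)]]) (simp add: off vec_eq_iff)
  have cU: "AE x in lebesgue_on DH. weak_curl DH U x = ext0 D WU x"
    by (rule weak_curl_eq[OF DH(1) zero_trace_has_weak_curl[OF bounded_open_lmeasurable[OF DH] zU]])
  have cV: "AE x in lebesgue_on DH. weak_curl DH (\<lambda>x. conj_vec (V x)) x = ext0 D (\<lambda>x. conj_vec (WV x)) x"
    by (rule weak_curl_eq[OF DH(1) zero_trace_has_weak_curl[OF bounded_open_lmeasurable[OF DH] zV]])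
  let ?g = "\<lambda>x. (matrix_inv (\<mu> x) *v WU x) \<odot> conj_vec (WV x) - complex_of_real (\<omega>\<^sup>2) * ((\<epsilon> x *v U x) \<odot> conj_vec (V x))"
  have i: "integrable (lebesgue_on D) ?g"
    by (intro Bochner_Integration.integrable_diff i1 integrable_mult_right i2)
  have "Phi DH \<omega> \<mu> \<epsilon> U V = (LINT x|lebesgue_on D. ?g x)"
    unfolding Phi_def
  proof (rule integrable_lebesgue_on_AE_eq(2)[OF DHs(2,1) i])
    show "AE x in lebesgue. ext0 D ?g x = ext0 DH (\<lambda>x. (matrix_inv (\<mu> x) *v weak_curl DH U x) \<odot> weak_curl DH (\<lambda>y. conj_vec (V y)) x
       - complex_of_real (\<omega>\<^sup>2) * ((\<epsilon> x *v U x) \<odot> conj_vec (V x))) x"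
      using cU cV unfolding AE_lebesgue_on_iff[OF DHs(1)]
    proof eventually_elim
      case (elim x)
      show ?case
      proof (cases "x \<in> D")
        case True
        then show ?thesis using elim D(2) by auto
      next
        case False
        then show ?thesis using elim off[of x] by (cases "x \<in> DH") (auto simp: bdot_simps)
      qed
    qed
  qed
  also have "\<dots> = (LINT x|lebesgue_on D. (matrix_inv (\<mu> x) *v WU x) \<odot> conj_vec (WV x))
     - complex_of_real (\<omega>\<^sup>2) * (LINT x|lebesgue_on D. (\<epsilon> x *v U x) \<odot> conj_vec (V x))"
    by (subst Bochner_Integration.integral_diff[OF i1 integrable_mult_right[OF i2]]) simp
  finally show "Phi DH \<omega> \<mu> \<epsilon> U V = (LINT x|lebesgue_on D. (matrix_inv (\<mu> x) *v WU x) \<odot> conj_vec (WV x))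
     - complex_of_real (\<omega>\<^sup>2) * (LINT x|lebesgue_on D. (\<epsilon> x *v U x) \<odot> conj_vec (V x))" .
qed

text \<open>
  Convolving with the indicator of a large ball gives a function that is constant near \<open>0\<close>; its
  partial derivative there is the integral in question.
\<close>

lemma integral_partial_zero:
  fixes K :: "real^3 \<Rightarrow> real"
  assumes K: "smooth K" and C: "compact C" "\<And>x. x \<notin> C \<Longrightarrow> K x = 0"
  shows "(LINT y|lebesgue. partial j K y) = 0"
proof -
  obtain R where R: "R > 0" "\<And>x. x \<in> C \<Longrightarrow> norm x \<le> R"
    using compact_imp_bounded[OF C(1)] bounded_pos by blast
  \<comment> \<open>The extra 1 makes the ball contain the reflected support for every
    \<open>x\<close> of norm below 1, so the convolution is constant there.\<close>
  let ?f = "indicator (cball 0 (R + 1)) :: real^3 \<Rightarrow> real"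
  have f: "integrable lebesgue ?f"
    using lmeasurable_cball[of "0::real^3" "R + 1"] lmeasurable_iff_integrable by blast
  have cb: "continuous_on UNIV (\<lambda>y. K' (x - y))" if "smooth K'" for K' :: "real^3 \<Rightarrow> real" and x
    by (rule continuous_on_compose2[OF smooth_continuous[OF that, of UNIV]]) (auto intro!: continuous_intros)
  have reflect: "(LINT y|lebesgue. K' (x - y)) = (LINT y|lebesgue. K' y)" if s: "smooth K'" for K' :: "real^3 \<Rightarrow> real" and x
  proof -
    have b: "K' \<in> borel_measurable borel" "(\<lambda>y. K' (x - y)) \<in> borel_measurable borel"
      using smooth_continuous[OF s, of UNIV] cb[OF s] by (auto intro!: borel_measurable_continuous_onI)
    then show ?thesis
      using lborel_integral_affine[of "-1" K' x] by (simp add: integral_completion)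
  qed
  have loc: "K' (x - y) *\<^sub>R ?f y = K' (x - y)" if "norm x < 1" "\<And>z. z \<notin> C \<Longrightarrow> K' z = 0" for K' :: "real^3 \<Rightarrow> real" and x y
  proof (cases "x - y \<in> C")
    case True
    then have "norm (x - y) \<le> R" using R by blast
    then have "norm y \<le> R + 1" using that(1) norm_triangle_ineq4[of x "x - y"] by simp
    then show ?thesis by simp
  qed (simp add: that)
  have "conv K ?f x = (LINT y|lebesgue. K y)" if "norm x < 1" for x
  proof -
    have "(\<lambda>y. K (x - y) *\<^sub>R ?f y) = (\<lambda>y. K (x - y))"
      by (rule ext, rule loc[OF that C(2)])
    then show ?thesis unfolding conv_def using reflect[OF K, of x] by simp
  qed
  then have "(conv K ?f has_derivative (\<lambda>h. 0)) (at 0)"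
    using has_derivative_transform_within_open[OF has_derivative_const[of "LINT y|lebesgue. K y" "at 0"], of "ball 0 1" "conv K ?f"]
    by auto
  then have "partial j (conv K ?f) 0 = 0" by (simp add: partial_eqI)
  then have "conv (partial j K) ?f 0 = 0" using partial_conv[OF K C f] by simp
  moreover have "conv (partial j K) ?f 0 = (LINT y|lebesgue. partial j K (0 - y))"
  proof -
    have "(\<lambda>y. partial j K (0 - y) *\<^sub>R ?f y) = (\<lambda>y. partial j K (0 - y))"
      by (rule ext, rule loc[OF _ partial_zero_off_compact[OF C]]) simp_all
    then show ?thesis unfolding conv_def by (simp only:)
  qed
  ultimately show ?thesis using reflect[OF smooth_partial[OF K], of j 0] by simp
qed

section \<open>Weak derivatives of the displacement from the identity\<close>

lemma test_function_partial:
  fixes \<phi> :: "real^3 \<Rightarrow> 'a::real_normed_vector"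
  assumes "test_function \<Omega> \<phi>" shows "test_function \<Omega> (partial j \<phi>)"
proof -
  obtain K where K: "compact K" "K \<subseteq> \<Omega>" "\<And>x. x \<notin> K \<Longrightarrow> \<phi> x = 0" and s: "smooth \<phi>"
    using assms unfolding test_function_def by blast
  show ?thesis
    unfolding test_function_def
    by (intro conjI exI[of _ K] allI impI smooth_partial s K(1,2) partial_zero_off_compact[OF K(1,3)])
qed

lemma locally_integrable_continuous:
  fixes f :: "real^3 \<Rightarrow> 'a::euclidean_space"
  assumes "continuous_on UNIV f" shows "locally_integrable \<Omega> f"
  unfolding locally_integrable_def set_integrable_def
proof (intro allI impI)
  fix K assume "compact K \<and> K \<subseteq> \<Omega>"
  then have i: "integrable lborel (\<lambda>x. indicator K x *\<^sub>R f x)"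
    using continuous_on_subset[OF assms subset_UNIV] by (intro borel_integrable_compact) auto
  then show "integrable lebesgue (\<lambda>x. indicator K x *\<^sub>R f x)"
    using integrable_completion[OF borel_measurable_integrable[OF i]] by simp
qed

text \<open>Component by component, the two integrands add up to the partial derivative of the
  compactly supported function \<phi> times a coordinate, whose integral vanishes.\<close>

lemma has_weak_partial_id:
  assumes \<Omega>: "open \<Omega>" "bounded \<Omega>"
  shows "has_weak_partial \<Omega> j (\<lambda>x. x) (\<lambda>_. axis j 1)"
  unfolding has_weak_partial_def
proof (intro conjI allI impI)
  show li: "locally_integrable \<Omega> (\<lambda>x. x)" "locally_integrable \<Omega> (\<lambda>_. axis j (1::real))"
    by (intro locally_integrable_continuous continuous_intros)+
  fix \<phi> :: "real^3 \<Rightarrow> real" assume t: "test_function \<Omega> \<phi>"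
  have \<Omega>s: "\<Omega> \<in> sets lebesgue" using \<Omega> by auto
  obtain K where K: "compact K" "K \<subseteq> \<Omega>" "\<And>x. x \<notin> K \<Longrightarrow> \<phi> x = 0" and s: "smooth \<phi>"
    using t unfolding test_function_def by blast
  have t': "test_function \<Omega> (partial j \<phi>)" by (rule test_function_partial[OF t])
  have i: "integrable (lebesgue_on \<Omega>) (\<lambda>x. partial j \<phi> x *\<^sub>R x)" "integrable (lebesgue_on \<Omega>) (\<lambda>x. \<phi> x *\<^sub>R axis j (1::real))"
    using locally_integrable_test_scaleR[OF \<Omega>s t' li(1)] locally_integrable_test_scaleR[OF \<Omega>s t li(2)] by auto
  have "(LINT x|lebesgue_on \<Omega>. partial j \<phi> x *\<^sub>R x) + (LINT x|lebesgue_on \<Omega>. \<phi> x *\<^sub>R axis j (1::real))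
     = (LINT x|lebesgue_on \<Omega>. partial j \<phi> x *\<^sub>R x + \<phi> x *\<^sub>R axis j (1::real))"
    by (rule Bochner_Integration.integral_add[OF i, symmetric])
  also have "\<dots> = 0"
  proof -
    have "(LINT x|lebesgue_on \<Omega>. partial j \<phi> x *\<^sub>R x + \<phi> x *\<^sub>R axis j (1::real)) $ k = 0" for k
    proof -
      let ?\<psi> = "\<lambda>x. \<phi> x *\<^sub>R x $ k"
      have s\<psi>: "smooth ?\<psi>"
        by (rule smooth_scaleR[OF s]) (simp add: smooth_def Ck_nth_coord)
      have p: "partial j ?\<psi> x = (partial j \<phi> x *\<^sub>R x + \<phi> x *\<^sub>R axis j (1::real)) $ k" for x
      proof -
        have c: "(\<lambda>x::real^3. x $ k) differentiable (at x)"
          using smooth_differentiable[of "\<lambda>x::real^3. x $ k" x] by (simp add: smooth_def Ck_nth_coord)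
        have "partial j (\<lambda>x::real^3. x $ k) x = axis j 1 $ k"
          by (rule partial_eqI[OF bounded_linear_imp_has_derivative[OF bounded_linear_vec_nth]])
        then show ?thesis
          using bounded_bilinear.partial_prod[OF bounded_bilinear_scaleR smooth_differentiable[OF s] c, of j] by simp
      qed
      have "(LINT x|lebesgue_on \<Omega>. partial j \<phi> x *\<^sub>R x + \<phi> x *\<^sub>R axis j (1::real)) $ k
        = (LINT x|lebesgue_on \<Omega>. (partial j \<phi> x *\<^sub>R x + \<phi> x *\<^sub>R axis j (1::real)) $ k)"
        using integral_bounded_linear[OF bounded_linear_vec_nth[of k] Bochner_Integration.integrable_add[OF i]] by simp
      also have "\<dots> = (LINT x|lebesgue. indicator \<Omega> x *\<^sub>R partial j ?\<psi> x)"
        unfolding p using \<Omega>s by (simp add: integral_restrict_space)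
      also have "\<dots> = (LINT x|lebesgue. partial j ?\<psi> x)"
      proof (rule Bochner_Integration.integral_cong)
        fix x
        have "partial j ?\<psi> x = 0" if "x \<notin> K"
          by (rule partial_zero_off_compact[OF K(1) _ that]) (simp add: K(3))
        then show "indicator \<Omega> x *\<^sub>R partial j ?\<psi> x = partial j ?\<psi> x"
          using K(2) by (cases "x \<in> K") auto
      qed simp
      also have "\<dots> = 0"
        by (rule integral_partial_zero[OF s\<psi> K(1)]) (simp add: K(3))
      finally show ?thesis .
    qed
    then show ?thesis by (simp add: vec_eq_iff)
  qed
  finally show "(LINT x|lebesgue_on \<Omega>. partial j \<phi> x *\<^sub>R x) = - (LINT x|lebesgue_on \<Omega>. \<phi> x *\<^sub>R axis j 1)"
    by (simp add: eq_neg_iff_add_eq_0)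
qed

lemma has_weak_partial_diff:
  fixes f g :: "real^3 \<Rightarrow> 'a::euclidean_space"
  assumes \<Omega>: "open \<Omega>" and f: "has_weak_partial \<Omega> j f f'" and g: "has_weak_partial \<Omega> j g g'"
  shows "has_weak_partial \<Omega> j (\<lambda>x. f x - g x) (\<lambda>x. f' x - g' x)"
  unfolding has_weak_partial_def
proof (intro conjI allI impI)
  have \<Omega>s: "\<Omega> \<in> sets lebesgue" using \<Omega> by auto
  have li: "locally_integrable \<Omega> f" "locally_integrable \<Omega> g" "locally_integrable \<Omega> f'" "locally_integrable \<Omega> g'"
    using f g by (auto simp: has_weak_partial_def)
  then show "locally_integrable \<Omega> (\<lambda>x. f x - g x)" "locally_integrable \<Omega> (\<lambda>x. f' x - g' x)"
    by (auto intro: locally_integrable_diff)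
  fix \<phi> :: "real^3 \<Rightarrow> real" assume t: "test_function \<Omega> \<phi>"
  have t': "test_function \<Omega> (partial j \<phi>)" by (rule test_function_partial[OF t])
  have eqs: "(LINT x|lebesgue_on \<Omega>. partial j \<phi> x *\<^sub>R f x) = - (LINT x|lebesgue_on \<Omega>. \<phi> x *\<^sub>R f' x)"
     "(LINT x|lebesgue_on \<Omega>. partial j \<phi> x *\<^sub>R g x) = - (LINT x|lebesgue_on \<Omega>. \<phi> x *\<^sub>R g' x)"
    using f g t by (auto simp: has_weak_partial_def)
  show "(LINT x|lebesgue_on \<Omega>. partial j \<phi> x *\<^sub>R (f x - g x)) = - (LINT x|lebesgue_on \<Omega>. \<phi> x *\<^sub>R (f' x - g' x))"
    unfolding scaleR_diff_right
    using eqs Bochner_Integration.integral_diff[OF locally_integrable_test_scaleR[OF \<Omega>s t' li(1)] locally_integrable_test_scaleR[OF \<Omega>s t' li(2)]]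
      Bochner_Integration.integral_diff[OF locally_integrable_test_scaleR[OF \<Omega>s t li(3)] locally_integrable_test_scaleR[OF \<Omega>s t li(4)]]
    by simp
qed

text \<open>The set where the bound fails is open by continuity and null by assumption, hence
  empty.\<close>

lemma AE_norm_le_continuous:
  fixes f :: "real^3 \<Rightarrow> 'a::euclidean_space"
  assumes \<Omega>: "open \<Omega>" and f: "continuous_on \<Omega> f" and ae: "AE x in lebesgue_on \<Omega>. norm (f x) \<le> c" and x: "x \<in> \<Omega>"
  shows "norm (f x) \<le> c"
proof (rule ccontr)
  assume "\<not> norm (f x) \<le> c"
  let ?V = "{y \<in> \<Omega>. c < norm (f y)}"
  have "open ((\<lambda>y. norm (f y)) -` {c<..} \<inter> \<Omega>)"
    using continuous_on_norm[OF f] \<Omega> by (simp add: continuous_on_open_vimage)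
  moreover have "(\<lambda>y. norm (f y)) -` {c<..} \<inter> \<Omega> = ?V" by auto
  ultimately have "open ?V" by simp
  moreover have "negligible ?V"
    using ae \<Omega> by (simp add: AE_lebesgue_on_iff AE_lebesgue_iff_negligible not_le)
  moreover have "x \<in> ?V" using x \<open>\<not> norm (f x) \<le> c\<close> by simp
  ultimately show False using open_not_negligible by blast
qed

context W1inf_map
begin

text \<open>\<open>d1\<close> measures the weak derivatives selected for the displacement, whereas
  the proof needs the Jacobian selected for \<open>T\<close>; uniqueness relates the two. The
  displacement is bounded at every point because it is continuous.\<close>

lemma W1inf_minus_id:
  shows "\<And>x. x \<in> \<Omega> \<Longrightarrow> norm (T x - x) \<le> W1inf_norm \<Omega> (\<lambda>x. T x - x)"
    and "AE x in lebesgue_on \<Omega>. \<forall>k j. \<bar>dT x $ k $ j - (mat 1 :: real^3^3) $ k $ j\<bar> \<le> W1inf_norm \<Omega> (\<lambda>x. T x - x)"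
proof -
  obtain b where b: "\<And>x. x \<in> \<Omega> \<Longrightarrow> norm x \<le> b" using bounded_dom bounded_pos by blast
  have mid: "(\<lambda>x::real^3. x) \<in> borel_measurable (lebesgue_on \<Omega>)"
    by (rule continuous_measurable_on) (rule continuous_on_id)
  have Lid: "Linf \<Omega> (\<lambda>x. x)" unfolding Linf_def using mid b by (auto intro!: exI[of _ b] AE_I2)
  have Ld: "Linf \<Omega> (\<lambda>x. f x - g x)" if lf: "Linf \<Omega> f" and lg: "Linf \<Omega> g" for f g :: "real^3 \<Rightarrow> real^3"
  proof -
    obtain c1 c2 where "AE x in lebesgue_on \<Omega>. norm (f x) \<le> c1" "AE x in lebesgue_on \<Omega>. norm (g x) \<le> c2"
      using lf lg unfolding Linf_def by blast
    then have "AE x in lebesgue_on \<Omega>. norm (f x - g x) \<le> c1 + c2"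
    proof eventually_elim
      case (elim x)
      then show ?case using norm_triangle_ineq4[of "f x" "g x"] by linarith
    qed
    then show ?thesis using lf lg by (auto simp: Linf_def)
  qed
  have LT: "Linf \<Omega> T" using W1 by (simp add: W1inf_def)
  have Lax: "Linf \<Omega> (\<lambda>_. axis j (1::real))" for j :: 3 unfolding Linf_def by auto
  have wd: "has_weak_partial \<Omega> j (\<lambda>x. T x - x) (\<lambda>x. weak_partial \<Omega> j T x - axis j 1)" for j
    by (rule has_weak_partial_diff[OF open_dom wp(1) has_weak_partial_id[OF open_dom bounded_dom]])
  have W: "W1inf \<Omega> (\<lambda>x. T x - x)"
    unfolding W1inf_def using Ld[OF LT Lid] wd Ld[OF wp(2) Lax] by blast
  show "norm (T x - x) \<le> W1inf_norm \<Omega> (\<lambda>x. T x - x)" if x: "x \<in> \<Omega>" for x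
  proof -
    have "AE x in lebesgue_on \<Omega>. norm (T x - x) \<le> W1inf_norm \<Omega> (\<lambda>x. T x - x)"
      using Linf_norm_AE[OF Ld[OF LT Lid]] by eventually_elim (rule order_trans[OF _ W1inf_norm_ge(1)])
    moreover have "continuous_on \<Omega> (\<lambda>x. T x - x)" by (intro continuous_intros cont)
    ultimately show ?thesis using AE_norm_le_continuous[OF open_dom _ _ x, of "\<lambda>x. T x - x"] by simp
  qed
  have "AE x in lebesgue_on \<Omega>. norm (weak_partial \<Omega> j T x - axis j 1) \<le> W1inf_norm \<Omega> (\<lambda>x. T x - x)" for j
    using Linf_norm_AE[OF W1inf_weak_partial(2)[OF open_dom W, of j]]
      has_weak_partial_unique[OF open_dom wd W1inf_weak_partial(1)[OF open_dom W], of j]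
  proof eventually_elim
    case (elim x)
    then show ?case using W1inf_norm_ge(2)[of \<Omega> j "\<lambda>x. T x - x"] by simp
  qed
  then have "AE x in lebesgue_on \<Omega>. \<forall>j\<in>UNIV. norm (weak_partial \<Omega> j T x - axis j 1) \<le> W1inf_norm \<Omega> (\<lambda>x. T x - x)"
    by (intro AE_finite_allI) auto
  then show "AE x in lebesgue_on \<Omega>. \<forall>k j. \<bar>dT x $ k $ j - (mat 1 :: real^3^3) $ k $ j\<bar> \<le> W1inf_norm \<Omega> (\<lambda>x. T x - x)"
  proof eventually_elim
    case (elim x)
    show ?case
    proof (intro allI)
      fix k j
      have "dT x $ k $ j - (mat 1 :: real^3^3) $ k $ j = (weak_partial \<Omega> j T x - axis j 1) $ k"
        by (simp add: weak_jacobian_def mat_def axis_def)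
      then show "\<bar>dT x $ k $ j - (mat 1 :: real^3^3) $ k $ j\<bar> \<le> W1inf_norm \<Omega> (\<lambda>x. T x - x)"
        using order_trans[OF component_le_norm_cart[of "weak_partial \<Omega> j T x - axis j 1" k]] elim by simp
    qed
  qed
qed

end

text \<open>\<open>f\<close> has no continuous representative at hand, so the Lipschitz bound holds
  between Lebesgue points only. Almost every \<open>x\<close> is one, and by
  \<open>AE_compose\<close> so is \<open>T x\<close>.\<close>

lemma (in W1inf_homeo) AE_compose_Lipschitz:
  fixes f :: "real^3 \<Rightarrow> 'a::euclidean_space"
  assumes f: "W1inf \<Omega> f" and U: "open U" "U \<subseteq> \<Omega>" and R: "\<And>x. x \<in> U \<Longrightarrow> ball x R \<subseteq> \<Omega> \<and> T x \<in> ball x R"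
  shows "AE x in lebesgue_on U. norm (f (T x) - f x) \<le> 3 * W1inf_norm \<Omega> f * norm (T x - x)"
proof -
  have Us: "U \<in> sets lebesgue" using U by auto
  have fi: "integrable lebesgue (ext0 \<Omega> f)"
    using Linf_integrable[OF T.lmeasurable_dom, of f] f integrable_ext0_iff[OF T.sets_dom, of f] by (simp add: W1inf_def)
  have w: "has_weak_partial \<Omega> j f (weak_partial \<Omega> j f)" "Linf \<Omega> (weak_partial \<Omega> j f)" for j
    using W1inf_weak_partial[OF T.open_dom f] by auto
  have wi: "integrable lebesgue (ext0 \<Omega> (weak_partial \<Omega> j f))" for j
    using Linf_integrable[OF T.lmeasurable_dom w(2)] integrable_ext0_iff[OF T.sets_dom, of "weak_partial \<Omega> j f"] by simp
  have wb: "AE x in lebesgue_on \<Omega>. norm (weak_partial \<Omega> j f x) \<le> W1inf_norm \<Omega> f" for j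
    using Linf_norm_AE[OF w(2), of j] by eventually_elim (rule order_trans[OF _ W1inf_norm_ge(2)])
  have lp: "AE x in lebesgue_on \<Omega>. lebesgue_point (ext0 \<Omega> f) x"
    using ae_lebesgue_point[OF fi] unfolding AE_lebesgue_on_iff[OF T.sets_dom] by eventually_elim simp
  have "AE x in lebesgue_on U. lebesgue_point (ext0 \<Omega> f) x" "AE x in lebesgue_on U. lebesgue_point (ext0 \<Omega> f) (T x)"
    by (rule AE_lebesgue_on_subset[OF lp U(2) T.sets_dom Us], rule AE_lebesgue_on_subset[OF AE_compose[OF lp] U(2) T.sets_dom Us])
  then show ?thesis
    using AE_space
  proof eventually_elim
    case (elim x)
    then have x: "x \<in> U" by simp
    then have "T x \<in> ball x R" "ball x R \<subseteq> \<Omega>" using R by auto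
    moreover have "x \<in> ball x R"
      using \<open>T x \<in> ball x R\<close> by (metis centre_in_ball dist_pos_lt mem_ball order.strict_trans1 zero_le_dist)
    ultimately show ?case
      by (intro weak_gradient_Lipschitz[OF T.open_dom fi w(1) wi wb _ _ _ elim(1,2)])
  qed
qed

section \<open>Perturbation of forms whose coefficients are close to each other\<close>

lemma prod2_diff:
  fixes a b a' b' d :: real
  assumes "\<bar>a - a'\<bar> \<le> d" "\<bar>b - b'\<bar> \<le> d" "\<bar>a'\<bar> \<le> 1" "\<bar>b'\<bar> \<le> 1" "d \<le> 1"
  shows "\<bar>a * b - a' * b'\<bar> \<le> 3 * d"
proof -
  have "a * b - a' * b' = (a - a') * (b - b') + (a - a') * b' + a' * (b - b')" by (simp add: algebra_simps)
  moreover have "\<bar>(a - a') * (b - b')\<bar> \<le> d * 1" unfolding abs_mult using assms by (intro mult_mono) auto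
  moreover have "\<bar>(a - a') * b'\<bar> \<le> d * 1" unfolding abs_mult using assms by (intro mult_mono) auto
  moreover have "\<bar>a' * (b - b')\<bar> \<le> 1 * d" unfolding abs_mult using assms by (intro mult_mono) auto
  ultimately show ?thesis by linarith
qed

text \<open>Each cofactor is a difference of two products of entries, and each product moves by at
  most \<open>3 * d\<close>. The cofactors are spelled out so that every entry matches one instance
  of \<open>q\<close>.\<close>

lemma cofactor_near_id:
  assumes A: "\<And>k j. \<bar>A $ k $ j - (mat 1 :: real^3^3) $ k $ j\<bar> \<le> d" and d: "d \<le> 1"
  shows "\<bar>cofactor_matrix A $ k $ j - (mat 1 :: real^3^3) $ k $ j\<bar> \<le> 6 * d"
proof -
  have i: "\<bar>(mat 1 :: real^3^3) $ k $ j\<bar> \<le> 1" for k j by (simp add: mat_def)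
  have p: "\<bar>A $ a $ b * A $ c $ e - (mat 1 :: real^3^3) $ a $ b * (mat 1 :: real^3^3) $ c $ e\<bar> \<le> 3 * d" for a b c e
    by (rule prod2_diff[OF A A i i d])
  have q: "\<bar>(A $ a $ b * A $ c $ e - A $ f $ g * A $ h $ l)
      - ((mat 1 :: real^3^3) $ a $ b * (mat 1 :: real^3^3) $ c $ e - (mat 1 :: real^3^3) $ f $ g * (mat 1 :: real^3^3) $ h $ l)\<bar> \<le> 6 * d" for a b c e f g h l
    using p[of a b c e] p[of f g h l] by linarith
  have cof: "cofactor_matrix A = vector [
     vector [A$2$2 * A$3$3 - A$2$3 * A$3$2, A$1$3 * A$3$2 - A$1$2 * A$3$3, A$1$2 * A$2$3 - A$1$3 * A$2$2],
     vector [A$2$3 * A$3$1 - A$2$1 * A$3$3, A$1$1 * A$3$3 - A$1$3 * A$3$1, A$1$3 * A$2$1 - A$1$1 * A$2$3],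
     vector [A$2$1 * A$3$2 - A$2$2 * A$3$1, A$1$2 * A$3$1 - A$1$1 * A$3$2, A$1$1 * A$2$2 - A$1$2 * A$2$1]]"
    by (simp add: vec_eq_iff forall_3 cofactor_matrix_def det_3 axis_def)
  have "\<forall>k j. \<bar>cofactor_matrix A $ k $ j - (mat 1 :: real^3^3) $ k $ j\<bar> \<le> 6 * d"
    unfolding forall_3 cof
    using q[of 2 2 3 3 2 3 3 2] q[of 1 3 3 2 1 2 3 3] q[of 1 2 2 3 1 3 2 2]
      q[of 2 3 3 1 2 1 3 3] q[of 1 1 3 3 1 3 3 1] q[of 1 3 2 1 1 1 2 3]
      q[of 2 1 3 2 2 2 3 1] q[of 1 2 3 1 1 1 3 2] q[of 1 1 2 2 1 2 2 1]
    by (simp add: mat_def)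
  then show ?thesis by blast
qed

lemma complex_mat_one [simp]: "complex_mat (mat 1) *v v = v"
proof -
  have "complex_mat (mat 1) = mat 1" by (simp add: complex_mat_def mat_def vec_eq_iff)
  then show ?thesis by simp
qed

lemma complex_mat_diff: "complex_mat (A - B) *v v = complex_mat A *v v - complex_mat B *v v"
  by (simp add: vec_eq_iff matrix_vector_mult_def complex_mat_def sum_subtractf[symmetric] algebra_simps)

lemma norm_complex_mat_minus_id:
  assumes "\<And>k j. \<bar>P $ k $ j - (mat 1 :: real^3^3) $ k $ j\<bar> \<le> c"
  shows "norm (complex_mat P *v a - a) \<le> 9 * c * norm a"
  using norm_complex_mat_mult_le[of "P - mat 1" c a] assms by (simp add: complex_mat_diff)

text \<open>The difference splits into the errors of \<open>P\<close>, of the coefficient, and of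
  \<open>Q\<close>. With 3 from the dot product, 9 from each matrix and \<open>6 * d\<close> from
  the assumptions, they contribute 3 * 9 * 54 = 1458, 3 * 9 = 27 and again 1458, in total less than
  3000.\<close>

lemma perturbed_form_bound:
  fixes N N' :: "complex^3^3"
  assumes N: "\<And>k j. cmod (N $ k $ j) \<le> m" and N': "\<And>k j. cmod (N' $ k $ j) \<le> m"
    and NN: "\<And>k j. cmod (N' $ k $ j - N $ k $ j) \<le> m * d"
    and P: "\<And>k j. \<bar>P $ k $ j - (mat 1 :: real^3^3) $ k $ j\<bar> \<le> 6 * d"
    and Q: "\<And>k j. \<bar>Q $ k $ j - (mat 1 :: real^3^3) $ k $ j\<bar> \<le> 6 * d"
    and m: "0 \<le> m" and d: "0 \<le> d"
  shows "cmod ((N *v (complex_mat P *v a)) \<odot> b - (N' *v a) \<odot> (complex_mat Q *v b)) \<le> 3000 * m * d * (norm a * norm b)"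
proof -
  let ?p = "complex_mat P *v a - a" and ?q = "complex_mat Q *v b - b"
  have eq: "(N *v (complex_mat P *v a)) \<odot> b - (N' *v a) \<odot> (complex_mat Q *v b)
     = (N *v ?p) \<odot> b - ((N' - N) *v a) \<odot> b - (N' *v a) \<odot> ?q"
    by (simp add: matrix_vector_mult_diff_distrib matrix_vector_mult_diff_rdistrib bdot_simps)
  have b1: "cmod ((N *v ?p) \<odot> b) \<le> 1458 * m * d * (norm a * norm b)"
  proof -
    have "norm (N *v ?p) \<le> 9 * m * (9 * (6 * d) * norm a)"
      using norm_mat_mult_le[OF N, of ?p] norm_complex_mat_minus_id[OF P, of a] m
      by (intro order_trans[OF norm_mat_mult_le[OF N]] mult_left_mono) auto
    then have "3 * norm (N *v ?p) * norm b \<le> 3 * (9 * m * (9 * (6 * d) * norm a)) * norm b"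
      by (intro mult_right_mono mult_left_mono) auto
    then show ?thesis using norm_bdot_le[of "N *v ?p" b] by (simp add: mult_ac)
  qed
  have b2: "cmod (((N' - N) *v a) \<odot> b) \<le> 27 * m * d * (norm a * norm b)"
  proof -
    have "norm ((N' - N) *v a) \<le> 9 * (m * d) * norm a"
      by (rule norm_mat_mult_le) (simp add: NN)
    then have "3 * norm ((N' - N) *v a) * norm b \<le> 3 * (9 * (m * d) * norm a) * norm b"
      by (intro mult_right_mono mult_left_mono) auto
    then show ?thesis using norm_bdot_le[of "(N' - N) *v a" b] by (simp add: mult_ac)
  qed
  have b3: "cmod ((N' *v a) \<odot> ?q) \<le> 1458 * m * d * (norm a * norm b)"
  proof -
    have "3 * norm (N' *v a) * norm ?q \<le> 3 * (9 * m * norm a) * (9 * (6 * d) * norm b)"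
      using norm_mat_mult_le[OF N', of a] norm_complex_mat_minus_id[OF Q, of b] m d
      by (intro mult_mono mult_left_mono) auto
    then show ?thesis using norm_bdot_le[of "N' *v a" ?q] by (simp add: mult_ac)
  qed
  have b4: "0 \<le> m * d * (norm a * norm b)" using m d by simp
  show ?thesis
    unfolding eq using b1 b2 b3 b4 norm_triangle_ineq4[of "(N *v ?p) \<odot> b - ((N' - N) *v a) \<odot> b" "(N' *v a) \<odot> ?q"]
      norm_triangle_ineq4[of "(N *v ?p) \<odot> b" "((N' - N) *v a) \<odot> b"] by linarith
qed

text \<open>The two errors contribute only 3 + 162; the larger constant is that of
  \<open>perturbed_form_bound\<close>, so that all terms of the residual share one factor.\<close>

lemma perturbed_load_bound:
  assumes N': "norm J' \<le> m" and NN: "norm (J' - J) \<le> m * d"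
    and Q: "\<And>k j. \<bar>Q $ k $ j - (mat 1 :: real^3^3) $ k $ j\<bar> \<le> 6 * d"
    and m: "0 \<le> m" and d: "0 \<le> d"
  shows "cmod (J \<odot> b - J' \<odot> (complex_mat Q *v b)) \<le> 3000 * m * d * norm b"
proof -
  let ?q = "complex_mat Q *v b - b"
  have "J \<odot> b - J' \<odot> (complex_mat Q *v b) = - ((J' - J) \<odot> b) - J' \<odot> ?q"
    by (simp add: bdot_simps)
  moreover have "cmod ((J' - J) \<odot> b) \<le> 3 * (m * d) * norm b"
    using NN by (intro order_trans[OF norm_bdot_le] mult_right_mono mult_left_mono) auto
  moreover have "cmod (J' \<odot> ?q) \<le> 3 * m * (9 * (6 * d) * norm b)"
    using N' norm_complex_mat_minus_id[OF Q, of b] m d by (intro order_trans[OF norm_bdot_le] mult_mono mult_left_mono) auto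
  moreover have "0 \<le> m * d * norm b" using m d by simp
  ultimately show ?thesis
    using norm_triangle_ineq4[of "- ((J' - J) \<odot> b)" "J' \<odot> ?q"] by simp
qed

lemma integral_diff_bound:
  fixes f g :: "real^3 \<Rightarrow> complex"
  assumes f: "integrable (lebesgue_on U) f" and g: "integrable (lebesgue_on U) g"
    and a: "L2 U a" and b: "L2 U b" and \<kappa>: "0 \<le> \<kappa>"
    and le: "AE x in lebesgue_on U. cmod (f x - g x) \<le> \<kappa> * (norm (a x) * norm (b x))"
  shows "cmod ((LINT x|lebesgue_on U. f x) - (LINT x|lebesgue_on U. g x)) \<le> \<kappa> * (L2_norm U a * L2_norm U b)"
proof -
  have "(LINT x|lebesgue_on U. f x) - (LINT x|lebesgue_on U. g x) = (LINT x|lebesgue_on U. f x - g x)"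
    by (rule Bochner_Integration.integral_diff[OF f g, symmetric])
  also have "cmod \<dots> \<le> (LINT x|lebesgue_on U. \<kappa> * (norm (a x) * norm (b x)))"
    by (rule norm_integral_le[OF integrable_mult_right[OF integrable_norm_prod[OF a b]] le])
  also have "\<dots> = \<kappa> * (LINT x|lebesgue_on U. norm (a x) * norm (b x))" by simp
  also have "\<dots> \<le> \<kappa> * (L2_norm U a * L2_norm U b)"
    by (intro mult_left_mono L2_Cauchy_Schwarz a b \<kappa>)
  finally show ?thesis .
qed

lemma bdot_commute: "u \<odot> v = v \<odot> u"
  by (simp add: bdot_3 mult.commute)

lemma conj_complex_mat_mult: "conj_vec (complex_mat R *v c) = complex_mat R *v conj_vec c"
  by (simp add: vec_eq_iff matrix_vector_mult_def complex_mat_def sum_3)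

lemma conj_vec_scaleR: "conj_vec (r *\<^sub>R v) = r *\<^sub>R conj_vec v"
  by (simp add: vec_eq_iff)

lemma Frhs_eq:
  assumes "DH \<in> sets lebesgue" "D \<in> sets lebesgue" "D \<subseteq> DH" "\<And>x. x \<notin> D \<Longrightarrow> V x = 0"
  shows "Frhs DH \<omega> J V = - \<i> * complex_of_real \<omega> * (LINT x|lebesgue_on D. J x \<odot> conj_vec (V x))"
proof -
  have "(\<lambda>x. indicator DH x *\<^sub>R (J x \<odot> conj_vec (V x))) = (\<lambda>x. indicator D x *\<^sub>R (J x \<odot> conj_vec (V x)))"
  proof
    fix x
    show "indicator DH x *\<^sub>R (J x \<odot> conj_vec (V x)) = indicator D x *\<^sub>R (J x \<odot> conj_vec (V x))"
      using assms(3,4) by (cases "x \<in> D") (auto simp: indicator_def bdot_3)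
  qed
  then have "(LINT x|lebesgue_on DH. J x \<odot> conj_vec (V x)) = (LINT x|lebesgue_on D. J x \<odot> conj_vec (V x))"
    using assms(1,2) by (simp only: integral_restrict_space space_completion space_lborel space_borel Int_UNIV_right)
  then show ?thesis by (simp add: Frhs_def)
qed

text \<open>A constant unit field serves as first factor when the load term, which contains no
  \<open>E\<close>, is estimated by \<open>integral_diff_bound\<close>.\<close>

lemma norm_axis_1: "norm (axis 1 1 :: complex^3) = 1"
  by (simp add: norm_vec_def L2_set_def sum_3 axis_def)

lemma L2_const: "D \<in> lmeasurable \<Longrightarrow> L2 D (\<lambda>_. v)"
  by (simp add: L2_def finite_measure.integrable_const finite_measure_lebesgue_on)

lemma zero_trace_curl_cong:
  assumes D: "D \<in> sets lebesgue" and z: "zero_trace_curl D U W" and eq: "\<And>x. x \<in> D \<Longrightarrow> U x = U' x"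
  shows "zero_trace_curl D U' W"
proof -
  have ae: "AE x in lebesgue_on D. U x = U' x" using eq by (intro AE_I2) simp
  have "L2 D U" using z by (simp add: zero_trace_curl_def)
  then have "L2 D U'" by (rule L2_AE_cong[OF D _ ae])
  moreover have "(LINT x|lebesgue_on D. U' x \<odot> f x) = (LINT x|lebesgue_on D. U x \<odot> f x)" for f
    by (rule Bochner_Integration.integral_cong) (auto simp: eq)
  ultimately show ?thesis using z by (simp add: zero_trace_curl_def)
qed

lemma Hcurl_norm_nonneg: "0 \<le> Hcurl_norm D U"
  by (simp add: Hcurl_norm_def)

lemma L2_norm_le_Hcurl_norm: "L2_norm D U \<le> Hcurl_norm D U" "L2_norm D (weak_curl D U) \<le> Hcurl_norm D U"
  unfolding Hcurl_norm_def by (auto intro!: real_le_rsqrt)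

lemma W1inf_measurable: "W1inf \<Omega> f \<Longrightarrow> f \<in> borel_measurable (lebesgue_on \<Omega>)"
  by (simp add: W1inf_def Linf_def)

lemma W1inf_AE_bound:
  assumes "W1inf \<Omega> f" shows "AE x in lebesgue_on \<Omega>. norm (f x) \<le> W1inf_norm \<Omega> f"
proof -
  have "AE x in lebesgue_on \<Omega>. norm (f x) \<le> Linf_norm \<Omega> f"
    using assms by (intro Linf_norm_AE) (simp add: W1inf_def)
  then show ?thesis by eventually_elim (rule order_trans[OF _ W1inf_norm_ge(1)])
qed

lemma AE_matI:
  fixes P :: "3 \<Rightarrow> 3 \<Rightarrow> 'b \<Rightarrow> bool"
  assumes "\<And>k j. AE x in M. P k j x" shows "AE x in M. \<forall>k j. P k j x"
proof -
  have "AE x in M. \<forall>k\<in>UNIV. \<forall>j\<in>UNIV. P k j x"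
    by (intro AE_finite_allI assms) auto
  then show ?thesis by eventually_elim blast
qed

context W1inf_homeo
begin

text \<open>The constant \<open>48 = 6 * 2^3\<close> bounds \<open>det A\<close> when all entries of \<open>A\<close> are at most \<open>2\<close>.\<close>

lemma AE_det_bounds:
  assumes A: "AE x in lebesgue_on \<Omega>. \<forall>k j. \<bar>T.dT x $ k $ j - (mat 1 :: real^3^3) $ k $ j\<bar> \<le> 1"
    and B: "AE x in lebesgue_on \<Omega>. \<forall>k j. \<bar>S.dT x $ k $ j - (mat 1 :: real^3^3) $ k $ j\<bar> \<le> 1"
    and det: "AE x in lebesgue_on \<Omega>. 0 < det (T.dT x)"
  shows "AE x in lebesgue_on \<Omega>. 0 < det (T.dT x) \<and> 1 \<le> 48 * det (T.dT x)"
    and "AE y in lebesgue_on \<Omega>. 0 < det (S.dT y) \<and> 1 \<le> 48 * det (S.dT y)"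
proof -
  interpret S': W1inf_homeo \<Omega> S T by (rule swap)
  have e2: "\<bar>X $ k $ j\<bar> \<le> 2" if "\<forall>k j. \<bar>X $ k $ j - (mat 1 :: real^3^3) $ k $ j\<bar> \<le> 1" for X :: "real^3^3" and k j
  proof -
    have "\<bar>(mat 1 :: real^3^3) $ k $ j\<bar> \<le> 1" by (simp add: mat_def)
    then show ?thesis using that[rule_format, of k j] by linarith
  qed
  have both: "AE x in lebesgue_on \<Omega>. (0 < det (T.dT x) \<and> 1 \<le> 48 * det (T.dT x)) \<and> (0 < det (S.dT (T x)) \<and> 1 \<le> 48 * det (S.dT (T x)))"
    using A AE_compose[OF B] det AE_inverse_jacobian
  proof eventually_elim
    case (elim x)
    \<comment> \<open>Since the product is 1 and neither factor exceeds 48, neither is below 1/48;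
      positivity passes from one to the other.\<close>
    have dd: "det (T.dT x) * det (S.dT (T x)) = 1" using elim(4) by (metis det_I det_mul)
    have a: "det (T.dT x) \<le> 48" "det (S.dT (T x)) \<le> 48"
      using det_bound[of "T.dT x" 2] e2[OF elim(1)] det_bound[of "S.dT (T x)" 2] e2[OF elim(2)] by auto
    have p: "0 < det (S.dT (T x))"
      using dd elim(3) by (metis zero_less_mult_pos zero_less_one)
    have "det (T.dT x) * det (S.dT (T x)) \<le> det (T.dT x) * 48" using a elim(3) by (intro mult_left_mono) auto
    moreover have "det (T.dT x) * det (S.dT (T x)) \<le> 48 * det (S.dT (T x))" using a p by (intro mult_right_mono) auto
    ultimately show ?case using dd p elim(3) by simp
  qed
  then show "AE x in lebesgue_on \<Omega>. 0 < det (T.dT x) \<and> 1 \<le> 48 * det (T.dT x)" by eventually_elim simp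
  have "AE x in lebesgue_on \<Omega>. 0 < det (S.dT (T x)) \<and> 1 \<le> 48 * det (S.dT (T x))" using both by eventually_elim simp
  from S'.AE_compose[OF this] AE_space
  show "AE y in lebesgue_on \<Omega>. 0 < det (S.dT y) \<and> 1 \<le> 48 * det (S.dT y)"
    by eventually_elim (simp add: TS)
qed

text \<open>
  Testing with the transported field \<open>V'\<close> turns the residual of the pulled-back solution into a
  difference of forms on \<open>U\<close> whose coefficients differ by \<open>O(d)\<close>.
\<close>

lemma residual_bound:
  assumes U: "open U" "U \<subseteq> \<Omega>"
    and d: "0 \<le> d" "d \<le> 1"
    and dA: "AE x in lebesgue_on \<Omega>. \<forall>k j. \<bar>T.dT x $ k $ j - (mat 1 :: real^3^3) $ k $ j\<bar> \<le> d"
    and dB: "AE x in lebesgue_on \<Omega>. \<forall>k j. \<bar>S.dT x $ k $ j - (mat 1 :: real^3^3) $ k $ j\<bar> \<le> d"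
    and det: "AE x in lebesgue_on \<Omega>. 0 < det (T.dT x)"
    and near: "\<And>x. x \<in> \<Omega> \<Longrightarrow> norm (T x - x) \<le> d"
    and \<rho>: "d < \<rho>" "\<And>y. y \<in> T ` U \<Longrightarrow> ball y (2 * \<rho>) \<subseteq> \<Omega>"
    and wM: "\<And>k j. W1inf \<Omega> (\<lambda>x. matrix_inv (\<mu> x) $ k $ j)"
    and we: "\<And>k j. W1inf \<Omega> (\<lambda>x. \<epsilon> x $ k $ j)"
    and wJ: "\<And>k. W1inf \<Omega> (\<lambda>x. J x $ k)"
    and mM: "\<And>k j. 3 * W1inf_norm \<Omega> (\<lambda>x. matrix_inv (\<mu> x) $ k $ j) \<le> m"
    and me: "\<And>k j. 3 * W1inf_norm \<Omega> (\<lambda>x. \<epsilon> x $ k $ j) \<le> m"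
    and mJ: "3 * (\<Sum>k\<in>UNIV. W1inf_norm \<Omega> (\<lambda>x. J x $ k)) \<le> m"
    and \<omega>: "0 < \<omega>"
    and E: "maxwell_solution \<Omega> \<omega> \<mu> \<epsilon> J (T ` U) E"
  shows "pull_back \<Omega> U T E \<in> H0curl U"
    and "V \<in> H0curl U \<Longrightarrow> cmod (Phi \<Omega> \<omega> \<mu> \<epsilon> (pull_back \<Omega> U T E) V - Frhs \<Omega> \<omega> J V)
      \<le> 3000 * m * (7 * L2_norm (T ` U) (weak_curl (T ` U) E) + \<omega>\<^sup>2 * (7 * L2_norm (T ` U) E)
           + \<omega> * sqrt (measure lebesgue \<Omega>)) * d * Hcurl_norm U V"
proof -
  interpret S': W1inf_homeo \<Omega> S T by (rule swap)
  let ?D = "T ` U" and ?PE = "pull_back \<Omega> U T E"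
  have \<rho>0: "\<rho> > 0" using \<rho>(1) d by simp
  have Us: "U \<in> sets lebesgue" using U by auto
  have Ub: "bounded U" using U(2) T.bounded_dom bounded_subset by blast
  have D: "open ?D" "?D \<subseteq> \<Omega>" using open_image[OF U] U(2) T_in by auto
  have Ds: "?D \<in> sets lebesgue" using D by auto
  have Db: "bounded ?D" using D(2) T.bounded_dom bounded_subset by blast
  have SD: "S ` ?D = U" using ST U(2) by force
  have m: "0 \<le> m"
    using order_trans[OF mult_nonneg_nonneg[OF _ W1inf_norm_nonneg] mM[of 1 1]] by simp
  have A1: "AE x in lebesgue_on \<Omega>. \<forall>k j. \<bar>T.dT x $ k $ j - (mat 1 :: real^3^3) $ k $ j\<bar> \<le> 1"
    and B1: "AE x in lebesgue_on \<Omega>. \<forall>k j. \<bar>S.dT x $ k $ j - (mat 1 :: real^3^3) $ k $ j\<bar> \<le> 1"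
    using dA dB by (eventually_elim, use d(2) in \<open>blast intro: order_trans\<close>)+
  note db = AE_det_bounds[OF A1 B1 det]
  have cT: "AE x in lebesgue_on U. 0 < det (T.dT x) \<and> 1 \<le> 48 * det (T.dT x)"
    by (rule AE_lebesgue_on_subset[OF db(1) U(2) T.sets_dom Us])
  have cS: "AE x in lebesgue_on ?D. 0 < det (S.dT x) \<and> 1 \<le> 48 * det (S.dT x)"
    by (rule AE_lebesgue_on_subset[OF db(2) D(2) T.sets_dom Ds])
  have ballU: "ball x \<rho> \<subseteq> \<Omega> \<and> T x \<in> ball x \<rho>" if x: "x \<in> U" for x
  proof -
    have *: "dist x (T x) \<le> d" using near[of x] x U(2) by (auto simp: dist_norm norm_minus_commute)
    have "ball x \<rho> \<subseteq> ball (T x) (2 * \<rho>)"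
    proof
      fix w assume "w \<in> ball x \<rho>"
      then show "w \<in> ball (T x) (2 * \<rho>)"
        using * \<rho>(1) dist_triangle[of "T x" w x] by (simp add: dist_commute)
    qed
    then show ?thesis using \<rho> x * by auto
  qed
  \<comment> \<open>The pull-back needs some positive kernel size valid at all points; a quarter of
    \<rho> also works on the \<open>U\<close> side, where only radius \<rho> is available.\<close>
  have cubeD: "cube y (\<rho> / 4) \<subseteq> \<Omega>" if "y \<in> ?D" for y
  proof -
    have "cube y (\<rho> / 4) \<subseteq> cball y (2 * (\<rho> / 4))" using \<rho>0 by (intro cube_subset_cball) simp
    also have "\<dots> \<subseteq> ball y (2 * \<rho>)" using \<rho>0 by auto
    finally show ?thesis using \<rho>(2)[OF that] by blast
  qed
  have cubeU: "cube x (\<rho> / 4) \<subseteq> \<Omega>" if "x \<in> S ` ?D" for x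
  proof -
    have "cube x (\<rho> / 4) \<subseteq> cball x (2 * (\<rho> / 4))" using \<rho>0 by (intro cube_subset_cball) simp
    also have "\<dots> \<subseteq> ball x \<rho>" using \<rho>0 by auto
    finally show ?thesis using ballU that unfolding SD by blast
  qed
  have EH: "E \<in> H0curl ?D" and Esol: "\<And>V. V \<in> H0curl ?D \<Longrightarrow> Phi \<Omega> \<omega> \<mu> \<epsilon> E V = Frhs \<Omega> \<omega> J V"
    using E by (auto simp: maxwell_solution_def)
  let ?WE = "weak_curl ?D E"
  have zE: "zero_trace_curl ?D E ?WE" and offE: "\<And>x. x \<notin> ?D \<Longrightarrow> E x = 0"
    using H0curlD[OF D(1) Db EH] by auto
  have LE: "L2 ?D E" "L2 ?D ?WE" using zE by (auto simp: zero_trace_curl_def)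
  let ?WP = "\<lambda>x. complex_mat (cofactor_matrix (T.dT x)) *v ?WE (T x)"
  have zP: "zero_trace_curl U ?PE ?WP"
    by (rule zero_trace_curl_cong[OF Us zero_trace_pull_back[OF U _ cubeD _ cT zE]])
      (use \<rho>0 in \<open>auto simp: pull_back_def\<close>)
  have offP: "?PE x = 0" if "x \<notin> U" for x using that by (simp add: pull_back_def)
  show "?PE \<in> H0curl U" by (rule H0curlI(1)[OF U(1) Ub zP offP])
  assume VH: "V \<in> H0curl U"
  let ?WV = "weak_curl U V"
  have zV: "zero_trace_curl U V ?WV" and offV: "\<And>x. x \<notin> U \<Longrightarrow> V x = 0"
    using H0curlD[OF U(1) Ub VH] by auto
  have LV: "L2 U V" "L2 U ?WV" using zV by (auto simp: zero_trace_curl_def)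
  \<comment> \<open>The covariant pull-back of \<open>V\<close> under the inverse map, so that both
    arguments of the form are transported by the same rule.\<close>
  define V' where "V' y = (if y \<in> ?D then complex_mat (transpose (S.dT y)) *v V (S y) else 0)" for y
  let ?WV' = "\<lambda>y. complex_mat (cofactor_matrix (S.dT y)) *v ?WV (S y)"
  have zV': "zero_trace_curl ?D V' ?WV'"
    by (rule zero_trace_curl_cong[OF Ds S'.zero_trace_pull_back[OF D _ cubeU _ cS]])
      (use \<rho>0 zV in \<open>auto simp: V'_def SD\<close>)
  have offV': "V' y = 0" if "y \<notin> ?D" for y using that by (simp add: V'_def)
  have V'H: "V' \<in> H0curl ?D" by (rule H0curlI(1)[OF D(1) Db zV' offV'])
  have LV': "L2 ?D V'" using zV' by (simp add: zero_trace_curl_def)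

  have M_bd: "AE x in lebesgue_on \<Omega>. \<forall>k j. cmod (matrix_inv (\<mu> x) $ k $ j) \<le> m"
  proof (rule AE_matI)
    fix k j
    show "AE x in lebesgue_on \<Omega>. cmod (matrix_inv (\<mu> x) $ k $ j) \<le> m"
      using W1inf_AE_bound[OF wM, of k j]
      by eventually_elim (use mM[of k j] W1inf_norm_nonneg[of \<Omega> "\<lambda>x. matrix_inv (\<mu> x) $ k $ j"] in linarith)
  qed
  have e_bd: "AE x in lebesgue_on \<Omega>. \<forall>k j. cmod (\<epsilon> x $ k $ j) \<le> m"
  proof (rule AE_matI)
    fix k j
    show "AE x in lebesgue_on \<Omega>. cmod (\<epsilon> x $ k $ j) \<le> m"
      using W1inf_AE_bound[OF we, of k j]
      by eventually_elim (use me[of k j] W1inf_norm_nonneg[of \<Omega> "\<lambda>x. \<epsilon> x $ k $ j"] in linarith)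
  qed
  have J_all: "AE x in lebesgue_on \<Omega>. \<forall>k\<in>UNIV. norm (J x $ k) \<le> W1inf_norm \<Omega> (\<lambda>x. J x $ k)"
    by (intro AE_finite_allI W1inf_AE_bound wJ) auto
  have J_bd: "AE x in lebesgue_on \<Omega>. norm (J x) \<le> m"
    using J_all
  proof eventually_elim
    case (elim x)
    have "norm (J x) \<le> (\<Sum>k\<in>UNIV. norm (J x $ k))" using norm_le_sum_nth[of "J x"] by (simp add: sum_3)
    also have "\<dots> \<le> (\<Sum>k\<in>UNIV. W1inf_norm \<Omega> (\<lambda>x. J x $ k))" using elim by (intro sum_mono) auto
    also have "\<dots> \<le> m"
      using mJ sum_nonneg[of UNIV "\<lambda>k. W1inf_norm \<Omega> (\<lambda>x. J x $ k)"] W1inf_norm_nonneg by fastforce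
    finally show ?case .
  qed
  \<comment> \<open>The Lipschitz constant is three times the norm, whence the factor 3 in the
    assumptions on \<open>m\<close>.\<close>
  have Lip: "AE x in lebesgue_on U. norm (f (T x) - f x) \<le> 3 * W1inf_norm \<Omega> f * d" if f: "W1inf \<Omega> f" for f :: "real^3 \<Rightarrow> complex"
  proof -
    have "AE x in lebesgue_on U. norm (f (T x) - f x) \<le> 3 * W1inf_norm \<Omega> f * norm (T x - x)"
      by (rule AE_compose_Lipschitz[OF f U ballU])
    then show ?thesis
      using AE_space
    proof eventually_elim
      case (elim x)
      then have "norm (T x - x) \<le> d" using near U(2) by auto
      then have "3 * W1inf_norm \<Omega> f * norm (T x - x) \<le> 3 * W1inf_norm \<Omega> f * d"
        using W1inf_norm_nonneg by (intro mult_left_mono) auto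
      then show ?case using elim by linarith
    qed
  qed
  have M_Lip: "AE x in lebesgue_on U. \<forall>k j. cmod (matrix_inv (\<mu> (T x)) $ k $ j - matrix_inv (\<mu> x) $ k $ j) \<le> m * d"
  proof (rule AE_matI)
    fix k j
    show "AE x in lebesgue_on U. cmod (matrix_inv (\<mu> (T x)) $ k $ j - matrix_inv (\<mu> x) $ k $ j) \<le> m * d"
      using Lip[OF wM, of k j] by eventually_elim (rule order_trans[OF _ mult_right_mono[OF mM d(1)]])
  qed
  have e_Lip: "AE x in lebesgue_on U. \<forall>k j. cmod (\<epsilon> (T x) $ k $ j - \<epsilon> x $ k $ j) \<le> m * d"
  proof (rule AE_matI)
    fix k j
    show "AE x in lebesgue_on U. cmod (\<epsilon> (T x) $ k $ j - \<epsilon> x $ k $ j) \<le> m * d"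
      using Lip[OF we, of k j] by eventually_elim (rule order_trans[OF _ mult_right_mono[OF me d(1)]])
  qed
  have JL_all: "AE x in lebesgue_on U. \<forall>k\<in>UNIV. norm (J (T x) $ k - J x $ k) \<le> 3 * W1inf_norm \<Omega> (\<lambda>x. J x $ k) * d"
    by (intro AE_finite_allI Lip wJ) auto
  have J_Lip: "AE x in lebesgue_on U. norm (J (T x) - J x) \<le> m * d"
    using JL_all
  proof eventually_elim
    case (elim x)
    have "norm (J (T x) - J x) \<le> (\<Sum>k\<in>UNIV. norm (J (T x) $ k - J x $ k))"
      using norm_le_sum_nth[of "J (T x) - J x"] by (simp add: sum_3)
    also have "\<dots> \<le> (\<Sum>k\<in>UNIV. 3 * W1inf_norm \<Omega> (\<lambda>x. J x $ k) * d)" using elim by (intro sum_mono) auto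
    also have "\<dots> = 3 * (\<Sum>k\<in>UNIV. W1inf_norm \<Omega> (\<lambda>x. J x $ k)) * d" by (simp add: sum_distrib_left sum_distrib_right)
    also have "\<dots> \<le> m * d" using mJ d(1) by (rule mult_right_mono)
    finally show ?case .
  qed
  have sub: "AE x in lebesgue_on U. P x" if "AE x in lebesgue_on \<Omega>. P x" for P
    by (rule AE_lebesgue_on_subset[OF that U(2) T.sets_dom Us])
  have subT: "AE x in lebesgue_on U. P (T x)" if "AE x in lebesgue_on \<Omega>. P x" for P
    by (rule sub[OF AE_compose[OF that]])
  have subD: "AE x in lebesgue_on ?D. P x" if "AE x in lebesgue_on \<Omega>. P x" for P
    by (rule AE_lebesgue_on_subset[OF that D(2) T.sets_dom Ds])

  note PhiP = Phi_eq[OF T.open_dom T.bounded_dom U zP zV offP offV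
      W1inf_measurable[OF wM] W1inf_measurable[OF we] M_bd e_bd]
  note PhiE = Phi_eq[OF T.open_dom T.bounded_dom D zE zV' offE offV'
      W1inf_measurable[OF wM] W1inf_measurable[OF we] M_bd e_bd]
  let ?IP1 = "LINT x|lebesgue_on U. (matrix_inv (\<mu> x) *v ?WP x) \<odot> conj_vec (?WV x)"
  let ?IP2 = "LINT x|lebesgue_on U. (\<epsilon> x *v ?PE x) \<odot> conj_vec (V x)"
  let ?IE1 = "LINT y|lebesgue_on ?D. (matrix_inv (\<mu> y) *v ?WE y) \<odot> conj_vec (?WV' y)"
  let ?IE2 = "LINT y|lebesgue_on ?D. (\<epsilon> y *v E y) \<odot> conj_vec (V' y)"
  let ?IJ = "LINT x|lebesgue_on U. J x \<odot> conj_vec (V x)"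
  let ?IJ' = "LINT y|lebesgue_on ?D. J y \<odot> conj_vec (V' y)"
  have mJm: "J \<in> borel_measurable (lebesgue_on \<Omega>)"
    by (rule measurable_vecI) (rule W1inf_measurable[OF wJ])
  have iJ: "integrable (lebesgue_on U) (\<lambda>x. J x \<odot> conj_vec (V x))"
    unfolding bdot_commute[of "J _"]
    by (rule integrable_bdot_bounded[OF L2_integrable[OF bounded_open_lmeasurable[OF U(1) Ub] L2_conj[OF LV(1)]]
        measurable_lebesgue_on_subset[OF mJm U(2)] sub[OF J_bd]])
  have iJ': "integrable (lebesgue_on ?D) (\<lambda>x. J x \<odot> conj_vec (V' x))"
    unfolding bdot_commute[of "J _"]
    by (rule integrable_bdot_bounded[OF L2_integrable[OF bounded_open_lmeasurable[OF D(1) Db] L2_conj[OF LV']]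
        measurable_lebesgue_on_subset[OF mJm D(2)] subD[OF J_bd]])

  have inv: "AE x in lebesgue_on U. S.dT (T x) ** T.dT x = mat 1 \<and> T.dT x ** S.dT (T x) = mat 1"
    by (rule sub[OF AE_inverse_jacobian])
  let ?w = "\<lambda>x. ?WE (T x)" and ?u = "\<lambda>x. E (T x)"
  \<comment> \<open>The determinant from the change of variables absorbs the Jacobian of the
    inverse: with A and B as the Jacobians of \<open>T\<close> and \<open>S\<close>, det A cof B = A
    and det A B = cof A. Afterwards only A and its cofactors act on \<open>V\<close>.\<close>
  have alg: "AE x in lebesgue_on U. \<forall>a.
      det (T.dT x) *\<^sub>R (a \<odot> conj_vec (?WV' (T x))) = a \<odot> (complex_mat (T.dT x) *v conj_vec (?WV x)) \<and>
      det (T.dT x) *\<^sub>R (a \<odot> conj_vec (V' (T x)))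
        = a \<odot> (complex_mat (transpose (cofactor_matrix (T.dT x))) *v conj_vec (V x))"
    using inv AE_space
  proof eventually_elim
    case (elim x)
    let ?A = "T.dT x" and ?B = "S.dT (T x)"
    have x: "S (T x) = x" "T x \<in> ?D" using elim(2) U(2) ST by auto
    have dd: "det ?A * det ?B = 1" using elim(1) by (metis det_I det_mul)
    have cA: "cofactor_matrix ?A = det ?A *\<^sub>R ?B" using elim(1) cofactor_eq_det_inverse by blast
    have cB: "cofactor_matrix ?B = det ?B *\<^sub>R ?A" using elim(1) cofactor_eq_det_inverse by blast
    have tr: "transpose (cofactor_matrix ?A) = det ?A *\<^sub>R transpose ?B"
      unfolding cA by (simp add: transpose_def vec_eq_iff)
    show ?case
    proof (intro allI conjI)
      fix a
      show "det ?A *\<^sub>R (a \<odot> conj_vec (?WV' (T x))) = a \<odot> (complex_mat ?A *v conj_vec (?WV x))"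
        unfolding cB complex_mat_scaleR_mult x conj_vec_scaleR conj_complex_mat_mult by (simp add: bdot_simps dd)
      show "det ?A *\<^sub>R (a \<odot> conj_vec (V' (T x))) = a \<odot> (complex_mat (transpose (cofactor_matrix ?A)) *v conj_vec (V x))"
        unfolding tr complex_mat_scaleR_mult using x by (simp add: V'_def conj_complex_mat_mult bdot_simps)
    qed
  qed
  have cofd: "\<forall>k j. \<bar>cofactor_matrix A $ k $ j - (mat 1 :: real^3^3) $ k $ j\<bar> \<le> 6 * d"
    if "\<forall>k j. \<bar>A $ k $ j - (mat 1 :: real^3^3) $ k $ j\<bar> \<le> d" for A :: "real^3^3"
    using that by (intro allI cofactor_near_id d(2)) blast
  have trd: "\<forall>k j. \<bar>transpose A $ k $ j - (mat 1 :: real^3^3) $ k $ j\<bar> \<le> c"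
    if "\<forall>k j. \<bar>A $ k $ j - (mat 1 :: real^3^3) $ k $ j\<bar> \<le> c" for A :: "real^3^3" and c
  proof (intro allI)
    fix k j
    show "\<bar>transpose A $ k $ j - (mat 1 :: real^3^3) $ k $ j\<bar> \<le> c"
    proof -
      have "(mat 1 :: real^3^3) $ k $ j = (mat 1 :: real^3^3) $ j $ k" by (auto simp: mat_def)
      then show ?thesis using that[rule_format, of j k] by (simp add: transpose_def)
    qed
  qed
  have six: "\<forall>k j. \<bar>A $ k $ j - (mat 1 :: real^3^3) $ k $ j\<bar> \<le> 6 * d"
    if "\<forall>k j. \<bar>A $ k $ j - (mat 1 :: real^3^3) $ k $ j\<bar> \<le> d" for A :: "real^3^3"
  proof (intro allI)
    fix k j
    show "\<bar>A $ k $ j - (mat 1 :: real^3^3) $ k $ j\<bar> \<le> 6 * d"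
      using that[rule_format, of k j] d(1) by linarith
  qed
  let ?\<kappa> = "3000 * m * d"
  have \<kappa>: "0 \<le> ?\<kappa>" using m d by simp
  have Lw: "L2 U ?w" "L2 U ?u"
    using L2_compose(1)[OF U _ cT] LE by auto
  \<comment> \<open>The change of variables gives the factor 48 for squares, rounded up to 49 = 7 *
    7.\<close>
  have Nw: "L2_norm U (\<lambda>x. F (T x)) \<le> 7 * L2_norm ?D F" if F: "L2 ?D F" for F
  proof -
    have "(L2_norm U (\<lambda>x. F (T x)))\<^sup>2 \<le> 48 * (L2_norm ?D F)\<^sup>2"
      unfolding L2_norm_sq using L2_compose(2)[OF U _ cT F] by simp
    also have "\<dots> \<le> (7 * L2_norm ?D F)\<^sup>2" by (simp add: power_mult_distrib)
    finally show ?thesis by (rule power2_le_imp_le) (simp add: L2_norm_nonneg)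
  qed
  have cb1: "?IE1 = (LINT x|lebesgue_on U. \<bar>det (T.dT x)\<bar> *\<^sub>R ((matrix_inv (\<mu> (T x)) *v ?WE (T x)) \<odot> conj_vec (?WV' (T x))))"
    by (rule change_variables(2)[OF U PhiE(2), symmetric])
  \<comment> \<open>The curl term: cofactors act on the curl of \<open>E\<close>, the Jacobian
    itself on the curl of \<open>V\<close>, so these are \<open>P\<close> and \<open>Q\<close> in
    \<open>perturbed_form_bound\<close>.\<close>
  have b1: "cmod (?IP1 - ?IE1) \<le> ?\<kappa> * (L2_norm U ?w * L2_norm U ?WV)"
    unfolding cb1 L2_norm_conj[of U ?WV, symmetric]
  proof (rule integral_diff_bound[OF PhiP(2) change_variables(1)[OF U PhiE(2)] Lw(1) L2_conj[OF LV(2)] \<kappa>])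
    show "AE x in lebesgue_on U. cmod ((matrix_inv (\<mu> x) *v ?WP x) \<odot> conj_vec (?WV x)
        - \<bar>det (T.dT x)\<bar> *\<^sub>R ((matrix_inv (\<mu> (T x)) *v ?WE (T x)) \<odot> conj_vec (?WV' (T x))))
        \<le> ?\<kappa> * (norm (?w x) * norm (conj_vec (?WV x)))"
      using alg cT sub[OF M_bd] subT[OF M_bd] M_Lip sub[OF dA]
    proof eventually_elim
      case (elim x)
      have eq: "\<bar>det (T.dT x)\<bar> *\<^sub>R ((matrix_inv (\<mu> (T x)) *v ?WE (T x)) \<odot> conj_vec (?WV' (T x)))
        = (matrix_inv (\<mu> (T x)) *v ?WE (T x)) \<odot> (complex_mat (T.dT x) *v conj_vec (?WV x))"
        using elim(2) elim(1)[rule_format, of "matrix_inv (\<mu> (T x)) *v ?WE (T x)", THEN conjunct1] by simp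
      show ?case
        unfolding eq
        by (rule perturbed_form_bound[OF elim(3)[rule_format] elim(4)[rule_format] elim(5)[rule_format]
              cofd[OF elim(6), rule_format] six[OF elim(6), rule_format] m d(1)])
    qed
  qed
  have cb2: "?IE2 = (LINT x|lebesgue_on U. \<bar>det (T.dT x)\<bar> *\<^sub>R ((\<epsilon> (T x) *v E (T x)) \<odot> conj_vec (V' (T x))))"
    by (rule change_variables(2)[OF U PhiE(3), symmetric])
  \<comment> \<open>The zeroth order term: the roles of Jacobian and cofactors are interchanged, and
    both appear transposed.\<close>
  have b2: "cmod (?IP2 - ?IE2) \<le> ?\<kappa> * (L2_norm U ?u * L2_norm U V)"
    unfolding cb2 L2_norm_conj[of U V, symmetric]
  proof (rule integral_diff_bound[OF PhiP(3) change_variables(1)[OF U PhiE(3)] Lw(2) L2_conj[OF LV(1)] \<kappa>])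
    show "AE x in lebesgue_on U. cmod ((\<epsilon> x *v ?PE x) \<odot> conj_vec (V x)
        - \<bar>det (T.dT x)\<bar> *\<^sub>R ((\<epsilon> (T x) *v E (T x)) \<odot> conj_vec (V' (T x))))
        \<le> ?\<kappa> * (norm (?u x) * norm (conj_vec (V x)))"
      using alg cT sub[OF e_bd] subT[OF e_bd] e_Lip sub[OF dA] AE_space
    proof eventually_elim
      case (elim x)
      have eq: "\<bar>det (T.dT x)\<bar> *\<^sub>R ((\<epsilon> (T x) *v E (T x)) \<odot> conj_vec (V' (T x)))
        = (\<epsilon> (T x) *v E (T x)) \<odot> (complex_mat (transpose (cofactor_matrix (T.dT x))) *v conj_vec (V x))"
        using elim(2) elim(1)[rule_format, of "\<epsilon> (T x) *v E (T x)", THEN conjunct2] by simp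
      have eq': "?PE x = complex_mat (transpose (T.dT x)) *v E (T x)"
        using elim(7) by (simp add: pull_back_def)
      show ?case
        unfolding eq eq'
        by (rule perturbed_form_bound[OF elim(3)[rule_format] elim(4)[rule_format] elim(5)[rule_format]
              trd[OF six[OF elim(6)], rule_format] trd[OF cofd[OF elim(6)], rule_format] m d(1)])
    qed
  qed
  have cb3: "?IJ' = (LINT x|lebesgue_on U. \<bar>det (T.dT x)\<bar> *\<^sub>R (J (T x) \<odot> conj_vec (V' (T x))))"
    by (rule change_variables(2)[OF U iJ', symmetric])
  \<comment> \<open>The constant unit field takes the place of \<open>E\<close>; its norm later
    yields the square root of the volume.\<close>
  have b3: "cmod (?IJ - ?IJ') \<le> ?\<kappa> * (L2_norm U (\<lambda>_. axis 1 1) * L2_norm U V)"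
    unfolding cb3 L2_norm_conj[of U V, symmetric]
  proof (rule integral_diff_bound[OF iJ change_variables(1)[OF U iJ'] L2_const[OF bounded_open_lmeasurable[OF U(1) Ub]] L2_conj[OF LV(1)] \<kappa>])
    show "AE x in lebesgue_on U. cmod (J x \<odot> conj_vec (V x)
        - \<bar>det (T.dT x)\<bar> *\<^sub>R (J (T x) \<odot> conj_vec (V' (T x))))
        \<le> ?\<kappa> * (norm (axis 1 1 :: complex^3) * norm (conj_vec (V x)))"
      using alg cT subT[OF J_bd] J_Lip sub[OF dA]
    proof eventually_elim
      case (elim x)
      have eq: "\<bar>det (T.dT x)\<bar> *\<^sub>R (J (T x) \<odot> conj_vec (V' (T x)))
        = J (T x) \<odot> (complex_mat (transpose (cofactor_matrix (T.dT x))) *v conj_vec (V x))"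
        using elim(2) elim(1)[rule_format, of "J (T x)", THEN conjunct2] by simp
      have "cmod (J x \<odot> conj_vec (V x) - J (T x) \<odot> (complex_mat (transpose (cofactor_matrix (T.dT x))) *v conj_vec (V x)))
        \<le> ?\<kappa> * norm (conj_vec (V x))"
        by (rule perturbed_load_bound[OF elim(3,4) trd[OF cofd[OF elim(5)], rule_format] m d(1)])
      then show ?case unfolding eq by (simp add: norm_axis_1)
    qed
  qed
  have one: "L2_norm U (\<lambda>_. axis 1 1) \<le> sqrt (measure lebesgue \<Omega>)"
  proof -
    have "measure lebesgue U \<le> measure lebesgue \<Omega>"
      by (rule measure_mono_fmeasurable[OF U(2) Us T.lmeasurable_dom])
    then show ?thesis
      unfolding L2_norm_def using Us by (simp add: norm_axis_1 measure_restrict_space)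
  qed
  have FV: "Frhs \<Omega> \<omega> J V = - \<i> * complex_of_real \<omega> * ?IJ"
    by (rule Frhs_eq[OF T.sets_dom Us U(2) offV])
  have FV': "Frhs \<Omega> \<omega> J V' = - \<i> * complex_of_real \<omega> * ?IJ'"
    by (rule Frhs_eq[OF T.sets_dom Ds D(2) offV'])
  \<comment> \<open>The equation for \<open>E\<close> tested with \<open>V'\<close>. Subtracting it
    from the residual pairs each integral over \<open>U\<close> with its counterpart over
    \<open>?D\<close>.\<close>
  have zero: "?IE1 - complex_of_real (\<omega>\<^sup>2) * ?IE2 - (- \<i> * complex_of_real \<omega> * ?IJ') = 0"
  proof -
    have "Phi \<Omega> \<omega> \<mu> \<epsilon> E V' = ?IE1 - complex_of_real (\<omega>\<^sup>2) * ?IE2" by (rule PhiE(1))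
    then show ?thesis using Esol[OF V'H] unfolding FV' by simp
  qed
  have PP: "Phi \<Omega> \<omega> \<mu> \<epsilon> ?PE V = ?IP1 - complex_of_real (\<omega>\<^sup>2) * ?IP2" by (rule PhiP(1))
  have eq: "Phi \<Omega> \<omega> \<mu> \<epsilon> ?PE V - Frhs \<Omega> \<omega> J V
      = (?IP1 - ?IE1) - complex_of_real (\<omega>\<^sup>2) * (?IP2 - ?IE2) + \<i> * complex_of_real \<omega> * (?IJ - ?IJ')"
    using zero unfolding PP FV by (simp add: algebra_simps)
  have tri: "cmod (a - complex_of_real (\<omega>\<^sup>2) * b + \<i> * complex_of_real \<omega> * c) \<le> p + \<omega>\<^sup>2 * q + \<omega> * r"
    if "cmod a \<le> p" "cmod b \<le> q" "cmod c \<le> r" for a b c p q r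
  proof -
    have "cmod (complex_of_real (\<omega>\<^sup>2) * b) = \<omega>\<^sup>2 * cmod b" "cmod (\<i> * complex_of_real \<omega> * c) = \<omega> * cmod c"
      using \<omega> by (simp_all add: norm_mult norm_power)
    moreover have "\<omega>\<^sup>2 * cmod b \<le> \<omega>\<^sup>2 * q" "\<omega> * cmod c \<le> \<omega> * r"
      using that \<omega> by (auto intro: mult_left_mono)
    ultimately show ?thesis
      using that(1) norm_triangle_ineq[of "a - complex_of_real (\<omega>\<^sup>2) * b" "\<i> * complex_of_real \<omega> * c"]
        norm_triangle_ineq4[of a "complex_of_real (\<omega>\<^sup>2) * b"] by linarith
  qed
  have n7: "0 \<le> 7 * L2_norm ?D F" for F by (simp add: L2_norm_nonneg)
  have h1: "L2_norm U ?w * L2_norm U ?WV \<le> 7 * L2_norm ?D ?WE * Hcurl_norm U V"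
    by (rule mult_mono[OF Nw[OF LE(2)] L2_norm_le_Hcurl_norm(2) n7 L2_norm_nonneg])
  have h2: "L2_norm U ?u * L2_norm U V \<le> 7 * L2_norm ?D E * Hcurl_norm U V"
    by (rule mult_mono[OF Nw[OF LE(1)] L2_norm_le_Hcurl_norm(1) n7 L2_norm_nonneg])
  have h3: "L2_norm U (\<lambda>_. axis 1 1) * L2_norm U V \<le> sqrt (measure lebesgue \<Omega>) * Hcurl_norm U V"
    by (rule mult_mono[OF one L2_norm_le_Hcurl_norm(1) _ L2_norm_nonneg]) simp
  note 1 = order_trans[OF b1 mult_left_mono[OF h1 \<kappa>]]
  note 2 = order_trans[OF b2 mult_left_mono[OF h2 \<kappa>]]
  note 3 = order_trans[OF b3 mult_left_mono[OF h3 \<kappa>]]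
  have total: "?\<kappa> * (7 * L2_norm ?D ?WE * Hcurl_norm U V) + \<omega>\<^sup>2 * (?\<kappa> * (7 * L2_norm ?D E * Hcurl_norm U V))
      + \<omega> * (?\<kappa> * (sqrt (measure lebesgue \<Omega>) * Hcurl_norm U V))
    = 3000 * m * (7 * L2_norm ?D ?WE + \<omega>\<^sup>2 * (7 * L2_norm ?D E) + \<omega> * sqrt (measure lebesgue \<Omega>)) * d * Hcurl_norm U V"
    by (simp add: algebra_simps)
  show "cmod (Phi \<Omega> \<omega> \<mu> \<epsilon> ?PE V - Frhs \<Omega> \<omega> J V)
      \<le> 3000 * m * (7 * L2_norm ?D ?WE + \<omega>\<^sup>2 * (7 * L2_norm ?D E) + \<omega> * sqrt (measure lebesgue \<Omega>)) * d * Hcurl_norm U V"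
    unfolding eq total[symmetric] by (rule tri[OF 1 2 3])
qed

end

section \<open>The error estimate\<close>

text \<open>The selected \<open>weak_curl\<close> of a field that vanishes almost everywhere need
  not be 0 pointwise; but 0 is a curl of the field, so uniqueness makes its norm vanish.\<close>

lemma Hcurl_norm_eq_0:
  assumes \<Omega>: "open \<Omega>" "bounded \<Omega>" and ae: "AE x in lebesgue_on \<Omega>. U x = 0"
  shows "Hcurl_norm \<Omega> U = 0"
proof -
  have \<Omega>s: "\<Omega> \<in> sets lebesgue" using \<Omega> by auto
  have L0: "L2 \<Omega> (\<lambda>_. 0)" by (rule L2_const[OF bounded_open_lmeasurable[OF \<Omega>]])
  have ae': "AE x in lebesgue_on \<Omega>. 0 = U x" using ae by eventually_elim simp
  have LU: "L2 \<Omega> U" by (rule L2_AE_cong[OF \<Omega>s L0 ae'])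
  have "zero_trace_curl \<Omega> U (\<lambda>_. 0)"
    unfolding zero_trace_curl_def
  proof (intro conjI allI impI LU L0)
    fix \<phi> :: "real^3 \<Rightarrow> complex^3" assume "smooth \<phi>"
    have "(LINT x|lebesgue_on \<Omega>. U x \<odot> curl \<phi> x) = 0"
      by (rule integral_eq_zero_AE) (use ae in eventually_elim, simp add: bdot_simps)
    then show "(LINT x|lebesgue_on \<Omega>. 0 \<odot> \<phi> x) = (LINT x|lebesgue_on \<Omega>. U x \<odot> curl \<phi> x)"
      by (simp add: bdot_simps)
  qed
  then have W: "AE x in lebesgue_on \<Omega>. weak_curl \<Omega> U x = 0"
    by (intro weak_curl_eq[OF \<Omega>(1)] zero_trace_has_weak_curl[OF bounded_open_lmeasurable[OF \<Omega>]])
  have "L2_norm \<Omega> V = 0" if "AE x in lebesgue_on \<Omega>. V x = 0" for V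
  proof -
    have "(LINT x|lebesgue_on \<Omega>. (norm (V x))\<^sup>2) = 0"
      by (rule integral_eq_zero_AE) (use that in eventually_elim, simp)
    then show ?thesis by (simp add: L2_norm_def)
  qed
  then show ?thesis using ae W by (simp add: Hcurl_norm_def)
qed

lemma Hcurl_norm_eq_0_imp:
  assumes "L2 \<Omega> U" "Hcurl_norm \<Omega> U = 0"
  shows "AE x in lebesgue_on \<Omega>. U x = 0"
proof -
  have "L2_norm \<Omega> U = 0"
    using L2_norm_le_Hcurl_norm(1)[of \<Omega> U] L2_norm_nonneg[of \<Omega> U] assms(2) by simp
  then have "(LINT x|lebesgue_on \<Omega>. (norm (U x))\<^sup>2) = 0" by (simp add: L2_norm_def)
  then have "AE x in lebesgue_on \<Omega>. (norm (U x))\<^sup>2 = 0"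
    using assms(1) by (subst (asm) integral_nonneg_eq_0_iff_AE) (auto simp: L2_def)
  then show ?thesis by eventually_elim simp
qed

text \<open>For \<open>U = e\<close> the supremum of the quotients is at most \<open>B\<close> over
  the norm of \<open>e\<close>, and the inf-sup condition bounds it below by \<open>C2\<close>. The
  infimum ranges over nonzero elements, so an \<open>e\<close> that vanishes almost everywhere is
  treated separately.\<close>

lemma inf_sup_bound:
  assumes \<Omega>: "open \<Omega>" "bounded \<Omega>" and wp: "well_posed DH \<omega> \<mu> \<epsilon> \<Omega> C1 C2" and C2: "C2 > 0"
    and e: "e \<in> H0curl \<Omega>" and B: "0 \<le> B" and le: "\<And>V. V \<in> H0curl \<Omega> \<Longrightarrow> cmod (Phi DH \<omega> \<mu> \<epsilon> e V) \<le> B * Hcurl_norm \<Omega> V"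
  shows "Hcurl_norm \<Omega> e \<le> B / C2"
proof (cases "AE x in lebesgue_on \<Omega>. e x = 0")
  case True
  then show ?thesis using Hcurl_norm_eq_0[OF \<Omega>] B C2 by simp
next
  case False
  have pos: "Hcurl_norm \<Omega> V > 0" if V: "V \<in> H0curl_nz \<Omega>" for V
  proof -
    have "L2 \<Omega> V" using V by (auto simp: H0curl_nz_def H0curl_def Hcurl_def)
    then have "Hcurl_norm \<Omega> V \<noteq> 0"
      using V Hcurl_norm_eq_0_imp by (auto simp: H0curl_nz_def)
    then show ?thesis using Hcurl_norm_nonneg[of \<Omega> V] by simp
  qed
  have enz: "e \<in> H0curl_nz \<Omega>" using e False by (simp add: H0curl_nz_def)
  let ?q = "\<lambda>U V. ereal (cmod (Phi DH \<omega> \<mu> \<epsilon> U V) / (Hcurl_norm \<Omega> U * Hcurl_norm \<Omega> V))"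
  have "ereal C2 \<le> (INF U\<in>H0curl_nz \<Omega>. SUP V\<in>H0curl_nz \<Omega>. ?q U V)"
    using wp by (simp add: well_posed_def)
  also have "\<dots> \<le> (SUP V\<in>H0curl_nz \<Omega>. ?q e V)"
    by (rule INF_lower[OF enz])
  also have "\<dots> \<le> ereal (B / Hcurl_norm \<Omega> e)"
  proof (rule SUP_least)
    fix V assume V: "V \<in> H0curl_nz \<Omega>"
    then have "cmod (Phi DH \<omega> \<mu> \<epsilon> e V) \<le> B * Hcurl_norm \<Omega> V" by (intro le) (simp add: H0curl_nz_def)
    then have "cmod (Phi DH \<omega> \<mu> \<epsilon> e V) / (Hcurl_norm \<Omega> e * Hcurl_norm \<Omega> V)
        \<le> (B * Hcurl_norm \<Omega> V) / (Hcurl_norm \<Omega> e * Hcurl_norm \<Omega> V)"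
      using pos[OF V] pos[OF enz] by (intro divide_right_mono) auto
    also have "\<dots> = B / Hcurl_norm \<Omega> e" using pos[OF V] by simp
    finally show "?q e V \<le> ereal (B / Hcurl_norm \<Omega> e)" by simp
  qed
  finally have "C2 \<le> B / Hcurl_norm \<Omega> e" by simp
  then show ?thesis using pos[OF enz] C2 by (simp add: pos_le_divide_eq mult.commute)
qed

text \<open>Linearity is not immediate: \<open>weak_curl\<close> selects representatives, and an
  integral splits only when the parts are integrable. \<open>Phi_eq\<close> settles both, with one
  bound \<open>m\<close> for all coefficient entries.\<close>

lemma Phi_diff:
  assumes DH: "open DH" "bounded DH" and D: "open D" "D \<subseteq> DH"
    and U: "U \<in> H0curl D" "U' \<in> H0curl D" and V: "V \<in> H0curl D"
    and mM: "\<And>k j. Linf DH (\<lambda>x. matrix_inv (\<mu> x) $ k $ j)" and me: "\<And>k j. Linf DH (\<lambda>x. \<epsilon> x $ k $ j)"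
  shows "(\<lambda>x. U x - U' x) \<in> H0curl D"
    and "Phi DH \<omega> \<mu> \<epsilon> (\<lambda>x. U x - U' x) V = Phi DH \<omega> \<mu> \<epsilon> U V - Phi DH \<omega> \<mu> \<epsilon> U' V"
proof -
  have Db: "bounded D" using D DH bounded_subset by blast
  note hU = H0curlD[OF D(1) Db U(1)] and hU' = H0curlD[OF D(1) Db U(2)] and hV = H0curlD[OF D(1) Db V]
  have z: "zero_trace_curl D (\<lambda>x. U x - U' x) (\<lambda>x. weak_curl D U x - weak_curl D U' x)"
    by (rule zero_trace_diff[OF D(1) Db hU(1) hU'(1)])
  have off: "U x - U' x = 0" if "x \<notin> D" for x using hU(2)[OF that] hU'(2)[OF that] by simp
  show "(\<lambda>x. U x - U' x) \<in> H0curl D" by (rule H0curlI(1)[OF D(1) Db z off])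
  have bd: "AE x in lebesgue_on DH. cmod (f x) \<le> Linf_norm DH f" if "Linf DH f" for f :: "real^3 \<Rightarrow> complex"
    using Linf_norm_AE[OF that] .
  define m where "m = (\<Sum>k\<in>UNIV. \<Sum>j\<in>UNIV. Linf_norm DH (\<lambda>x. matrix_inv (\<mu> x) $ k $ j) + Linf_norm DH (\<lambda>x. \<epsilon> x $ k $ j))"
  have le: "Linf_norm DH (\<lambda>x. matrix_inv (\<mu> x) $ k $ j) + Linf_norm DH (\<lambda>x. \<epsilon> x $ k $ j) \<le> m" for k j :: 3
  proof -
    let ?f = "\<lambda>k j. Linf_norm DH (\<lambda>x. matrix_inv (\<mu> x) $ k $ j) + Linf_norm DH (\<lambda>x. \<epsilon> x $ k $ j)"
    have nn: "0 \<le> ?f k j" for k j by (simp add: Linf_norm_nonneg)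
    have "?f k j \<le> (\<Sum>j\<in>UNIV. ?f k j)" using nn by (intro member_le_sum) auto
    also have "\<dots> \<le> (\<Sum>k\<in>UNIV. \<Sum>j\<in>UNIV. ?f k j)"
      using nn by (intro member_le_sum[of k UNIV "\<lambda>k. \<Sum>j\<in>UNIV. ?f k j"] sum_nonneg) auto
    finally show ?thesis by (simp add: m_def)
  qed
  have bM: "AE x in lebesgue_on DH. \<forall>k j. cmod (matrix_inv (\<mu> x) $ k $ j) \<le> m"
  proof (rule AE_matI)
    fix k j
    show "AE x in lebesgue_on DH. cmod (matrix_inv (\<mu> x) $ k $ j) \<le> m"
      using bd[OF mM[of k j]] by eventually_elim (use le[of k j] Linf_norm_nonneg[of DH "\<lambda>x. \<epsilon> x $ k $ j"] in linarith)
  qed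
  have be: "AE x in lebesgue_on DH. \<forall>k j. cmod (\<epsilon> x $ k $ j) \<le> m"
  proof (rule AE_matI)
    fix k j
    show "AE x in lebesgue_on DH. cmod (\<epsilon> x $ k $ j) \<le> m"
      using bd[OF me[of k j]] by eventually_elim (use le[of k j] Linf_norm_nonneg[of DH "\<lambda>x. matrix_inv (\<mu> x) $ k $ j"] in linarith)
  qed
  have mM': "(\<lambda>x. matrix_inv (\<mu> x) $ k $ j) \<in> borel_measurable (lebesgue_on DH)"
    and me': "(\<lambda>x. \<epsilon> x $ k $ j) \<in> borel_measurable (lebesgue_on DH)" for k j
    using mM me by (auto simp: Linf_def)
  note P = Phi_eq[OF DH D hU(1) hV(1) hU(2) hV(2) mM' me' bM be]
  note P' = Phi_eq[OF DH D hU'(1) hV(1) hU'(2) hV(2) mM' me' bM be]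
  note Pd = Phi_eq[OF DH D z hV(1) off hV(2) mM' me' bM be]
  have 1: "(LINT x|lebesgue_on D. (matrix_inv (\<mu> x) *v (weak_curl D U x - weak_curl D U' x)) \<odot> conj_vec (weak_curl D V x))
    = (LINT x|lebesgue_on D. (matrix_inv (\<mu> x) *v weak_curl D U x) \<odot> conj_vec (weak_curl D V x))
      - (LINT x|lebesgue_on D. (matrix_inv (\<mu> x) *v weak_curl D U' x) \<odot> conj_vec (weak_curl D V x))"
    unfolding matrix_vector_mult_diff_distrib bdot_simps by (rule Bochner_Integration.integral_diff[OF P(2) P'(2)])
  have 2: "(LINT x|lebesgue_on D. (\<epsilon> x *v (U x - U' x)) \<odot> conj_vec (V x))
    = (LINT x|lebesgue_on D. (\<epsilon> x *v U x) \<odot> conj_vec (V x)) - (LINT x|lebesgue_on D. (\<epsilon> x *v U' x) \<odot> conj_vec (V x))"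
    unfolding matrix_vector_mult_diff_distrib bdot_simps by (rule Bochner_Integration.integral_diff[OF P(3) P'(3)])
  show "Phi DH \<omega> \<mu> \<epsilon> (\<lambda>x. U x - U' x) V = Phi DH \<omega> \<mu> \<epsilon> U V - Phi DH \<omega> \<mu> \<epsilon> U' V"
  proof -
    let ?I = "\<lambda>W. LINT x|lebesgue_on D. (matrix_inv (\<mu> x) *v W x) \<odot> conj_vec (weak_curl D V x)"
    let ?I' = "\<lambda>W. LINT x|lebesgue_on D. (\<epsilon> x *v W x) \<odot> conj_vec (V x)"
    have p: "Phi DH \<omega> \<mu> \<epsilon> U V = ?I (weak_curl D U) - complex_of_real (\<omega>\<^sup>2) * ?I' U" by (rule P(1))
    have p': "Phi DH \<omega> \<mu> \<epsilon> U' V = ?I (weak_curl D U') - complex_of_real (\<omega>\<^sup>2) * ?I' U'" by (rule P'(1))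
    have pd: "Phi DH \<omega> \<mu> \<epsilon> (\<lambda>x. U x - U' x) V
        = ?I (\<lambda>x. weak_curl D U x - weak_curl D U' x) - complex_of_real (\<omega>\<^sup>2) * ?I' (\<lambda>x. U x - U' x)" by (rule Pd(1))
    show ?thesis unfolding p p' pd 1 2 by (simp add: algebra_simps)
  qed
qed

theorem theorem4p18:
  fixes D DH :: "(real^3) set" and Dt :: "nat \<Rightarrow> (real^3) set"
    and T :: "nat \<Rightarrow> real^3 \<Rightarrow> real^3"
    and M :: nat and \<omega> :: real
    and \<mu> \<epsilon> :: "real^3 \<Rightarrow> complex^3^3"
    and J E :: "real^3 \<Rightarrow> complex^3"
    and Et :: "nat \<Rightarrow> real^3 \<Rightarrow> complex^3"
  assumes "bounded_Ck_domain M D"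
    and "\<And>i. bounded_Lipschitz_domain (Dt i)"
    and "bounded_Lipschitz_domain DH"
    and "closure D \<subseteq> DH"
    and "\<And>i. closure (Dt i) \<subseteq> DH"
    and "maxwell_data DH \<omega> \<mu> \<epsilon> J"
    and "\<exists>C1>0. \<exists>C2>0. well_posed DH \<omega> \<mu> \<epsilon> D C1 C2"
    and "uniformly_well_posed DH \<omega> \<mu> \<epsilon> Dt"
    and "admissible_approximation DH D Dt T"
    and "maxwell_solution DH \<omega> \<mu> \<epsilon> J D E"
    and "\<And>i. maxwell_solution DH \<omega> \<mu> \<epsilon> J (Dt i) (Et i)"
    and "\<And>k l. W1inf DH (\<lambda>x. matrix_inv (\<mu> x) $ k $ l)"
    and "\<And>k l. W1inf DH (\<lambda>x. \<epsilon> x $ k $ l)"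
    and "\<And>k. W1inf DH (\<lambda>x. J x $ k)"
  shows "\<exists>C>0. \<forall>i.
    Hcurl_norm (Dt i) (\<lambda>x. pull_back DH (Dt i) (T i) E x - Et i x)
      \<le> C * d1 DH (T i) * (Hcurl_norm D E + W1inf_norm DH J)"
proof -
  define Q where "Q = Hcurl_norm D E + W1inf_norm DH J"
  define d where "d i = d1 DH (T i)" for i
  define e where "e i = (\<lambda>x. pull_back DH (Dt i) (T i) E x - Et i x)" for i
  have DH: "open DH" "bounded DH" and D: "open D" "bounded D" and Dt: "\<And>i. open (Dt i)" "\<And>i. bounded (Dt i)"
    using assms(1,2,3) by (auto simp: bounded_Ck_domain_def bounded_Lipschitz_domain_def bounded_domain_def)
  have sub: "D \<subseteq> DH" "\<And>i. Dt i \<subseteq> DH" using assms(4,5) closure_subset by blast+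
  have DHs: "DH \<in> sets lebesgue" using DH by auto
  have Dts: "Dt i \<in> sets lebesgue" for i using Dt by auto
  note adm = assms(9)[unfolded admissible_approximation_def]
  have hom: "W1inf_homeo DH (T i) (inv_into DH (T i))" for i
  proof -
    have b: "bij_betw (T i) DH DH" and c: "continuous_on DH (T i)" "continuous_on DH (inv_into DH (T i))"
      and w: "W1inf DH (T i)" "W1inf DH (inv_into DH (T i))" using adm by auto
    have im: "T i ` DH = DH" and inj: "inj_on (T i) DH" using b by (auto simp: bij_betw_def)
    have m: "W1inf_map DH (T i)" "W1inf_map DH (inv_into DH (T i))"
      using DH c w by (auto intro: W1inf_map.intro)
    show ?thesis
    proof (intro W1inf_homeo.intro m W1inf_homeo_axioms.intro)
      fix x assume x: "x \<in> DH"
      show "T i x \<in> DH" using x im by blast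
      show "inv_into DH (T i) x \<in> DH" using x im inv_into_into by metis
      show "inv_into DH (T i) (T i x) = x" using inv_into_f_f[OF inj x] .
      show "T i (inv_into DH (T i) x) = x" using x im f_inv_into_f by metis
    qed
  qed
  have img: "T i ` Dt i = D" for i using adm by (auto simp: bij_betw_def)
  have dlim: "d \<longlonglongrightarrow> 0" and dec: "\<And>i. d (Suc i) < d i" using adm by (auto simp: d_def[abs_def])
  \<comment> \<open>A strictly decreasing sequence stays above its limit 0. Positivity is what later
    allows division by \<open>d i\<close>.\<close>
  have dpos: "d i > 0" for i
  proof -
    have "decseq d" using dec by (intro decseq_SucI) (simp add: less_imp_le)
    then have "0 \<le> d (Suc i)" using dlim by (rule decseq_ge)
    then show ?thesis using dec[of i] by simp
  qed
  have dle: "W1inf_norm DH (\<lambda>x. T i x - x) \<le> d i" "W1inf_norm DH (\<lambda>x. inv_into DH (T i) x - x) \<le> d i" for i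
    unfolding d_def d1_def using W1inf_norm_nonneg[of DH "\<lambda>x. T i x - x"] W1inf_norm_nonneg[of DH "\<lambda>x. inv_into DH (T i) x - x"]
    by linarith+
  have det: "AE x in lebesgue_on DH. 0 < det (weak_jacobian DH (T i) x)" for i using adm by blast
  have EH: "E \<in> H0curl D" using assms(10) by (simp add: maxwell_solution_def)
  have EtH: "Et i \<in> H0curl (Dt i)" and Etsol: "\<And>V. V \<in> H0curl (Dt i) \<Longrightarrow> Phi DH \<omega> \<mu> \<epsilon> (Et i) V = Frhs DH \<omega> J V" for i
    using assms(11)[of i] by (auto simp: maxwell_solution_def)
  obtain C1 C2 where C2: "C2 > 0" and wp: "\<And>i. well_posed DH \<omega> \<mu> \<epsilon> (Dt i) C1 C2"
    using assms(8) by (auto simp: uniformly_well_posed_def)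
  have \<omega>: "\<omega> > 0" using assms(6) by (simp add: maxwell_data_def)
  have Qn: "0 \<le> Hcurl_norm D E" "0 \<le> W1inf_norm DH J" by (auto simp: Hcurl_norm_nonneg W1inf_norm_nonneg)
  have "\<exists>C>0. \<forall>i. Hcurl_norm (Dt i) (e i) \<le> C * d i * Q"
  proof (cases "Q = 0")
    case True
    then have zeroE: "Hcurl_norm D E = 0" and zeroJ: "W1inf_norm DH J = 0" using Qn by (auto simp: Q_def)
    have "AE y in lebesgue_on D. E y = 0"
      using EH zeroE by (intro Hcurl_norm_eq_0_imp) (auto simp: H0curl_def Hcurl_def)
    then have E0: "AE y in lebesgue_on DH. y \<in> D \<longrightarrow> E y = 0"
      using D by (simp add: AE_lebesgue_on_iff DHs) (auto elim: eventually_mono)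
    \<comment> \<open>\<open>Linf_norm\<close> controls a function only once it is known to be
      essentially bounded; for \<open>J\<close> this is assembled from its components.\<close>
    have LJ: "Linf DH J"
    proof -
      have "AE x in lebesgue_on DH. \<forall>k\<in>UNIV. norm (J x $ k) \<le> W1inf_norm DH (\<lambda>x. J x $ k)"
        by (intro AE_finite_allI W1inf_AE_bound assms(14)) auto
      then have "AE x in lebesgue_on DH. norm (J x) \<le> (\<Sum>k\<in>UNIV. W1inf_norm DH (\<lambda>x. J x $ k))"
      proof eventually_elim
        case (elim x)
        have "norm (J x) \<le> (\<Sum>k\<in>UNIV. norm (J x $ k))" using norm_le_sum_nth[of "J x"] by (simp add: sum_3)
        also have "\<dots> \<le> (\<Sum>k\<in>UNIV. W1inf_norm DH (\<lambda>x. J x $ k))" using elim by (intro sum_mono) auto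
        finally show ?case .
      qed
      moreover have "J \<in> borel_measurable (lebesgue_on DH)"
        by (rule measurable_vecI) (rule W1inf_measurable[OF assms(14)])
      ultimately show ?thesis unfolding Linf_def by blast
    qed
    have nJ: "Linf_norm DH J \<le> 0" using W1inf_norm_ge(1)[of DH J] zeroJ by simp
    have J0: "AE x in lebesgue_on DH. J x = 0"
      using Linf_norm_AE[OF LJ]
    proof eventually_elim
      case (elim x)
      then have "norm (J x) \<le> 0" using nJ by linarith
      then show ?case by simp
    qed
    have F0: "Frhs DH \<omega> J V = 0" for V
    proof -
      have "(LINT x|lebesgue_on DH. J x \<odot> conj_vec (V x)) = 0"
        by (rule integral_eq_zero_AE) (use J0 in eventually_elim, simp add: bdot_simps)
      then show ?thesis by (simp add: Frhs_def)
    qed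
    have "Hcurl_norm (Dt i) (e i) = 0" for i
    proof -
      interpret W1inf_homeo DH "T i" "inv_into DH (T i)" by (rule hom)
      \<comment> \<open>With a vanishing right-hand side the inf-sup condition applies with
        \<open>B = 0\<close>; the pull-back of \<open>E\<close> vanishes because \<open>T i\<close>
        preserves null sets under preimages.\<close>
      have "Hcurl_norm (Dt i) (Et i) \<le> 0 / C2"
        by (rule inf_sup_bound[OF Dt wp C2 EtH]) (simp_all add: Etsol F0)
      then have "Hcurl_norm (Dt i) (Et i) = 0" using Hcurl_norm_nonneg[of "Dt i" "Et i"] by simp
      then have Et0: "AE x in lebesgue_on (Dt i). Et i x = 0"
        using EtH[of i] by (intro Hcurl_norm_eq_0_imp) (auto simp: H0curl_def Hcurl_def)
      have "AE x in lebesgue_on (Dt i). T i x \<in> D \<longrightarrow> E (T i x) = 0"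
        by (rule AE_lebesgue_on_subset[OF AE_compose[OF E0] sub(2) DHs Dts])
      with Et0 AE_space have "AE x in lebesgue_on (Dt i). e i x = 0"
      proof eventually_elim
        case (elim x)
        then have "T i x \<in> D" using img[of i] by auto
        then show ?case using elim by (simp add: e_def pull_back_def)
      qed
      then show ?thesis by (rule Hcurl_norm_eq_0[OF Dt])
    qed
    then show ?thesis using True by (intro exI[of _ 1]) simp
  next
    case False
    then have Qpos: "Q > 0" using Qn by (simp add: Q_def)
    \<comment> \<open>Sums instead of maxima: one number dominates the norms of all entries, as
      \<open>residual_bound\<close> requires of \<open>m\<close>.\<close>
    define F where "F = (\<Sum>k\<in>UNIV. \<Sum>j\<in>UNIV. W1inf_norm DH (\<lambda>x. matrix_inv (\<mu> x) $ k $ j) + W1inf_norm DH (\<lambda>x. \<epsilon> x $ k $ j))"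
    define G where "G = (\<Sum>k\<in>UNIV. W1inf_norm DH (\<lambda>x. J x $ k))"
    define m where "m = 3 * (F + G)"
    let ?f = "\<lambda>k j. W1inf_norm DH (\<lambda>x. matrix_inv (\<mu> x) $ k $ j) + W1inf_norm DH (\<lambda>x. \<epsilon> x $ k $ j)"
    have nn: "0 \<le> ?f k j" for k j :: 3 by (simp add: W1inf_norm_nonneg)
    have nG: "0 \<le> G" by (simp add: G_def W1inf_norm_nonneg sum_nonneg)
    have fle: "?f k j \<le> F" for k j :: 3
    proof -
      have "?f k j \<le> (\<Sum>j\<in>UNIV. ?f k j)" using nn by (intro member_le_sum) auto
      also have "\<dots> \<le> (\<Sum>k\<in>UNIV. \<Sum>j\<in>UNIV. ?f k j)"
        using nn by (intro member_le_sum[of k UNIV "\<lambda>k. \<Sum>j\<in>UNIV. ?f k j"] sum_nonneg) auto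
      finally show ?thesis by (simp add: F_def)
    qed
    have mM: "3 * W1inf_norm DH (\<lambda>x. matrix_inv (\<mu> x) $ k $ j) \<le> m" for k j
      using fle[of k j] nG W1inf_norm_nonneg[of DH "\<lambda>x. \<epsilon> x $ k $ j"] by (simp add: m_def)
    have me: "3 * W1inf_norm DH (\<lambda>x. \<epsilon> x $ k $ j) \<le> m" for k j
      using fle[of k j] nG W1inf_norm_nonneg[of DH "\<lambda>x. matrix_inv (\<mu> x) $ k $ j"] by (simp add: m_def)
    have mJ: "3 * (\<Sum>k\<in>UNIV. W1inf_norm DH (\<lambda>x. J x $ k)) \<le> m"
      using order_trans[OF nn fle[of 1 1]] by (simp add: m_def G_def)
    have m0: "0 \<le> m" using order_trans[OF nn fle[of 1 1]] nG by (simp add: m_def)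
    define K where "K = 3000 * m * (7 * L2_norm D (weak_curl D E) + \<omega>\<^sup>2 * (7 * L2_norm D E) + \<omega> * sqrt (measure lebesgue DH))"
    have K0: "0 \<le> K" using m0 \<omega> by (simp add: K_def L2_norm_nonneg)
    have "compact (closure D)" using D by (simp add: compact_closure)
    then obtain r where r: "r > 0" "(\<Union>y\<in>closure D. ball y r) \<subseteq> DH"
      using compact_subset_open_imp_ball_epsilon_subset[OF _ DH(1) assms(4)] by blast
    \<comment> \<open>\<open>residual_bound\<close> asks for balls of radius
      \<open>2 * \<rho>\<close> around points of \<open>D\<close>; compactness of the closure gives
      radius \<open>r\<close>.\<close>
    define \<rho> where "\<rho> = r / 2"
    have \<rho>: "\<rho> > 0" "\<And>y. y \<in> D \<Longrightarrow> ball y (2 * \<rho>) \<subseteq> DH"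
      using r closure_subset[of D] by (auto simp: \<rho>_def)
    have "\<forall>\<^sub>F i in sequentially. d i < min \<rho> 1"
      using dlim \<rho>(1) by (intro order_tendstoD) auto
    then obtain N where N: "\<And>i. i \<ge> N \<Longrightarrow> d i < \<rho> \<and> d i < 1"
      by (auto simp: eventually_sequentially)
    have large: "Hcurl_norm (Dt i) (e i) \<le> K * d i / C2" if i: "i \<ge> N" for i
    proof -
      interpret W1inf_homeo DH "T i" "inv_into DH (T i)" by (rule hom)
      have dA: "AE x in lebesgue_on DH. \<forall>k j. \<bar>T.dT x $ k $ j - (mat 1 :: real^3^3) $ k $ j\<bar> \<le> d i"
        using T.W1inf_minus_id(2) by eventually_elim (use dle(1)[of i] in \<open>blast intro: order_trans\<close>)
      have dB: "AE x in lebesgue_on DH. \<forall>k j. \<bar>S.dT x $ k $ j - (mat 1 :: real^3^3) $ k $ j\<bar> \<le> d i"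
        using S.W1inf_minus_id(2) by eventually_elim (use dle(2)[of i] in \<open>blast intro: order_trans\<close>)
      have near: "norm (T i x - x) \<le> d i" if "x \<in> DH" for x
        using T.W1inf_minus_id(1)[OF that] dle(1)[of i] by simp
      have \<rho>': "ball y (2 * \<rho>) \<subseteq> DH" if "y \<in> T i ` Dt i" for y using \<rho>(2) that img by auto
      have di: "0 \<le> d i" "d i \<le> 1" "d i < \<rho>" using dpos[of i] N[OF i] by auto
      have solE: "maxwell_solution DH \<omega> \<mu> \<epsilon> J (T i ` Dt i) E" using assms(10) img by simp
      note res = residual_bound[OF Dt(1) sub(2) di(1,2) dA dB det near di(3) \<rho>' assms(12,13,14) mM me mJ \<omega> solE, unfolded img]
      have PH: "pull_back DH (Dt i) (T i) E \<in> H0curl (Dt i)" using res(1) by blast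
      have Lm: "Linf DH (\<lambda>x. matrix_inv (\<mu> x) $ k $ j)" "Linf DH (\<lambda>x. \<epsilon> x $ k $ j)" for k j
        using assms(12,13) by (auto simp: W1inf_def)
      have "Hcurl_norm (Dt i) (e i) \<le> (K * d i) / C2"
      proof (rule inf_sup_bound[OF Dt wp C2])
        show "e i \<in> H0curl (Dt i)"
          unfolding e_def by (rule Phi_diff(1)[OF DH Dt(1) sub(2) PH EtH EtH Lm])
        show "0 \<le> K * d i" using K0 di by simp
        fix V assume V: "V \<in> H0curl (Dt i)"
        have "Phi DH \<omega> \<mu> \<epsilon> (e i) V = Phi DH \<omega> \<mu> \<epsilon> (pull_back DH (Dt i) (T i) E) V - Frhs DH \<omega> J V"
          unfolding e_def Phi_diff(2)[OF DH Dt(1) sub(2) PH EtH V Lm] Etsol[OF V] ..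
        also have "cmod \<dots> \<le> K * d i * Hcurl_norm (Dt i) V"
          unfolding K_def using res(2) V by blast
        finally show "cmod (Phi DH \<omega> \<mu> \<epsilon> (e i) V) \<le> K * d i * Hcurl_norm (Dt i) V" .
      qed
      then show ?thesis .
    qed
    \<comment> \<open>\<open>E\<close> and \<open>J\<close> are fixed before \<open>C\<close>, so
      \<open>K\<close>, which depends on them, may be divided by \<open>Q > 0\<close>. The sum
      settles the indices below \<open>N\<close>, each term making its own estimate true, and the 1
      ensures \<open>C > 0\<close>.\<close>
    define C where "C = 1 + K / (C2 * Q) + (\<Sum>i<N. Hcurl_norm (Dt i) (e i) / (d i * Q))"
    have s0: "0 \<le> (\<Sum>i<N. Hcurl_norm (Dt i) (e i) / (d i * Q))"
      using Qpos dpos by (intro sum_nonneg divide_nonneg_nonneg mult_nonneg_nonneg) (auto simp: Hcurl_norm_nonneg less_imp_le)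
    have k0: "0 \<le> K / (C2 * Q)" using K0 C2 Qpos by simp
    have "Hcurl_norm (Dt i) (e i) \<le> C * d i * Q" for i
    proof (cases "i < N")
      case True
      have "Hcurl_norm (Dt i) (e i) / (d i * Q) \<le> (\<Sum>i<N. Hcurl_norm (Dt i) (e i) / (d i * Q))"
        using True Qpos dpos
        by (intro member_le_sum divide_nonneg_nonneg mult_nonneg_nonneg) (auto simp: Hcurl_norm_nonneg less_imp_le)
      then have "Hcurl_norm (Dt i) (e i) / (d i * Q) \<le> C" using k0 by (simp add: C_def)
      then show ?thesis using dpos[of i] Qpos by (simp add: pos_divide_le_eq mult.assoc)
    next
      case False
      then have "Hcurl_norm (Dt i) (e i) \<le> K * d i / C2" by (intro large) simp
      also have "\<dots> = K / (C2 * Q) * d i * Q" using Qpos by simp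
      also have "\<dots> \<le> C * d i * Q"
        using s0 dpos[of i] Qpos by (intro mult_right_mono) (auto simp: C_def)
      finally show ?thesis .
    qed
    moreover have "C > 0" using s0 k0 by (simp add: C_def)
    ultimately show ?thesis by blast
  qed
  then show ?thesis by (simp add: e_def d_def Q_def)
qed

end
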